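(* Let $\Gamma \subset \mathsf{Homeo}(M)$ be a non-elementary convergence group and let $\sigma_1, \sigma_2 \colon \Gamma \times M \to \mathbb{R}$ be expanding coarse-cocycles. For $i=1,2$, let $\mu_i$ be a coarse $\sigma_i$-Patterson--Sullivan measure of dimension $\delta_i$. If $\sum_{\gamma\in\Gamma} e^{-\delta_1 \|\gamma\|_{\sigma_1}} = +\infty$, then either: (1) $\mu_1 \perp \mu_2$, or (2) $\mu_1 \ll \mu_2$ and $\mu_2 \ll \mu_1$; moreover, in this case $$\sup_{\gamma \in \Gamma}\left| \delta_1\|\gamma\|_{\sigma_1} - \delta_2\|\gamma\|_{\sigma_2} \right| < \infty.$$
   Context: Convergence groups. $M$ is a compact metrizable space. A subgroup $\Gamma\subset\mathsf{Homeo}(M)$ is a (discrete) convergence group if for every sequence $\{\gamma_n\}$ of distinct elements of $\Gamma$ there are $x,y\in M$ and a subsequence $\{\gamma_{n_j}\}$ such that $\gamma_{n_j}|_{M\smallsetminus\{y\}}$ converges locally uniformly to the constant $x$. The limit set $\Lambda(\Gamma)$ is the set of $x\in M$ for which there are $y\in M$ and a sequence $\{\gamma_n\}\subset\Gamma$ with $\gamma_n|_{M\smallsetminus\{y\}}\to x$ locally uniformly. $\Gamma$ is non-elementary if $\#\Lambda(\Gamma)\ge 3$. An element $\gamma$ is loxodromic if it has two fixed points $\gamma^+\ne\gamma^-$ in $\Lambda(\Gamma)$ such that $\gamma^{\pm n}|_{M\smallsetminus\{\gamma^{\mp}\}}$ converges locally uniformly to $\gamma^{\pm}$ as $n\to+\infty$.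 Compatible metrics. $\Gamma\sqcup M$ carries a unique compact metrizable topology for which the inclusions of $\Gamma$ (discrete) and of $M$ are embeddings and the natural action of $\Gamma$ (left multiplication on $\Gamma$) is a convergence group action. A compatible metric $\mathrm{d}$ is a metric on $\Gamma\sqcup M$ inducing this topology; fix one. Coarse-cocycles. For $\kappa\ge0$, $\sigma\colon\Gamma\times M\to\mathbb{R}$ is a $\kappa$-coarse-cocycle if (i) $\limsup_{x\to x_0}|\sigma(\gamma,x_0)-\sigma(\gamma,x)|\le\kappa$ for all $\gamma\in\Gamma$, $x_0\in M$, and (ii) $|\sigma(\gamma_1\gamma_2,x)-(\sigma(\gamma_1,\gamma_2x)+\sigma(\gamma_2,x))|\le\kappa$ for all $\gamma_1,\gamma_2\in\Gamma$, $x\in M$. A coarse-cocycle is a $\kappa$-coarse-cocycle for some $\kappa$. It is proper if $\sigma(\gamma_n,\gamma_n^+)\to+\infty$ whenever $\{\gamma_n\}\subset\Gamma$ is a sequence of distinct loxodromic elements with $\liminf_n\mathrm{d}(\gamma_n^-,\gamma_n^+)>0$. It is expanding if it is proper and for each $\gamma\in\Gamma$ there is a number $\|\gamma\|_\sigma\in\mathbb{R}$ (the $\sigma$-magnitude) such that for every $\epsilon>0$ there is $C>0$ with $\|\gamma\|_\sigma-C\le\sigma(\gamma,x)\le\|\gamma\|_\sigma+C$ whenever $x\in M$, $\gamma\in\Gamma$ and $\mathrm{d}(x,\gamma^{-1})>\epsilon$ (here $\gamma^{-1}$ is a point of $\Gamma\sqcup M$). The magnitude function is any fixed choice; two choices differ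 by a bounded amount. Patterson--Sullivan measures: a Borel probability measure $\mu$ on $M$ is a $C$-coarse $\sigma$-Patterson--Sullivan measure of dimension $\delta$ if for every $\gamma\in\Gamma$ the measures $\mu$ and $\gamma_*\mu$ are mutually absolutely continuous and $e^{-C-\delta\sigma(\gamma^{-1},\cdot)}\le\frac{d\gamma_*\mu}{d\mu}\le e^{C-\delta\sigma(\gamma^{-1},\cdot)}$ $\mu$-almost everywhere; it is a coarse $\sigma$-Patterson--Sullivan measure if this holds for some $C$. *)

theory Defs
  imports "HOL-Analysis.Analysis"
begin

text \<open>
  The compact metrizable space is a type of class \<open>metric_space\<close> whose universe is compact; the
  compactness is a hypothesis wherever it is needed. The metric \<open>dist\<close> serves only to express
  uniform convergence to a constant, which depends on the topology alone.
\<close>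

text \<open>
  Locally uniform convergence on \<open>S\<close> to the constant \<open>x\<close>, for an explicit metric \<open>d\<close>, so that it
  applies both to \<open>M\<close> (with \<open>dist\<close>) and to the union of \<open>\<Gamma>\<close> and \<open>M\<close> (with a metric on a carrier set).
\<close>

definition loc_unif_to_const ::
    "('a \<Rightarrow> 'a \<Rightarrow> real) \<Rightarrow> 'a set \<Rightarrow> (nat \<Rightarrow> 'a \<Rightarrow> 'a) \<Rightarrow> 'a \<Rightarrow> bool" where
  "loc_unif_to_const d S f x \<longleftrightarrow>
     (\<forall>z\<in>S. \<exists>r>0. \<forall>e>0. \<forall>\<^sub>F n in sequentially. \<forall>w\<in>S. d z w < r \<longrightarrow> d (f n w) x < e)"

definition convergence_action ::
    "'g set \<Rightarrow> ('g \<Rightarrow> 'a \<Rightarrow> 'a) \<Rightarrow> 'a set \<Rightarrow> ('a \<Rightarrow> 'a \<Rightarrow> real) \<Rightarrow> bool" where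
  "convergence_action G act X d \<longleftrightarrow>
     (\<forall>g :: nat \<Rightarrow> 'g. inj g \<and> range g \<subseteq> G \<longrightarrow>
        (\<exists>x\<in>X. \<exists>y\<in>X. \<exists>r :: nat \<Rightarrow> nat. strict_mono r \<and>
           loc_unif_to_const d (X - {y}) (\<lambda>j. act (g (r j))) x))"

definition homeo_group :: "('m::topological_space \<Rightarrow> 'm) set \<Rightarrow> bool" where
  "homeo_group \<Gamma> \<longleftrightarrow>
     (\<forall>\<gamma>\<in>\<Gamma>. homeomorphism UNIV UNIV \<gamma> (inv \<gamma>)) \<and>
     id \<in> \<Gamma> \<and> (\<forall>\<gamma>\<in>\<Gamma>. \<forall>\<eta>\<in>\<Gamma>. \<gamma> \<circ> \<eta> \<in> \<Gamma>) \<and> (\<forall>\<gamma>\<in>\<Gamma>. inv \<gamma> \<in> \<Gamma>)"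

definition convergence_group :: "('m::metric_space \<Rightarrow> 'm) set \<Rightarrow> bool" where
  "convergence_group \<Gamma> \<longleftrightarrow> homeo_group \<Gamma> \<and> convergence_action \<Gamma> (\<lambda>\<gamma>. \<gamma>) UNIV dist"

definition limit_set :: "('m::metric_space \<Rightarrow> 'm) set \<Rightarrow> 'm set" where
  "limit_set \<Gamma> =
     {x. \<exists>y. \<exists>g :: nat \<Rightarrow> 'm \<Rightarrow> 'm. range g \<subseteq> \<Gamma> \<and> loc_unif_to_const dist (UNIV - {y}) g x}"

definition non_elementary :: "('m::metric_space \<Rightarrow> 'm) set \<Rightarrow> bool" where
  "non_elementary \<Gamma> \<longleftrightarrow> infinite (limit_set \<Gamma>) \<or> card (limit_set \<Gamma>) \<ge> 3"

text \<open>\<open>\<gamma>\<close> is a loxodromic element of \<open>\<Gamma>\<close> with attracting point \<open>a\<close> and repelling point \<open>b\<close>.\<close>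

definition loxodromic ::
    "('m::metric_space \<Rightarrow> 'm) set \<Rightarrow> ('m \<Rightarrow> 'm) \<Rightarrow> 'm \<Rightarrow> 'm \<Rightarrow> bool" where
  "loxodromic \<Gamma> \<gamma> a b \<longleftrightarrow>
     \<gamma> \<in> \<Gamma> \<and> a \<in> limit_set \<Gamma> \<and> b \<in> limit_set \<Gamma> \<and> a \<noteq> b \<and> \<gamma> a = a \<and> \<gamma> b = b \<and>
     loc_unif_to_const dist (UNIV - {b}) (\<lambda>n. \<gamma> ^^ n) a \<and>
     loc_unif_to_const dist (UNIV - {a}) (\<lambda>n. inv \<gamma> ^^ n) b"

text \<open>
  The disjoint union of \<open>\<Gamma>\<close> and \<open>M\<close> is \<open>\<Gamma> <+> UNIV\<close>; there \<open>\<gamma>\<close> acts by \<open>map_sum ((\<circ>) \<gamma>) \<gamma>\<close>, that is by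
  left multiplication on \<open>\<Gamma>\<close> and by \<open>\<gamma>\<close> itself on \<open>M\<close>. A metric is compatible if the topology it
  induces has the properties which characterize the compactification.
\<close>

definition compatible_metric ::
    "('m::metric_space \<Rightarrow> 'm) set \<Rightarrow> (('m \<Rightarrow> 'm) + 'm \<Rightarrow> ('m \<Rightarrow> 'm) + 'm \<Rightarrow> real) \<Rightarrow> bool" where
  "compatible_metric \<Gamma> d \<longleftrightarrow>
     Metric_space (\<Gamma> <+> UNIV) d \<and>
     (let T = Metric_space.mtopology (\<Gamma> <+> UNIV) d in
        compact_space T \<and>
        embedding_map (discrete_topology \<Gamma>) T Inl \<and>
        embedding_map euclidean T Inr \<and>
        (\<forall>\<gamma>\<in>\<Gamma>. homeomorphic_map T T (map_sum ((\<circ>) \<gamma>) \<gamma>)) \<and>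
        convergence_action \<Gamma> (\<lambda>\<gamma>. map_sum ((\<circ>) \<gamma>) \<gamma>) (\<Gamma> <+> UNIV) d)"

definition coarse_cocycle_const ::
    "real \<Rightarrow> ('m::metric_space \<Rightarrow> 'm) set \<Rightarrow> (('m \<Rightarrow> 'm) \<Rightarrow> 'm \<Rightarrow> real) \<Rightarrow> bool" where
  "coarse_cocycle_const \<kappa> \<Gamma> \<sigma> \<longleftrightarrow>
     (\<forall>\<gamma>\<in>\<Gamma>. \<forall>x0. Limsup (at x0) (\<lambda>x. ereal \<bar>\<sigma> \<gamma> x0 - \<sigma> \<gamma> x\<bar>) \<le> ereal \<kappa>) \<and>
     (\<forall>\<gamma>1\<in>\<Gamma>. \<forall>\<gamma>2\<in>\<Gamma>. \<forall>x. \<bar>\<sigma> (\<gamma>1 \<circ> \<gamma>2) x - (\<sigma> \<gamma>1 (\<gamma>2 x) + \<sigma> \<gamma>2 x)\<bar> \<le> \<kappa>)"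

definition coarse_cocycle ::
    "('m::metric_space \<Rightarrow> 'm) set \<Rightarrow> (('m \<Rightarrow> 'm) \<Rightarrow> 'm \<Rightarrow> real) \<Rightarrow> bool" where
  "coarse_cocycle \<Gamma> \<sigma> \<longleftrightarrow> (\<exists>\<kappa>\<ge>0. coarse_cocycle_const \<kappa> \<Gamma> \<sigma>)"

definition proper_cocycle ::
    "('m::metric_space \<Rightarrow> 'm) set \<Rightarrow> (('m \<Rightarrow> 'm) + 'm \<Rightarrow> ('m \<Rightarrow> 'm) + 'm \<Rightarrow> real) \<Rightarrow>
     (('m \<Rightarrow> 'm) \<Rightarrow> 'm \<Rightarrow> real) \<Rightarrow> bool" where
  "proper_cocycle \<Gamma> d \<sigma> \<longleftrightarrow>
     (\<forall>(g :: nat \<Rightarrow> 'm \<Rightarrow> 'm) a b.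
        inj g \<and> (\<forall>n. loxodromic \<Gamma> (g n) (a n) (b n)) \<and>
        Liminf sequentially (\<lambda>n. ereal (d (Inr (b n)) (Inr (a n)))) > 0 \<longrightarrow>
        filterlim (\<lambda>n. \<sigma> (g n) (a n)) at_top sequentially)"

text \<open>\<open>N \<gamma>\<close> is a \<open>\<sigma>\<close>-magnitude of \<open>\<gamma>\<close>; the constant \<open>C\<close> depends on \<open>\<epsilon>\<close> but not on \<open>\<gamma>\<close>.\<close>

definition magnitude_function ::
    "('m::metric_space \<Rightarrow> 'm) set \<Rightarrow> (('m \<Rightarrow> 'm) + 'm \<Rightarrow> ('m \<Rightarrow> 'm) + 'm \<Rightarrow> real) \<Rightarrow>
     (('m \<Rightarrow> 'm) \<Rightarrow> 'm \<Rightarrow> real) \<Rightarrow> (('m \<Rightarrow> 'm) \<Rightarrow> real) \<Rightarrow> bool" where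
  "magnitude_function \<Gamma> d \<sigma> N \<longleftrightarrow>
     (\<forall>\<epsilon>>0. \<exists>C>0. \<forall>\<gamma>\<in>\<Gamma>. \<forall>x. d (Inr x) (Inl (inv \<gamma>)) > \<epsilon> \<longrightarrow>
        N \<gamma> - C \<le> \<sigma> \<gamma> x \<and> \<sigma> \<gamma> x \<le> N \<gamma> + C)"

definition expanding_coarse_cocycle ::
    "('m::metric_space \<Rightarrow> 'm) set \<Rightarrow> (('m \<Rightarrow> 'm) + 'm \<Rightarrow> ('m \<Rightarrow> 'm) + 'm \<Rightarrow> real) \<Rightarrow>
     (('m \<Rightarrow> 'm) \<Rightarrow> 'm \<Rightarrow> real) \<Rightarrow> bool" where
  "expanding_coarse_cocycle \<Gamma> d \<sigma> \<longleftrightarrow>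
     coarse_cocycle \<Gamma> \<sigma> \<and> proper_cocycle \<Gamma> d \<sigma> \<and> (\<exists>N. magnitude_function \<Gamma> d \<sigma> N)"

definition PS_measure_const ::
    "real \<Rightarrow> ('m::metric_space \<Rightarrow> 'm) set \<Rightarrow> (('m \<Rightarrow> 'm) \<Rightarrow> 'm \<Rightarrow> real) \<Rightarrow> real \<Rightarrow> 'm measure \<Rightarrow> bool" where
  "PS_measure_const C \<Gamma> \<sigma> \<delta> \<mu> \<longleftrightarrow>
     sets \<mu> = sets borel \<and> emeasure \<mu> UNIV = 1 \<and>
     (\<forall>\<gamma>\<in>\<Gamma>.
        absolutely_continuous \<mu> (distr \<mu> borel \<gamma>) \<and> absolutely_continuous (distr \<mu> borel \<gamma>) \<mu> \<and>
        (AE x in \<mu>.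
           ennreal (exp (- C - \<delta> * \<sigma> (inv \<gamma>) x)) \<le> RN_deriv \<mu> (distr \<mu> borel \<gamma>) x \<and>
           RN_deriv \<mu> (distr \<mu> borel \<gamma>) x \<le> ennreal (exp (C - \<delta> * \<sigma> (inv \<gamma>) x))))"

definition coarse_PS_measure ::
    "('m::metric_space \<Rightarrow> 'm) set \<Rightarrow> (('m \<Rightarrow> 'm) \<Rightarrow> 'm \<Rightarrow> real) \<Rightarrow> real \<Rightarrow> 'm measure \<Rightarrow> bool" where
  "coarse_PS_measure \<Gamma> \<sigma> \<delta> \<mu> \<longleftrightarrow> (\<exists>C. PS_measure_const C \<Gamma> \<sigma> \<delta> \<mu>)"

definition mutually_singular :: "'m::topological_space measure \<Rightarrow> 'm measure \<Rightarrow> bool" where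
  "mutually_singular \<mu> \<nu> \<longleftrightarrow> (\<exists>A\<in>sets borel. emeasure \<mu> A = 0 \<and> emeasure \<nu> (- A) = 0)"

end

theory Submission
  imports Defs
begin

text \<open>
  For a divergent Patterson--Sullivan measure the shadows \<open>\<gamma>(M - B(\<gamma>\<^sup>-\<^sup>1, e))\<close> satisfy a shadow lemma,
  a Vitali covering property and a quasi-independence estimate. A second moment argument shows that
  the points lying in infinitely many shadows have positive measure, and the covering property makes
  almost all of them density points along shadows. Zooming in at a density point of a set \<open>E\<close> gives
  \<open>\<gamma>\<^sub>n\<close> for which \<open>\<gamma>\<^sub>n\<^sup>-\<^sup>1 E\<close> exhausts the measure of \<open>M\<close> away from a single point \<open>b\<close>.
  Applied to an invariant set this is ergodicity, since no point is fixed by the whole group. Applied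
  to a set on which the density \<open>d\<mu>\<^sub>2/d\<mu>\<^sub>1\<close> is bounded above and below, it bounds that density on
  compact subsets of \<open>M - {b}\<close>, hence everywhere by moving \<open>b\<close>; comparing the masses of shadows then
  bounds \<open>\<delta>\<^sub>1 N\<^sub>1 - \<delta>\<^sub>2 N\<^sub>2\<close>. The Poincare series of the second measure therefore diverges too, and its
  ergodicity excludes a singular part.
\<close>

section \<open>Sequences in the compactification\<close>

text \<open>Three obstacles shape the argument. A magnitude is known only through values of the
  cocycle away from \<open>inv \<gamma>\<close>, so estimates on it are uniform only while certain
  points of \<Gamma> and M stay apart in \<open>d\<close>. They are proved by contradiction, along
  subsequences on which the group elements are constant or collapse M minus a point to a point, and
  their constants are not explicit. Secondly, properness is assumed on loxodromic elements only, and
  a sequence whose attracting and repelling points agree need not contain any; it is first composed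
  with an element that moves the attracting point. Thirdly, divergence is assumed for
  \<open>\<mu>1\<close> alone, so the comparison has to be made with a measure whose series is not
  understood: the part of \<open>\<mu>2\<close> absolutely continuous with respect to
  \<open>\<mu>1\<close>. Hence \<open>quasi_conformal\<close> asks for a finite measure and
  inequalities between masses, which restriction to an invariant set preserves, and \<open>N\<close>
  absorbs the dimension.\<close>

locale compactified_group =
  fixes \<Gamma> :: "('m::metric_space \<Rightarrow> 'm) set"
    and d :: "('m \<Rightarrow> 'm) + 'm \<Rightarrow> ('m \<Rightarrow> 'm) + 'm \<Rightarrow> real"
  assumes compact_M: "compact (UNIV :: 'm set)"
    and conv_grp: "convergence_group \<Gamma>"
    and nonel: "non_elementary \<Gamma>"
    and compat: "compatible_metric \<Gamma> d"
begin

abbreviation X where "X \<equiv> \<Gamma> <+> (UNIV :: 'm set)"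

sublocale Metric_space X d
  using compat by (simp add: compatible_metric_def)

abbreviation act :: "('m \<Rightarrow> 'm) \<Rightarrow> ('m \<Rightarrow> 'm) + 'm \<Rightarrow> ('m \<Rightarrow> 'm) + 'm" where
  "act \<gamma> \<equiv> map_sum ((\<circ>) \<gamma>) \<gamma>"

definition cvg :: "(nat \<Rightarrow> ('m \<Rightarrow> 'm) + 'm) \<Rightarrow> ('m \<Rightarrow> 'm) + 'm \<Rightarrow> bool" where
  "cvg s l \<longleftrightarrow> (\<lambda>n. d (s n) l) \<longlonglongrightarrow> 0"

lemma grp: "homeo_group \<Gamma>"
  using conv_grp by (simp add: convergence_group_def)

lemma id_in [simp]: "id \<in> \<Gamma>"
  and comp_in [simp]: "\<gamma> \<in> \<Gamma> \<Longrightarrow> \<eta> \<in> \<Gamma> \<Longrightarrow> \<gamma> \<circ> \<eta> \<in> \<Gamma>"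
  and inv_in [simp]: "\<gamma> \<in> \<Gamma> \<Longrightarrow> inv \<gamma> \<in> \<Gamma>"
  using grp by (auto simp: homeo_group_def)

lemma homeo: "\<gamma> \<in> \<Gamma> \<Longrightarrow> homeomorphism UNIV UNIV \<gamma> (inv \<gamma>)"
  using grp by (auto simp: homeo_group_def)

lemma inv_app [simp]: "\<gamma> \<in> \<Gamma> \<Longrightarrow> \<gamma> (inv \<gamma> x) = x" "\<gamma> \<in> \<Gamma> \<Longrightarrow> inv \<gamma> (\<gamma> x) = x"
  using homeo[of \<gamma>] by (auto simp: homeomorphism_def)

lemma bij_in: "\<gamma> \<in> \<Gamma> \<Longrightarrow> bij \<gamma>"
  using homeo[of \<gamma>] by (auto simp: homeomorphism_def intro: bij_betw_byWitness[where f' = "inv \<gamma>"])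

lemma inj_in: "\<gamma> \<in> \<Gamma> \<Longrightarrow> inj \<gamma>"
  by (simp add: bij_in bij_is_inj)

lemma inj_iff_in: "\<gamma> \<in> \<Gamma> \<Longrightarrow> \<gamma> x = \<gamma> y \<longleftrightarrow> x = y"
  by (simp add: inj_in inj_eq)

lemma cont_in: "\<gamma> \<in> \<Gamma> \<Longrightarrow> continuous_on UNIV \<gamma>"
  using homeo[of \<gamma>] by (auto simp: homeomorphism_def)

lemma inv_inv [simp]: "\<gamma> \<in> \<Gamma> \<Longrightarrow> inv (inv \<gamma>) = \<gamma>"
  by (simp add: bij_in inv_inv_eq)

lemma inv_comp [simp]: "\<gamma> \<in> \<Gamma> \<Longrightarrow> \<eta> \<in> \<Gamma> \<Longrightarrow> inv (\<gamma> \<circ> \<eta>) = inv \<eta> \<circ> inv \<gamma>"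
  by (simp add: bij_in o_inv_distrib)

lemma comp_inv [simp]: "\<gamma> \<in> \<Gamma> \<Longrightarrow> \<gamma> \<circ> inv \<gamma> = id" "\<gamma> \<in> \<Gamma> \<Longrightarrow> inv \<gamma> \<circ> \<gamma> = id"
  by (auto simp: fun_eq_iff)

lemma comp_inv_cancel [simp]:
  "\<gamma> \<in> \<Gamma> \<Longrightarrow> \<gamma> \<circ> (inv \<gamma> \<circ> \<eta>) = \<eta>" "\<gamma> \<in> \<Gamma> \<Longrightarrow> inv \<gamma> \<circ> (\<gamma> \<circ> \<eta>) = \<eta>"
  by (auto simp: fun_eq_iff)

lemma open_image_in: "\<gamma> \<in> \<Gamma> \<Longrightarrow> open S \<Longrightarrow> open (\<gamma> ` S)"
  using homeo[of \<gamma>] homeomorphism_imp_open_map[of UNIV UNIV \<gamma> "inv \<gamma>" S] by simp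

lemma image_eq_vimage_inv: "\<gamma> \<in> \<Gamma> \<Longrightarrow> \<gamma> ` S = inv \<gamma> -` S"
  by (simp add: bij_in bij_vimage_eq_inv_image)

lemma image_in_borel: "\<gamma> \<in> \<Gamma> \<Longrightarrow> S \<in> sets borel \<Longrightarrow> \<gamma> ` S \<in> sets (borel :: 'm measure)"
  using measurable_sets_borel[OF borel_measurable_continuous_onI[OF cont_in[OF inv_in]], of \<gamma> S]
  by (simp add: image_eq_vimage_inv)

lemma pow_in [simp]: "\<gamma> \<in> \<Gamma> \<Longrightarrow> \<gamma> ^^ n \<in> \<Gamma>"
  by (induction n) auto

lemma Inl_X [simp]: "Inl \<gamma> \<in> X \<longleftrightarrow> \<gamma> \<in> \<Gamma>" and Inr_X [simp]: "Inr x \<in> X"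
  by auto

lemma act_X [simp]: "\<gamma> \<in> \<Gamma> \<Longrightarrow> p \<in> X \<Longrightarrow> act \<gamma> p \<in> X"
  by (cases p) auto

lemma act_comp: "act \<gamma> (act \<eta> p) = act (\<gamma> \<circ> \<eta>) p"
  by (cases p) (auto simp: fun_eq_iff)

lemma act_inv [simp]: "\<gamma> \<in> \<Gamma> \<Longrightarrow> act \<gamma> (act (inv \<gamma>) p) = p" "\<gamma> \<in> \<Gamma> \<Longrightarrow> act (inv \<gamma>) (act \<gamma> p) = p"
  by (cases p; simp)+

lemma cvg_limitin: "l \<in> X \<Longrightarrow> (\<And>n. s n \<in> X) \<Longrightarrow> cvg s l \<longleftrightarrow> limitin mtopology s l sequentially"
  by (simp add: limitin_metric_dist_null cvg_def)

lemma cvg_subseq: "cvg s l \<Longrightarrow> strict_mono r \<Longrightarrow> cvg (\<lambda>n. s (r n)) l"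
  unfolding cvg_def using LIMSEQ_subseq_LIMSEQ[of "\<lambda>n. d (s n) l" 0 r] by (simp add: o_def)

lemma d_cvg:
  assumes "cvg s l" "cvg t m" and X: "\<And>n. s n \<in> X" "\<And>n. t n \<in> X" "l \<in> X" "m \<in> X"
  shows "(\<lambda>n. d (s n) (t n)) \<longlonglongrightarrow> d l m"
proof -
  have "\<bar>d (s n) (t n) - d l m\<bar> \<le> d (s n) l + d (t n) m" for n
  proof -
    have "d (s n) (t n) \<le> d (s n) l + d l (t n)" "d l (t n) \<le> d l m + d m (t n)"
      "d l m \<le> d l (s n) + d (s n) m" "d (s n) m \<le> d (s n) (t n) + d (t n) m"
      by (intro triangle X)+
    then show ?thesis using commute[of l "s n"] commute[of m "t n"] by linarith
  qed
  moreover have "(\<lambda>n. d (s n) l + d (t n) m) \<longlonglongrightarrow> 0"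
    using tendsto_add[OF assms(1,2)[unfolded cvg_def]] by simp
  ultimately have "(\<lambda>n. d (s n) (t n) - d l m) \<longlonglongrightarrow> 0"
    using Lim_null_comparison[of "\<lambda>n. d (s n) (t n) - d l m" "\<lambda>n. d (s n) l + d (t n) m" sequentially]
    by (simp only: real_norm_def eventually_True)
  then show ?thesis by (rule LIM_zero_cancel)
qed

lemma cvg_const [simp]: "l \<in> X \<Longrightarrow> cvg (\<lambda>n. l) l"
  by (simp add: cvg_def)

lemma cvg_unique:
  assumes "cvg s l" "cvg s m" "\<And>n. s n \<in> X" "l \<in> X" "m \<in> X" shows "l = m"
proof -
  have "(\<lambda>n. d (s n) (s n)) \<longlonglongrightarrow> d l m"
    using assms by (intro d_cvg)
  moreover have "(\<lambda>n. d (s n) (s n)) = (\<lambda>n. 0)" using assms by auto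
  ultimately have "d l m = 0" by (simp add: LIMSEQ_const_iff)
  then show ?thesis using assms by simp
qed

lemma cvg_ne:
  assumes "cvg s l" "cvg t m" "\<And>n. s n \<in> X" "\<And>n. t n \<in> X" "l \<in> X" "m \<in> X" "l \<noteq> m"
  shows "\<exists>e>0. \<forall>\<^sub>F n in sequentially. d (s n) (t n) > e"
proof -
  have "d l m > 0" using nonneg[of l m] zero[of l m] assms(5-7) by linarith
  moreover have "(\<lambda>n. d (s n) (t n)) \<longlonglongrightarrow> d l m" using assms by (intro d_cvg)
  ultimately have "\<forall>\<^sub>F n in sequentially. d (s n) (t n) > d l m / 2"
    by (intro order_tendstoD(1)) auto
  then show ?thesis using \<open>d l m > 0\<close> half_gt_zero by blast
qed

lemma cvg_ge_ne:
  assumes "cvg s l" "cvg t m" "\<And>n. s n \<in> X" "\<And>n. t n \<in> X" "l \<in> X" "m \<in> X"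
    and "e > 0" "\<And>n. d (s n) (t n) \<ge> e"
  shows "l \<noteq> m"
proof
  assume "l = m"
  have "(\<lambda>n. d (s n) (t n)) \<longlonglongrightarrow> d l m" using assms by (intro d_cvg)
  then have "d l m \<ge> e" using assms(8) LIMSEQ_le_const[of "\<lambda>n. d (s n) (t n)" "d l m" e] by auto
  then show False using \<open>l = m\<close> assms by simp
qed

lemma X_subseq:
  assumes "\<And>n :: nat. s n \<in> X"
  obtains l r where "l \<in> X" "strict_mono r" "cvg (\<lambda>n. s (r n)) l"
proof -
  have "compact_space mtopology" using compat by (simp add: compatible_metric_def Let_def)
  moreover have "range s \<subseteq> X" using assms by auto
  ultimately obtain l r where l: "l \<in> X" "strict_mono r" "limitin mtopology (s \<circ> r) l sequentially"
    unfolding compact_space_sequentially by blast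
  then have "cvg (\<lambda>n. s (r n)) l"
    using cvg_limitin[of l "s \<circ> r"] assms by (simp add: o_def)
  with l(1,2) show ?thesis by (rule that)
qed

lemma emb_Inr: "embedding_map euclidean mtopology (Inr :: 'm \<Rightarrow> ('m \<Rightarrow> 'm) + 'm)"
  using compat by (simp add: compatible_metric_def Let_def)

lemma cvg_Inr: "cvg (\<lambda>n. Inr (x n)) (Inr y) \<longleftrightarrow> x \<longlonglongrightarrow> y"
proof -
  let ?S = "subtopology mtopology (range (Inr :: 'm \<Rightarrow> ('m \<Rightarrow> 'm) + 'm))"
  have hm: "homeomorphic_map euclidean ?S (Inr :: 'm \<Rightarrow> ('m \<Rightarrow> 'm) + 'm)"
    using emb_Inr by (simp add: embedding_map_def)
  have "cvg (\<lambda>n. Inr (x n)) (Inr y) \<longleftrightarrow> limitin ?S (\<lambda>n. Inr (x n)) (Inr y) sequentially"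
    by (subst cvg_limitin) (auto simp: limitin_subtopology)
  also have "\<dots> \<longleftrightarrow> limitin euclidean x y sequentially"
  proof
    assume "limitin euclidean x y sequentially"
    from continuous_map_limit[OF homeomorphic_imp_continuous_map[OF hm] this]
    show "limitin ?S (\<lambda>n. Inr (x n)) (Inr y) sequentially" by (simp add: o_def)
  next
    assume *: "limitin ?S (\<lambda>n. Inr (x n)) (Inr y) sequentially"
    obtain g where g: "homeomorphic_maps euclidean ?S Inr g"
      using hm homeomorphic_map_maps by blast
    then have "continuous_map ?S euclidean g" and gI: "\<And>x. g (Inr x) = x"
      by (auto simp: homeomorphic_maps_def)
    from continuous_map_limit[OF this(1) *]
    show "limitin euclidean x y sequentially" by (simp add: o_def gI)
  qed
  finally show ?thesis by simp
qed

lemma closedin_M: "closedin mtopology (range (Inr :: 'm \<Rightarrow> ('m \<Rightarrow> 'm) + 'm))"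
proof -
  have "continuous_map euclidean mtopology (Inr :: 'm \<Rightarrow> ('m \<Rightarrow> 'm) + 'm)"
    using emb_Inr homeomorphic_imp_continuous_map continuous_map_in_subtopology
    unfolding embedding_map_def by blast
  then have "compactin mtopology (range (Inr :: 'm \<Rightarrow> ('m \<Rightarrow> 'm) + 'm))"
    using compact_M image_compactin[of euclidean UNIV mtopology Inr] by simp
  then show ?thesis using compactin_imp_closedin Hausdorff_space_mtopology by blast
qed

text \<open>The embedding of the discrete group makes its points open only relative to \<Gamma>.
  Since M is compact, its copy is closed, and removing it from a neighbourhood leaves a
  neighbourhood consisting of the single point.\<close>

lemma isolated_Inl:
  assumes "\<gamma> \<in> \<Gamma>"
  shows "\<exists>e>0. \<forall>p\<in>X. d p (Inl \<gamma>) < e \<longrightarrow> p = Inl \<gamma>"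
proof -
  let ?S = "subtopology mtopology (Inl ` \<Gamma>) :: (('m \<Rightarrow> 'm) + 'm) topology"
  have "embedding_map (discrete_topology \<Gamma>) mtopology (Inl :: _ \<Rightarrow> ('m \<Rightarrow> 'm) + 'm)"
    using compat by (simp add: compatible_metric_def Let_def)
  then have "homeomorphic_map (discrete_topology \<Gamma>) ?S Inl"
    by (simp add: embedding_map_def)
  then have "openin ?S (Inl ` {\<gamma>})"
    using homeomorphic_map_openness[of "discrete_topology \<Gamma>" ?S Inl "{\<gamma>}"] assms by simp
  then obtain U where U: "openin mtopology U" "U \<inter> Inl ` \<Gamma> = {Inl \<gamma>}"
    by (auto simp: openin_subtopology)
  have "openin mtopology (U - range Inr)"
    using U closedin_M by (simp add: openin_diff)
  moreover have "U - range Inr = {Inl \<gamma>}"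
  proof -
    have "U \<subseteq> X" using openin_subset[OF U(1)] by simp
    then show ?thesis using U(2) by (auto simp: Plus_def)
  qed
  ultimately have "openin mtopology {Inl \<gamma>}" by simp
  then obtain e where e: "e > 0" "mball (Inl \<gamma>) e \<subseteq> {Inl \<gamma>}"
    by (auto simp: openin_mtopology)
  then show ?thesis using assms by (auto simp: subset_iff in_mball commute intro!: exI[of _ e])
qed

lemma cvg_Inl:
  assumes "cvg s (Inl \<gamma>)" "\<gamma> \<in> \<Gamma>" "\<And>n. s n \<in> X"
  shows "\<forall>\<^sub>F n in sequentially. s n = Inl \<gamma>"
proof -
  obtain e where e: "e > 0" "\<And>p. p \<in> X \<Longrightarrow> d p (Inl \<gamma>) < e \<Longrightarrow> p = Inl \<gamma>"
    using isolated_Inl assms by blast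
  have "\<forall>\<^sub>F n in sequentially. d (s n) (Inl \<gamma>) < e"
    using assms(1) e(1) unfolding cvg_def by (intro order_tendstoD(2)) auto
  then show ?thesis by eventually_elim (use e assms in auto)
qed

lemma cvg_act:
  assumes "\<gamma> \<in> \<Gamma>" "cvg s l" "\<And>n. s n \<in> X" "l \<in> X"
  shows "cvg (\<lambda>n. act \<gamma> (s n)) (act \<gamma> l)"
proof -
  have "homeomorphic_map mtopology mtopology (act \<gamma>)"
    using compat assms(1) by (simp add: compatible_metric_def Let_def)
  then have c: "continuous_map mtopology mtopology (act \<gamma>)"
    by (rule homeomorphic_imp_continuous_map)
  have "limitin mtopology s l sequentially" using assms cvg_limitin by blast
  from continuous_map_limit[OF c this]
  show ?thesis using assms by (subst cvg_limitin) (auto simp: o_def)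
qed

lemma cvg_inj_Inl:
  assumes "inj g" "range g \<subseteq> \<Gamma>" "cvg (\<lambda>n. Inl (g n)) p" "p \<in> X"
  obtains x where "p = Inr x"
proof (cases p)
  case (Inl \<gamma>)
  have "\<forall>\<^sub>F n in sequentially. (Inl (g n) :: ('m \<Rightarrow> 'm) + 'm) = Inl \<gamma>"
    using assms(2-4) Inl by (intro cvg_Inl) auto
  then obtain N where "\<And>n. n \<ge> N \<Longrightarrow> g n = \<gamma>" by (auto simp: eventually_sequentially)
  then have "g N = g (Suc N)" by simp
  then show ?thesis using assms(1) by (simp add: inj_eq)
qed (use that in auto)

section \<open>Sequences of group elements that collapse M minus a point to a point\<close>

lemma ex_three: "\<exists>x y z :: 'm. x \<noteq> y \<and> x \<noteq> z \<and> y \<noteq> z \<and> {x, y, z} \<subseteq> limit_set \<Gamma>"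
proof -
  obtain T where T: "T \<subseteq> limit_set \<Gamma>" "card T = 3"
    using nonel unfolding non_elementary_def
    by (meson infinite_arbitrarily_large obtain_subset_with_card_n)
  then obtain x y z where "T = {x,y,z}" "x \<noteq> y" "x \<noteq> z" "y \<noteq> z"
    using card_3_iff[of T] by auto
  with T show ?thesis by blast
qed

lemma ex_avoid2: "\<exists>x :: 'm. x \<in> limit_set \<Gamma> \<and> x \<noteq> u \<and> x \<noteq> v"
proof -
  obtain x y z :: 'm where "x \<noteq> y" "x \<noteq> z" "y \<noteq> z" "x \<in> limit_set \<Gamma>" "y \<in> limit_set \<Gamma>" "z \<in> limit_set \<Gamma>"
    using ex_three by auto
  then show ?thesis by (cases "x = u \<or> x = v"; cases "y = u \<or> y = v") auto
qed

text \<open>A collapsing sequence with attracting point \<open>a\<close> and repelling point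
  \<open>b\<close>. Testing on convergent sequences \<open>s\<close> instead of fixed points encodes
  locally uniform convergence off \<open>b\<close>. The whole compactification is acted on: the
  constant sequence \<open>Inl id\<close> shows that \<open>Inl (g n)\<close> tends to
  \<open>Inr a\<close>. The clause for inverses makes the notion symmetric.\<close>

definition conv_seq :: "(nat \<Rightarrow> 'm \<Rightarrow> 'm) \<Rightarrow> 'm \<Rightarrow> 'm \<Rightarrow> bool" where
  "conv_seq g a b \<longleftrightarrow> (\<forall>n. g n \<in> \<Gamma>) \<and>
     (\<forall>s l. (\<forall>n. s n \<in> X) \<longrightarrow> l \<in> X \<longrightarrow> l \<noteq> Inr b \<longrightarrow> cvg s l \<longrightarrow>
        cvg (\<lambda>n. act (g n) (s n)) (Inr a)) \<and>
     (\<forall>s l. (\<forall>n. s n \<in> X) \<longrightarrow> l \<in> X \<longrightarrow> l \<noteq> Inr a \<longrightarrow> cvg s l \<longrightarrow>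
        cvg (\<lambda>n. act (inv (g n)) (s n)) (Inr b))"

lemma conv_seqI:
  assumes "\<And>n. g n \<in> \<Gamma>"
    and "\<And>s l. (\<And>n. s n \<in> X) \<Longrightarrow> l \<in> X \<Longrightarrow> l \<noteq> Inr b \<Longrightarrow> cvg s l \<Longrightarrow>
        cvg (\<lambda>n. act (g n) (s n)) (Inr a)"
    and "\<And>s l. (\<And>n. s n \<in> X) \<Longrightarrow> l \<in> X \<Longrightarrow> l \<noteq> Inr a \<Longrightarrow> cvg s l \<Longrightarrow>
        cvg (\<lambda>n. act (inv (g n)) (s n)) (Inr b)"
  shows "conv_seq g a b"
  unfolding conv_seq_def
proof (intro conjI allI impI)
qed (use assms in \<open>blast+\<close>)

lemma conv_seq_in: "conv_seq g a b \<Longrightarrow> g n \<in> \<Gamma>"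
  by (simp add: conv_seq_def)

lemma conv_seqD:
  "conv_seq g a b \<Longrightarrow> (\<And>n. s n \<in> X) \<Longrightarrow> l \<in> X \<Longrightarrow> l \<noteq> Inr b \<Longrightarrow> cvg s l \<Longrightarrow>
     cvg (\<lambda>n. act (g n) (s n)) (Inr a)"
  unfolding conv_seq_def by blast

lemma conv_seq_inv: "conv_seq g a b \<Longrightarrow> conv_seq (\<lambda>n. inv (g n)) b a"
  unfolding conv_seq_def by simp

lemma conv_seqM:
  assumes "conv_seq g a b" "x \<longlonglongrightarrow> l" "l \<noteq> b"
  shows "(\<lambda>n. g n (x n)) \<longlonglongrightarrow> a"
  using conv_seqD[OF assms(1), of "\<lambda>n. Inr (x n)" "Inr l"] assms(2,3)
  by (simp add: cvg_Inr)

lemma conv_seq_Inl: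
  assumes "conv_seq g a b" shows "cvg (\<lambda>n. Inl (g n)) (Inr a)"
  using conv_seqD[OF assms, of "\<lambda>n. Inl id" "Inl id"] by simp

lemma conv_seq_Inl_inv:
  assumes "conv_seq g a b" shows "cvg (\<lambda>n. Inl (inv (g n))) (Inr b)"
  using conv_seq_Inl[OF conv_seq_inv[OF assms]] .

text \<open>A sequence given along a subsequence is completed by its limit at the other indices.
  This is what lets \<open>conv_seq\<close>, which tests full sequences, pass to
  subsequences.\<close>

lemma fill_subseq:
  fixes r :: "nat \<Rightarrow> nat"
  assumes r: "strict_mono r" and s: "\<And>n. s n \<in> X" "l \<in> X" and c: "cvg s l"
  shows "\<exists>t. (\<forall>n. t n \<in> X) \<and> cvg t l \<and> (\<forall>n. t (r n) = s n)"
proof -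
  define t where "t m = (if m \<in> range r then s (inv r m) else l)" for m
  have inj: "inj r" using r strict_mono_imp_inj_on by blast
  have tr: "t (r n) = s n" for n using inj by (simp add: t_def)
  have "cvg t l"
    unfolding cvg_def
  proof (rule LIMSEQ_I)
    fix e :: real assume "e > 0"
    with c obtain N where N: "\<And>n. n \<ge> N \<Longrightarrow> norm (d (s n) l - 0) < e"
      unfolding cvg_def by (meson LIMSEQ_D)
    have "norm (d (t m) l - 0) < e" if m: "m \<ge> r N" for m
    proof (cases "m \<in> range r")
      case True
      then obtain n where n: "m = r n" by auto
      then have "n \<ge> N" using m r by (simp add: strict_mono_less_eq)
      then show ?thesis using N n tr by simp
    qed (use \<open>e > 0\<close> s in \<open>simp add: t_def\<close>)
    then show "\<exists>no. \<forall>n\<ge>no. norm (d (t n) l - 0) < e" by blast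
  qed
  moreover have "t n \<in> X" for n using s by (simp add: t_def)
  ultimately show ?thesis using tr by blast
qed

lemma conv_seq_sub:
  assumes g: "conv_seq g a b" and r: "strict_mono r"
  shows "conv_seq (\<lambda>n. g (r n)) a b"
proof -
  have *: "cvg (\<lambda>n. act (h (r n)) (s n)) (Inr p)"
    if h: "conv_seq h p q" and s: "\<And>n. s n \<in> X" "l \<in> X" "l \<noteq> Inr q" "cvg s l" for h p q s l
  proof -
    obtain t where t: "\<And>n. t n \<in> X" "cvg t l" "\<And>n. t (r n) = s n"
      using fill_subseq[OF r s(1,2,4)] by blast
    have "cvg (\<lambda>n. act (h n) (t n)) (Inr p)" by (rule conv_seqD[OF h t(1) s(2,3) t(2)])
    from cvg_subseq[OF this r] show ?thesis by (simp add: t)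
  qed
  show ?thesis
    by (rule conv_seqI[OF conv_seq_in[OF g] *[OF g] *[OF conv_seq_inv[OF g]]])
qed

lemma conv_seq_comp_left:
  assumes g: "conv_seq g a b" and \<eta>: "\<eta> \<in> \<Gamma>"
  shows "conv_seq (\<lambda>n. \<eta> \<circ> g n) (\<eta> a) b"
proof -
  have 1: "cvg (\<lambda>n. act (\<eta> \<circ> g n) (s n)) (Inr (\<eta> a))"
    if s: "\<And>n. s n \<in> X" "l \<in> X" "l \<noteq> Inr b" "cvg s l" for s l
  proof -
    have "cvg (\<lambda>n. act \<eta> (act (g n) (s n))) (act \<eta> (Inr a))"
      by (rule cvg_act[OF \<eta> conv_seqD[OF g s]]) (use s conv_seq_in[OF g] in auto)
    then show ?thesis by (simp only: act_comp) simp
  qed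
  have 2: "cvg (\<lambda>n. act (inv (\<eta> \<circ> g n)) (s n)) (Inr b)"
    if s: "\<And>n. s n \<in> X" "l \<in> X" "l \<noteq> Inr (\<eta> a)" "cvg s l" for s l
  proof -
    have "act (inv \<eta>) l \<noteq> Inr a"
      using s(3) act_inv(1)[OF \<eta>, of l] by (metis map_sum.simps(2))
    then have "cvg (\<lambda>n. act (inv (g n)) (act (inv \<eta>) (s n))) (Inr b)"
      using s \<eta> by (intro conv_seqD[OF conv_seq_inv[OF g] _ _ _ cvg_act[of "inv \<eta>" s l]]) auto
    then show ?thesis using conv_seq_in[OF g] \<eta> by (simp add: act_comp)
  qed
  show ?thesis
    by (rule conv_seqI[OF _ 1 2]) (use conv_seq_in[OF g] \<eta> in simp)
qed

lemma loc_unif_cvg: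
  assumes f: "loc_unif_to_const d (X - {y}) f x" and y: "y \<in> X"
    and s: "\<And>n. s n \<in> X" "l \<in> X" "l \<noteq> y" "cvg s l" and fX: "\<And>n p. p \<in> X \<Longrightarrow> f n p \<in> X"
  shows "cvg (\<lambda>n. f n (s n)) x"
  unfolding cvg_def
proof (rule LIMSEQ_I)
  fix e :: real assume "e > 0"
  have "l \<in> X - {y}" using s by auto
  then obtain r where r: "r > 0"
    "\<And>e. e > 0 \<Longrightarrow> \<forall>\<^sub>F n in sequentially. \<forall>w\<in>X - {y}. d l w < r \<longrightarrow> d (f n w) x < e"
    using f unfolding loc_unif_to_const_def by blast
  obtain e' where e': "e' > 0" "\<forall>\<^sub>F n in sequentially. d (s n) y > e'"
    using cvg_ne[of s l "\<lambda>n. y" y] s y by auto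
  have "\<forall>\<^sub>F n in sequentially. d (s n) l < r"
    using s(4) r(1) unfolding cvg_def by (rule order_tendstoD(2))
  with e'(2) r(2)[OF \<open>e > 0\<close>] have "\<forall>\<^sub>F n in sequentially. norm (d (f n (s n)) x - 0) < e"
  proof eventually_elim
    case (elim n)
    then have "s n \<noteq> y" using e'(1) y by auto
    then have "d (f n (s n)) x < e" using elim s(1) commute by simp
    then show ?case by simp
  qed
  then show "\<exists>no. \<forall>n\<ge>no. norm (d (f n (s n)) x - 0) < e" by (simp add: eventually_sequentially)
qed

lemma loc_unif_subseq:
  assumes "loc_unif_to_const d' S f x" "strict_mono r"
  shows "loc_unif_to_const d' S (\<lambda>n. f (r n)) x"
  using assms eventually_subseq[OF assms(2)] unfolding loc_unif_to_const_def by fast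

lemma comp_right_cancel:
  assumes "\<eta> \<in> \<Gamma>" shows "p \<circ> \<eta> = q \<circ> \<eta> \<longleftrightarrow> p = q"
proof
  assume *: "p \<circ> \<eta> = q \<circ> \<eta>"
  have "p x = q x" for x
    using fun_cong[OF *, of "inv \<eta> x"] assms by simp
  then show "p = q" by blast
qed simp

text \<open>The convergence property gives an attracting and a repelling point for a subsequence
  and, after refining, another pair for the inverses. Following a test point out and back forces the
  second pair to be the first one interchanged. Attracting points lie in M because infinitely many
  distinct elements cannot accumulate at an isolated point of \<Gamma>.\<close>

lemma ex_conv_seq:
  fixes g :: "nat \<Rightarrow> 'm \<Rightarrow> 'm"
  assumes g: "inj g" "\<And>n. g n \<in> \<Gamma>"
  shows "\<exists>(r :: nat \<Rightarrow> nat) a b. strict_mono r \<and> conv_seq (\<lambda>n. g (r n)) a b"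
proof -
  have CA: "\<exists>x\<in>X. \<exists>y\<in>X. \<exists>r :: nat \<Rightarrow> nat. strict_mono r \<and>
           loc_unif_to_const d (X - {y}) (\<lambda>j. act (h (r j))) x"
    if "inj h" "\<And>n. h n \<in> \<Gamma>" for h :: "nat \<Rightarrow> 'm \<Rightarrow> 'm"
    using compat that unfolding compatible_metric_def Let_def convergence_action_def by blast
  obtain x y r where r: "x \<in> X" "y \<in> X" "strict_mono r"
    "loc_unif_to_const d (X - {y}) (\<lambda>j. act (g (r j))) x" using CA[OF g] by blast
  let ?h = "\<lambda>n. inv (g (r n))"
  have "inj (\<lambda>n. g (r n))"
    using g(1) r(3) by (auto simp: inj_eq strict_mono_eq intro!: injI)
  moreover have "inv p = inv q \<longleftrightarrow> p = q" if "p \<in> \<Gamma>" "q \<in> \<Gamma>" for p q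
    using that inv_inv by metis
  ultimately have injh: "inj ?h" using g(2) by (simp add: inj_def)
  obtain x' y' r' where r': "x' \<in> X" "y' \<in> X" "strict_mono r'"
    "loc_unif_to_const d (X - {y'}) (\<lambda>j. act (?h (r' j))) x'" using CA[OF injh] g(2) by auto
  define k where "k n = g (r (r' n))" for n
  have kG [simp]: "k n \<in> \<Gamma>" for n by (simp add: k_def g)
  have injk: "inj k"
    using g(1) r(3) r'(3) by (auto simp: inj_eq strict_mono_eq k_def intro!: injI)
  have inji: "inj (\<lambda>n. inv (k n))"
    using inj_compose[OF injh strict_mono_imp_inj_on[OF r'(3)]] by (simp add: k_def o_def)
  have K1: "cvg (\<lambda>n. act (k n) (s n)) x"
    if s: "\<And>n. s n \<in> X" "l \<in> X" "l \<noteq> y" "cvg s l" for s l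
    using loc_unif_cvg[OF loc_unif_subseq[OF r(4) r'(3)] r(2) s] by (simp add: k_def g)
  have K2: "cvg (\<lambda>n. act (inv (k n)) (s n)) x'"
    if s: "\<And>n. s n \<in> X" "l \<in> X" "l \<noteq> y'" "cvg s l" for s l
    using loc_unif_cvg[OF r'(4) r'(2) s] by (simp add: k_def g)
  have avoid: "\<exists>z\<in>X. z \<noteq> u \<and> z \<noteq> v" for u v :: "('m \<Rightarrow> 'm) + 'm"
  proof -
    obtain p q w :: 'm where "p \<noteq> q" "p \<noteq> w" "q \<noteq> w" using ex_three by blast
    then show ?thesis
      by (cases "Inr p = u \<or> Inr p = v"; cases "Inr q = u \<or> Inr q = v")
         (fastforce intro: bexI[of _ "Inr p"] bexI[of _ "Inr q"] bexI[of _ "Inr w"])+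
  qed
  \<comment> \<open>If \<open>y\<close> differed from \<open>x'\<close>, a point \<open>z\<close>
    would be carried by the inverses to \<open>x'\<close>, away from \<open>y\<close>, and then by
    \<open>k n\<close> to \<open>x\<close>. But \<open>z\<close> returns to itself and is chosen
    different from \<open>x\<close>.\<close>
  have yx: "y = x'"
  proof (rule ccontr)
    assume "y \<noteq> x'"
    obtain z where z: "z \<in> X" "z \<noteq> y'" "z \<noteq> x" using avoid by blast
    have "cvg (\<lambda>n. act (inv (k n)) z) x'" using K2[of "\<lambda>n. z" z] z by simp
    then have "cvg (\<lambda>n. act (k n) (act (inv (k n)) z)) x"
      using \<open>y \<noteq> x'\<close> z r'(1) by (intro K1[of _ x']) auto
    then have "cvg (\<lambda>n. z) x" by simp
    then show False using cvg_unique[of "\<lambda>n. z" z x] z r(1) by simp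
  qed
  have xy: "x = y'"
  proof (rule ccontr)
    assume "x \<noteq> y'"
    obtain z where z: "z \<in> X" "z \<noteq> y" "z \<noteq> x'" using avoid by blast
    have "cvg (\<lambda>n. act (k n) z) x" using K1[of "\<lambda>n. z" z] z by simp
    then have "cvg (\<lambda>n. act (inv (k n)) (act (k n) z)) x'"
      using \<open>x \<noteq> y'\<close> z r(1) by (intro K2[of _ x]) auto
    then have "cvg (\<lambda>n. z) x'" by simp
    then show False using cvg_unique[of "\<lambda>n. z" z x'] z r'(1) by simp
  qed
  have avoidG: "\<exists>\<eta>\<in>\<Gamma>. Inl \<eta> \<noteq> p" for p :: "('m \<Rightarrow> 'm) + 'm"
    using injk kG inj_eq[OF injk, of 0 1] by (metis Inl_inject zero_neq_one)
  obtain a where a: "x = Inr a"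
  proof -
    obtain \<eta> where \<eta>: "\<eta> \<in> \<Gamma>" "Inl \<eta> \<noteq> y" using avoidG by blast
    have c: "cvg (\<lambda>n. Inl (k n \<circ> \<eta>)) x" using K1[of "\<lambda>n. Inl \<eta>" "Inl \<eta>"] \<eta> by simp
    have i: "inj (\<lambda>n. k n \<circ> \<eta>)"
      using injk \<eta>(1) by (simp add: inj_def comp_right_cancel)
    have "range (\<lambda>n. k n \<circ> \<eta>) \<subseteq> \<Gamma>" using \<eta>(1) by auto
    from cvg_inj_Inl[OF i this c r(1)] that show ?thesis by blast
  qed
  obtain b where b: "x' = Inr b"
  proof -
    obtain \<eta> where \<eta>: "\<eta> \<in> \<Gamma>" "Inl \<eta> \<noteq> y'" using avoidG by blast
    have c: "cvg (\<lambda>n. Inl (inv (k n) \<circ> \<eta>)) x'" using K2[of "\<lambda>n. Inl \<eta>" "Inl \<eta>"] \<eta> by simp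
    have i: "inj (\<lambda>n. inv (k n) \<circ> \<eta>)"
      using inji \<eta>(1) by (simp add: inj_def comp_right_cancel)
    have "range (\<lambda>n. inv (k n) \<circ> \<eta>) \<subseteq> \<Gamma>" using \<eta>(1) by auto
    from cvg_inj_Inl[OF i this c r'(1)] that show ?thesis by blast
  qed
  have "conv_seq k a b"
    by (rule conv_seqI[OF kG K1[unfolded a] K2[unfolded b]]) (use xy yx a b in auto)
  moreover have "strict_mono (\<lambda>n. r (r' n))"
    using r(3) r'(3) by (simp add: strict_mono_def)
  ultimately show ?thesis unfolding k_def by (intro exI[of _ "\<lambda>n. r (r' n)"]) blast
qed

text \<open>Either some value recurs infinitely often, or an infinite set of indices on which
  \<open>g\<close> is injective gives distinct elements, to which \<open>ex_conv_seq\<close>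
  applies.\<close>

lemma seq_dichotomy:
  fixes g :: "nat \<Rightarrow> 'm \<Rightarrow> 'm"
  assumes g: "\<And>n. g n \<in> \<Gamma>"
  obtains (const) r \<gamma> where "strict_mono (r :: nat \<Rightarrow> nat)" "\<gamma> \<in> \<Gamma>" "\<And>n. g (r n) = \<gamma>"
    | (conv) r a b where "strict_mono (r :: nat \<Rightarrow> nat)" "conv_seq (\<lambda>n. g (r n)) a b"
proof (cases "finite (range g)")
  case True
  then obtain m where m: "infinite {n. g n = g m}"
    using pigeonhole_infinite[of "UNIV :: nat set" g] by auto
  have "g (enumerate {n. g n = g m} k) = g m" for k
    using enumerate_in_set[OF m, of k] by simp
  then show ?thesis
    by (rule const[OF strict_mono_enumerate[OF m] g])
next
  case False
  obtain S where S: "range g = g ` S" "inj_on g S"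
    using subset_image_inj[of "range g" g UNIV] by auto
  then have "infinite S" using False by auto
  let ?r = "enumerate S"
  have r: "strict_mono ?r" by (rule strict_mono_enumerate[OF \<open>infinite S\<close>])
  have "inj (\<lambda>n. g (?r n))"
    using S r \<open>infinite S\<close> by (auto simp: inj_def inj_on_eq_iff enumerate_in_set strict_mono_eq)
  from ex_conv_seq[OF this] g obtain r' a b where
    "strict_mono r'" "conv_seq (\<lambda>n. g (?r (r' n))) a b" by blast
  then show ?thesis using conv[of "\<lambda>n. ?r (r' n)"] r by (simp add: strict_mono_def)
qed

lemma M_subseq:
  fixes w :: "nat \<Rightarrow> 'm"
  obtains l and r :: "nat \<Rightarrow> nat" where "strict_mono r" "(\<lambda>n. w (r n)) \<longlonglongrightarrow> l"
proof -
  have "seq_compact (UNIV :: 'm set)" using compact_M compact_imp_seq_compact by blast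
  then obtain l r where "strict_mono (r :: nat \<Rightarrow> nat)" "(w \<circ> r) \<longlonglongrightarrow> l"
    by (rule seq_compactE[of UNIV w]) auto
  then show ?thesis using that by (simp add: o_def)
qed

lemma not_eventually_subseq:
  assumes "\<not> (\<forall>\<^sub>F n in sequentially. P n)"
  shows "\<exists>r :: nat \<Rightarrow> nat. strict_mono r \<and> (\<forall>n. \<not> P (r n))"
proof -
  have inf: "infinite {n. \<not> P n}"
    using assms by (simp add: cofinite_eq_sequentially[symmetric] eventually_cofinite)
  have "\<not> P (enumerate {n. \<not> P n} k)" for k using enumerate_in_set[OF inf, of k] by simp
  then show ?thesis using strict_mono_enumerate[OF inf] by blast
qed

section \<open>Loxodromic elements and global fixed points\<close>

text \<open>Converts subsequential convergence along moving points back into the locally uniform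
  convergence that \<open>limit_set\<close> and \<open>loxodromic\<close> demand. The radius at
  \<open>z\<close> is half the distance to \<open>y\<close>, so that limits of points within it stay
  off \<open>y\<close>.\<close>

lemma loc_unif_criterion:
  fixes f :: "nat \<Rightarrow> 'm \<Rightarrow> 'm"
  assumes *: "\<And>(r :: nat \<Rightarrow> nat) w l. strict_mono r \<Longrightarrow> w \<longlonglongrightarrow> l \<Longrightarrow> l \<noteq> y \<Longrightarrow>
     \<exists>r' :: nat \<Rightarrow> nat. strict_mono r' \<and> (\<lambda>n. f (r (r' n)) (w (r' n))) \<longlonglongrightarrow> x"
  shows "loc_unif_to_const dist (UNIV - {y}) f x"
  unfolding loc_unif_to_const_def
proof
  fix z assume "z \<in> UNIV - {y}"
  then have R: "dist z y / 2 > 0" by simp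
  have "\<forall>\<^sub>F n in sequentially. \<forall>w\<in>UNIV - {y}. dist z w < dist z y / 2 \<longrightarrow> dist (f n w) x < e"
    if "e > 0" for e
  proof (rule ccontr)
    assume "\<not> ?thesis"
    then obtain r :: "nat \<Rightarrow> nat" where r: "strict_mono r"
      "\<And>n. \<not> (\<forall>w\<in>UNIV - {y}. dist z w < dist z y / 2 \<longrightarrow> dist (f (r n) w) x < e)"
      using not_eventually_subseq by fast
    then have "\<forall>n. \<exists>w. dist z w < dist z y / 2 \<and> \<not> dist (f (r n) w) x < e" by blast
    then obtain w where w: "\<And>n. dist z (w n) < dist z y / 2" "\<And>n. \<not> dist (f (r n) (w n)) x < e"
      by metis
    obtain l q where q: "strict_mono (q :: nat \<Rightarrow> nat)" "(\<lambda>n. w (q n)) \<longlonglongrightarrow> l" by (rule M_subseq)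
    have "(\<lambda>n. dist z (w (q n))) \<longlonglongrightarrow> dist z l" by (intro tendsto_intros q)
    moreover have "\<exists>N. \<forall>n\<ge>N. dist z (w (q n)) \<le> dist z y / 2" using w(1) less_imp_le by blast
    ultimately have "dist z l \<le> dist z y / 2" by (rule LIMSEQ_le_const2)
    then have "l \<noteq> y" using R by auto
    have "strict_mono (\<lambda>n. r (q n))" using r(1) q(1) by (simp add: strict_mono_def)
    from *[OF this q(2) \<open>l \<noteq> y\<close>] obtain r' where
      "strict_mono (r' :: nat \<Rightarrow> nat)" "(\<lambda>n. f (r (q (r' n))) (w (q (r' n)))) \<longlonglongrightarrow> x" by blast
    from tendstoD[OF this(2) \<open>e > 0\<close>] obtain n where "dist (f (r (q (r' n))) (w (q (r' n)))) x < e"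
      by (auto simp: eventually_sequentially)
    then show False using w(2) by blast
  qed
  with R show "\<exists>r>0. \<forall>e>0. \<forall>\<^sub>F n in sequentially. \<forall>w\<in>UNIV - {y}. dist z w < r \<longrightarrow> dist (f n w) x < e"
    by blast
qed

lemma loc_unif_M:
  fixes f :: "nat \<Rightarrow> 'm \<Rightarrow> 'm"
  assumes "loc_unif_to_const dist (UNIV - {y}) f x" "z \<noteq> y"
  shows "(\<lambda>n. f n z) \<longlonglongrightarrow> x"
proof (rule tendstoI)
  fix e :: real assume "e > 0"
  have "z \<in> UNIV - {y}" using assms by simp
  with assms(1) \<open>e > 0\<close> obtain r where r: "r > 0" and
    "\<forall>\<^sub>F n in sequentially. \<forall>w\<in>UNIV - {y}. dist z w < r \<longrightarrow> dist (f n w) x < e"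
    unfolding loc_unif_to_const_def by blast
  from this(2) show "\<forall>\<^sub>F n in sequentially. dist (f n z) x < e"
    by eventually_elim (use r assms in auto)
qed

lemma conv_seq_unif:
  assumes g: "conv_seq g a b" and U: "open U" "b \<in> U" and V: "open V" "a \<in> V"
  shows "\<forall>\<^sub>F n in sequentially. \<forall>z. z \<notin> U \<longrightarrow> g n z \<in> V"
proof (rule ccontr)
  assume "\<not> ?thesis"
  then obtain r :: "nat \<Rightarrow> nat" where r: "strict_mono r" "\<And>n. \<not> (\<forall>z. z \<notin> U \<longrightarrow> g (r n) z \<in> V)"
    using not_eventually_subseq by fast
  then obtain z where z: "\<And>n. z n \<notin> U" "\<And>n. g (r n) (z n) \<notin> V" by metis
  obtain l q where q: "strict_mono (q :: nat \<Rightarrow> nat)" "(\<lambda>n. z (q n)) \<longlonglongrightarrow> l" by (rule M_subseq)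
  have "l \<in> - U"
    by (rule closed_sequentially[of "- U" "\<lambda>n. z (q n)"]) (use U z q in auto)
  then have "l \<noteq> b" using U by auto
  have "strict_mono (\<lambda>n. r (q n))" using r(1) q(1) by (simp add: strict_mono_def)
  from conv_seqM[OF conv_seq_sub[OF g this] q(2) \<open>l \<noteq> b\<close>]
  have "(\<lambda>n. g (r (q n)) (z (q n))) \<longlonglongrightarrow> a" .
  from topological_tendstoD[OF this V] obtain n where "g (r (q n)) (z (q n)) \<in> V"
    by (auto simp: eventually_sequentially)
  then show False using z(2) by blast
qed

text \<open>The sequence witnessing a limit point may repeat elements. A constant subsequence is
  impossible, since an injective map would collapse all of M except \<open>y\<close> to one point; a
  collapsing subsequence has attracting point \<open>x\<close>, as one test point shows.\<close>

lemma limit_set_conv_seq: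
  assumes "x \<in> limit_set \<Gamma>"
  shows "\<exists>g b. conv_seq g x b"
proof -
  obtain y and g :: "nat \<Rightarrow> 'm \<Rightarrow> 'm" where
    g: "\<And>n. g n \<in> \<Gamma>" "loc_unif_to_const dist (UNIV - {y}) g x"
    using assms unfolding limit_set_def by blast
  show ?thesis
  proof (cases rule: seq_dichotomy[of g, OF g(1), case_names const conv])
    case (const r \<gamma>)
    have *: "\<gamma> z = x" if "z \<noteq> y" for z
    proof -
      have "(\<lambda>n. g (r n) z) \<longlonglongrightarrow> x"
        by (rule loc_unif_M[OF loc_unif_subseq[OF g(2) const(1)] that])
      then show ?thesis using const(3) by (simp add: LIMSEQ_const_iff)
    qed
    obtain u where u: "u \<noteq> y" using ex_avoid2 by blast
    obtain v where v: "v \<noteq> y" "v \<noteq> u" using ex_avoid2 by blast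
    have "\<gamma> u = \<gamma> v" using *[OF u] *[OF v(1)] by simp
    then show ?thesis using inj_iff_in[OF const(2)] v by simp
  next
    case (conv r a b)
    obtain z where z: "z \<noteq> y" "z \<noteq> b" using ex_avoid2 by blast
    have "(\<lambda>n. g (r n) z) \<longlonglongrightarrow> x"
      by (rule loc_unif_M[OF loc_unif_subseq[OF g(2) conv(1)] z(1)])
    moreover have "(\<lambda>n. g (r n) z) \<longlonglongrightarrow> a"
      by (rule conv_seqM[OF conv(2) tendsto_const z(2)])
    ultimately have "a = x" using LIMSEQ_unique by blast
    then show ?thesis using conv(2) by blast
  qed
qed

text \<open>The condition passes to \<open>inv g\<close> with \<open>U\<close> and \<open>V\<close>
  exchanged. The base point \<open>p\<close> outside both sets certifies infinite order: every
  positive power moves it into \<open>V\<close>.\<close>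

definition ping_pong :: "('m \<Rightarrow> 'm) \<Rightarrow> 'm set \<Rightarrow> 'm set \<Rightarrow> 'm \<Rightarrow> bool" where
  "ping_pong g U V p \<longleftrightarrow> g \<in> \<Gamma> \<and> closure U \<inter> closure V = {} \<and>
     (\<forall>z. z \<notin> U \<longrightarrow> g z \<in> V) \<and> p \<notin> U \<and> p \<notin> V"

lemma ping_pong_inv: "ping_pong g U V p \<Longrightarrow> ping_pong (inv g) V U p"
  unfolding ping_pong_def by (metis inf_commute inv_in inv_app(1))

lemma ping_pong_pow:
  assumes "ping_pong g U V p" "z \<notin> U"
  shows "(g ^^ Suc n) z \<in> V"
proof -
  have UV: "U \<inter> V = {}"
    using assms(1) closure_subset unfolding ping_pong_def by blast
  show ?thesis
  proof (induction n)
    case 0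
    then show ?case using assms unfolding ping_pong_def by simp
  next
    case (Suc n)
    then have "(g ^^ Suc n) z \<notin> U" using UV by blast
    then have "g ((g ^^ Suc n) z) \<in> V" using assms(1) unfolding ping_pong_def by blast
    then show ?case by simp
  qed
qed

lemma ping_pong_inj:
  assumes P: "ping_pong g U V p"
  shows "inj (\<lambda>n. g ^^ n)"
proof -
  have g: "g \<in> \<Gamma>" using P by (simp add: ping_pong_def)
  have *: "g ^^ m \<noteq> g ^^ n" if "m < n" for m n
  proof
    assume eq: "g ^^ m = g ^^ n"
    obtain k where k: "n = m + Suc k" using \<open>m < n\<close> less_imp_Suc_add by auto
    have "g ^^ n = g ^^ m \<circ> g ^^ Suc k" unfolding k by (rule funpow_add)
    then have "(g ^^ m) ((g ^^ Suc k) p) = (g ^^ m) p"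
      using fun_cong[OF eq, of p] by (simp only: o_apply)
    then have "(g ^^ Suc k) p = p" using inj_iff_in[OF pow_in[OF g]] by blast
    then show False using ping_pong_pow[OF P, of p k] P by (simp add: ping_pong_def)
  qed
  show ?thesis
    by (rule injI) (metis * linorder_neqE_nat)
qed

lemma inv_pow: "g \<in> \<Gamma> \<Longrightarrow> inv (g ^^ n) = inv g ^^ n"
  by (simp add: bij_in inv_fn)

text \<open>The limit \<open>a\<close> lies in the closure of \<open>V\<close> because positive
  powers send everything outside \<open>U\<close> into \<open>V\<close>, and it is fixed because
  \<open>g\<close> commutes with its powers.\<close>

lemma ping_pong_attr:
  fixes k :: "nat \<Rightarrow> nat"
  assumes P: "ping_pong g U V p" and c: "conv_seq (\<lambda>n. g ^^ k n) a b" and k: "strict_mono k"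
  shows "a \<in> closure V" "g a = a"
proof -
  have g: "g \<in> \<Gamma>" using P by (simp add: ping_pong_def)
  have gp: "g p \<in> V" and "U \<inter> V = {}" "p \<notin> V" "p \<notin> U"
    using P closure_subset unfolding ping_pong_def by blast+
  \<comment> \<open>Two distinct points outside \<open>U\<close> are now at hand, so one of them
    avoids the repelling point.\<close>
  then have "g p \<notin> U" "g p \<noteq> p" by auto
  with \<open>p \<notin> U\<close> obtain z where z: "z \<notin> U" "z \<noteq> b" by metis
  have lim: "(\<lambda>n. (g ^^ k (Suc n)) z) \<longlonglongrightarrow> a"
    by (rule LIMSEQ_Suc[OF conv_seqM[OF c tendsto_const z(2)]])
  have "(g ^^ k (Suc n)) z \<in> closure V" for n
  proof -
    have "k (Suc n) > 0" using k by (metis gr0I lessI not_less0 strict_mono_less)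
    then obtain j where "k (Suc n) = Suc j" using gr0_conv_Suc by blast
    then show ?thesis using ping_pong_pow[OF P z(1), of j] closure_subset by auto
  qed
  then show "a \<in> closure V" using closed_sequentially[OF closed_closure _ lim] by blast
  obtain w where w: "w \<noteq> b" "w \<noteq> inv g b" using ex_avoid2 by blast
  have "g w \<noteq> b" using w(2) g by auto
  have "(\<lambda>n. (g ^^ k n) (g w)) \<longlonglongrightarrow> a"
    by (rule conv_seqM[OF c tendsto_const \<open>g w \<noteq> b\<close>])
  then have 1: "(\<lambda>n. g ((g ^^ k n) w)) \<longlonglongrightarrow> a" by (simp add: funpow_swap1)
  have "isCont g a" using cont_in[OF g] by (simp add: continuous_on_eq_continuous_at)
  then have "(\<lambda>n. g ((g ^^ k n) w)) \<longlonglongrightarrow> g a"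
    by (rule isCont_tendsto_compose) (rule conv_seqM[OF c tendsto_const w(1)])
  then show "g a = a" using 1 LIMSEQ_unique by blast
qed

lemma ping_pong_subseq:
  fixes r :: "nat \<Rightarrow> nat"
  assumes P: "ping_pong g U V p" and r: "strict_mono r"
  shows "\<exists>(r' :: nat \<Rightarrow> nat) a b. strict_mono r' \<and> conv_seq (\<lambda>n. g ^^ r (r' n)) a b \<and>
    a \<in> closure V \<and> b \<in> closure U \<and> g a = a \<and> g b = b"
proof -
  have g: "g \<in> \<Gamma>" using P by (simp add: ping_pong_def)
  have "inj (\<lambda>n. g ^^ r n)"
    using inj_compose[OF ping_pong_inj[OF P] strict_mono_imp_inj_on[OF r]] by (simp add: o_def)
  from ex_conv_seq[OF this pow_in[OF g]] obtain r' a b where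
    r': "strict_mono (r' :: nat \<Rightarrow> nat)" and c: "conv_seq (\<lambda>n. g ^^ r (r' n)) a b" by blast
  have k: "strict_mono (\<lambda>n. r (r' n))" using r r' by (simp add: strict_mono_def)
  have c': "conv_seq (\<lambda>n. inv g ^^ r (r' n)) b a"
    using conv_seq_inv[OF c] by (simp add: inv_pow[OF g])
  have "inv g b = b" by (rule ping_pong_attr(2)[OF ping_pong_inv[OF P] c' k])
  then have "g b = b" using inv_app(1)[OF g, of b] by simp
  then show ?thesis
    using r' c ping_pong_attr[OF P c k] ping_pong_attr(1)[OF ping_pong_inv[OF P] c' k] by blast
qed

text \<open>All subsequences of powers have the same attracting and repelling points. Another pair
  again lies in the disjoint closures of \<open>V\<close> and \<open>U\<close>, so the fixed point
  \<open>a\<close> is not the other repelling point, and its constant orbit tends to the other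
  attracting point. The subsequence criterion then covers the full sequence of powers.\<close>

lemma ping_pong_loxodromic:
  assumes P: "ping_pong g U V p"
  shows "\<exists>a\<in>closure V. \<exists>b\<in>closure U. loxodromic \<Gamma> g a b"
proof -
  have g: "g \<in> \<Gamma>" and dis: "closure U \<inter> closure V = {}" using P by (auto simp: ping_pong_def)
  obtain a b where ab: "a \<in> closure V" "b \<in> closure U" "g a = a" "g b = b"
    using ping_pong_subseq[OF P strict_mono_id] by blast
  have pa: "(g ^^ n) a = a" for n using ab(3) by (induction n) auto
  have pb: "(g ^^ n) b = b" for n using ab(4) by (induction n) auto
  have sub: "\<exists>r' :: nat \<Rightarrow> nat. strict_mono r' \<and> conv_seq (\<lambda>n. g ^^ r (r' n)) a b"
    if r: "strict_mono r" for r :: "nat \<Rightarrow> nat"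
  proof -
    obtain r' :: "nat \<Rightarrow> nat" and a' b' where r': "strict_mono r'" "conv_seq (\<lambda>n. g ^^ r (r' n)) a' b'"
      "a' \<in> closure V" "b' \<in> closure U"
      using ping_pong_subseq[OF P r] by blast
    have "a \<noteq> b'" "b \<noteq> a'" using ab r' dis by blast+
    have "(\<lambda>n. (g ^^ r (r' n)) a) \<longlonglongrightarrow> a'" by (rule conv_seqM[OF r'(2) tendsto_const \<open>a \<noteq> b'\<close>])
    then have "a = a'" by (simp add: pa LIMSEQ_const_iff)
    have "inv (g ^^ n) b = b" for n using inv_app(2)[OF pow_in[OF g], of n b] pb by simp
    moreover have "(\<lambda>n. inv (g ^^ r (r' n)) b) \<longlonglongrightarrow> b'"
      by (rule conv_seqM[OF conv_seq_inv[OF r'(2)] tendsto_const \<open>b \<noteq> a'\<close>])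
    ultimately have "b = b'" by (simp add: LIMSEQ_const_iff)
    then show ?thesis using r' \<open>a = a'\<close> by blast
  qed
  have lu1: "loc_unif_to_const dist (UNIV - {b}) (\<lambda>n. g ^^ n) a"
  proof (rule loc_unif_criterion)
    fix r :: "nat \<Rightarrow> nat" and w l assume r: "strict_mono r" and w: "w \<longlonglongrightarrow> l" "l \<noteq> b"
    obtain r' :: "nat \<Rightarrow> nat" where r': "strict_mono r'" "conv_seq (\<lambda>n. g ^^ r (r' n)) a b"
      using sub[OF r] by blast
    have "(\<lambda>n. w (r' n)) \<longlonglongrightarrow> l" using LIMSEQ_subseq_LIMSEQ[OF w(1) r'(1)] by (simp add: o_def)
    from conv_seqM[OF r'(2) this w(2)] r'(1)
    show "\<exists>r'. strict_mono r' \<and> (\<lambda>n. (g ^^ r (r' n)) (w (r' n))) \<longlonglongrightarrow> a" by blast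
  qed
  have lu2: "loc_unif_to_const dist (UNIV - {a}) (\<lambda>n. inv g ^^ n) b"
  proof (rule loc_unif_criterion)
    fix r :: "nat \<Rightarrow> nat" and w l assume r: "strict_mono r" and w: "w \<longlonglongrightarrow> l" "l \<noteq> a"
    obtain r' :: "nat \<Rightarrow> nat" where r': "strict_mono r'" "conv_seq (\<lambda>n. g ^^ r (r' n)) a b"
      using sub[OF r] by blast
    have "(\<lambda>n. w (r' n)) \<longlonglongrightarrow> l" using LIMSEQ_subseq_LIMSEQ[OF w(1) r'(1)] by (simp add: o_def)
    from conv_seqM[OF conv_seq_inv[OF r'(2)] this w(2)] r'(1)
    show "\<exists>r'. strict_mono r' \<and> (\<lambda>n. (inv g ^^ r (r' n)) (w (r' n))) \<longlonglongrightarrow> b"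
      by (auto simp: inv_pow[OF g])
  qed
  have "range (\<lambda>n. g ^^ n) \<subseteq> \<Gamma>" "range (\<lambda>n. inv g ^^ n) \<subseteq> \<Gamma>" using g by auto
  then have "a \<in> limit_set \<Gamma>" "b \<in> limit_set \<Gamma>"
    unfolding limit_set_def using lu1 lu2 by blast+
  moreover have "a \<noteq> b" using ab dis by blast
  ultimately show ?thesis using lu1 lu2 ab g unfolding loxodromic_def by blast
qed

lemma conv_seq_loxodromic:
  assumes g: "conv_seq g a b" and "a \<noteq> b" and "e > 0"
  shows "\<forall>\<^sub>F n in sequentially. \<exists>a' b'. loxodromic \<Gamma> (g n) a' b' \<and> dist a' a < e \<and> dist b' b < e"
proof -
  obtain p where p: "p \<noteq> a" "p \<noteq> b" using ex_avoid2 by blast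
  \<comment> \<open>A third of the smallest distance keeps the closed balls about \<open>a\<close>
    and \<open>b\<close> disjoint and \<open>p\<close> outside both, and puts the fixed points
    within \<open>e\<close>.\<close>
  define \<rho> where "\<rho> = Min {e, dist a b, dist p a, dist p b} / 3"
  have \<rho>: "0 < \<rho>" "3 * \<rho> \<le> e" "3 * \<rho> \<le> dist a b" "3 * \<rho> \<le> dist p a" "3 * \<rho> \<le> dist p b"
    using assms p by (auto simp: \<rho>_def)
  have ev: "\<forall>\<^sub>F n in sequentially. \<forall>z. z \<notin> ball b \<rho> \<longrightarrow> g n z \<in> ball a \<rho>"
    by (rule conv_seq_unif[OF g]) (use \<rho> in auto)
  have cl: "closure (ball b \<rho>) \<subseteq> cball b \<rho>" "closure (ball a \<rho>) \<subseteq> cball a \<rho>"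
    by (simp_all add: closure_minimal ball_subset_cball)
  have dis: "cball b \<rho> \<inter> cball a \<rho> = {}"
  proof (rule equals0I)
    fix z assume "z \<in> cball b \<rho> \<inter> cball a \<rho>"
    then have "dist a b \<le> 2 * \<rho>" using dist_triangle2[of a b z] by (simp add: dist_commute)
    then show False using \<rho> by simp
  qed
  from ev show ?thesis
  proof eventually_elim
    case (elim n)
    have "ping_pong (g n) (ball b \<rho>) (ball a \<rho>) p"
      unfolding ping_pong_def using elim conv_seq_in[OF g] cl dis \<rho>
      by (auto simp: dist_commute)
    from ping_pong_loxodromic[OF this] obtain a' b' where
      "a' \<in> closure (ball a \<rho>)" "b' \<in> closure (ball b \<rho>)" "loxodromic \<Gamma> (g n) a' b'" by blast
    then have "loxodromic \<Gamma> (g n) a' b' \<and> dist a' a < e \<and> dist b' b < e"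
      using cl \<rho> by (auto simp: dist_commute subset_iff intro: le_less_trans)
    then show ?case by blast
  qed
qed

text \<open>Two loxodromic elements \<open>g\<close>, \<open>h\<close> with the same repelling point \<open>y\<close> and different attracting
  points give a sequence \<open>h\<^sup>m g\<^sup>-\<^sup>n\<close> under which three points have three distinct limits.\<close>

lemma no_global_fixed_point: "\<exists>\<gamma>\<in>\<Gamma>. \<gamma> y \<noteq> y"
proof (rule ccontr)
  assume "\<not> ?thesis"
  then have fix_y: "\<And>\<gamma>. \<gamma> \<in> \<Gamma> \<Longrightarrow> \<gamma> y = y" by blast
  \<comment> \<open>With \<open>y\<close> fixed by everything, a sequence attracted to
    \<open>x\<close> must be repelled by \<open>y\<close>, since otherwise it would move
    \<open>y\<close> towards \<open>x\<close>. The loxodromic elements nearby have repelling point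
    \<open>y\<close> as well, because their inverse powers fix \<open>y\<close>.\<close>
  have lox: "\<exists>g a. loxodromic \<Gamma> g a y \<and> dist a x < e" if x: "x \<in> limit_set \<Gamma>" "x \<noteq> y" and "e > 0" for x e
  proof -
    obtain g b where g: "conv_seq g x b" using limit_set_conv_seq[OF x(1)] by blast
    have "b = y"
    proof (rule ccontr)
      assume "b \<noteq> y"
      then have "(\<lambda>n. g n y) \<longlonglongrightarrow> x" by (intro conv_seqM[OF g tendsto_const]) simp
      then show False using fix_y[OF conv_seq_in[OF g]] x(2) by (simp add: LIMSEQ_const_iff)
    qed
    have "min e (dist x y) > 0" using \<open>e > 0\<close> x(2) by simp
    from eventually_happens'[OF _ conv_seq_loxodromic[OF g _ this]] \<open>b = y\<close> x(2)
    obtain h a' b' where h: "loxodromic \<Gamma> h a' b'" "dist a' x < min e (dist x y)" by auto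
    have hG: "h \<in> \<Gamma>" using h(1) by (simp add: loxodromic_def)
    have "a' \<noteq> y" using h(2) by (auto simp: dist_commute)
    then have "(\<lambda>n. (inv h ^^ n) y) \<longlonglongrightarrow> b'"
      using h(1) unfolding loxodromic_def by (intro loc_unif_M[of a']) auto
    then have "b' = y" using fix_y[OF pow_in[OF inv_in[OF hG]]] by (simp add: LIMSEQ_const_iff)
    then show ?thesis using h by auto
  qed
  obtain x1 where x1: "x1 \<in> limit_set \<Gamma>" "x1 \<noteq> y" using ex_avoid2 by blast
  obtain g a where ga: "loxodromic \<Gamma> g a y" using lox[OF x1, of 1] by auto
  obtain x2 where x2: "x2 \<in> limit_set \<Gamma>" "x2 \<noteq> y" "x2 \<noteq> a" using ex_avoid2 by blast
  obtain h c where hc: "loxodromic \<Gamma> h c y" "dist c x2 < dist a x2"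
    using lox[OF x2(1,2), of "dist a x2"] x2(3) by auto
  have ac: "a \<noteq> c" using hc(2) by auto
  have g: "g \<in> \<Gamma>" "g a = a" "a \<noteq> y" and g_lim: "\<And>z. z \<noteq> a \<Longrightarrow> (\<lambda>n. (inv g ^^ n) z) \<longlonglongrightarrow> y"
    using ga loc_unif_M unfolding loxodromic_def by blast+
  have h: "h \<in> \<Gamma>" "h c = c" "c \<noteq> y" and h_lim: "\<And>z. z \<noteq> y \<Longrightarrow> (\<lambda>n. (h ^^ n) z) \<longlonglongrightarrow> c"
    using hc(1) loc_unif_M unfolding loxodromic_def by blast+
  have ga_pow: "(inv g ^^ n) a = a" for n
  proof -
    have "inv g a = a" using inv_app(2)[OF g(1), of a] g(2) by simp
    then show ?thesis by (induction n) auto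
  qed
  obtain p where p: "p \<noteq> a" "p \<noteq> y" using ex_avoid2 by blast
  define U where "U = ball y (dist c y / 2)"
  have U: "open U" "y \<in> U" using h(3) by (auto simp: U_def)
  have "closure U \<subseteq> cball y (dist c y / 2)"
    unfolding U_def by (simp add: closure_minimal ball_subset_cball)
  then have cU: "c \<notin> closure U" using h(3) by (auto simp: dist_commute subset_iff)
  \<comment> \<open>The shell that an orbit of \<open>h\<close> enters when it first leaves
    \<open>U\<close>. It is closed and avoids \<open>y\<close> and \<open>c\<close>, so a limit in
    it is a third point.\<close>
  define K where "K = h ` closure U - U"
  have "homeomorphism UNIV UNIV h (inv h)" using homeo h(1) by blast
  have "closed (h ` closure U)"
    using continuous_closed_vimage[of "closure U" "inv h"] cont_in[OF inv_in[OF h(1)]]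
    by (simp add: image_eq_vimage_inv[OF h(1)] continuous_on_eq_continuous_at)
  then have K: "closed K" "y \<notin> K" "c \<notin> K"
  proof -
    show "c \<notin> K" using cU h(1,2) inj_iff_in[OF h(1)] by (auto simp: K_def)
  qed (use U in \<open>auto simp: K_def closed_Diff\<close>)
  define q where "q n = (inv g ^^ n) p" for n
  have q_lim: "q \<longlonglongrightarrow> y" unfolding q_def by (rule g_lim[OF p(1)])
  have qy: "q n \<noteq> y" for n
    unfolding q_def using fix_y[OF pow_in[OF inv_in[OF g(1)]], of n] p(2)
      inj_iff_in[OF pow_in[OF inv_in[OF g(1)]], of n p y] by auto
  have ex_out: "\<exists>m. (h ^^ m) (q n) \<notin> U" for n
  proof -
    have "open (- closure U)" "c \<in> - closure U" using cU by auto
    from topological_tendstoD[OF h_lim[OF qy] this] show ?thesis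
      using closure_subset unfolding eventually_sequentially by blast
  qed
  \<comment> \<open>The first exit time from \<open>U\<close>. It tends to infinity because
    \<open>q n\<close> tends to \<open>y\<close>, which every power of \<open>h\<close> fixes. So
    \<open>h ^^ m n\<close> carries \<open>a\<close> towards \<open>c\<close>, while it leaves
    \<open>q n\<close>, the image of \<open>p\<close>, in the shell \<open>K\<close>.\<close>
  define m where "m n = (LEAST k. (h ^^ k) (q n) \<notin> U)" for n
  have m_out: "(h ^^ m n) (q n) \<notin> U" for n
    unfolding m_def by (rule LeastI_ex[OF ex_out])
  have m_in: "(h ^^ k) (q n) \<in> U" if "k < m n" for k n
    using not_less_Least[of k "\<lambda>k. (h ^^ k) (q n) \<notin> U"] that unfolding m_def by blast
  have ev_m: "\<forall>\<^sub>F n in sequentially. m n \<ge> N" for N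
  proof -
    have "\<forall>\<^sub>F n in sequentially. (h ^^ k) (q n) \<in> U" for k
    proof -
      have "isCont (h ^^ k) y"
        using cont_in[OF pow_in[OF h(1)]] by (simp add: continuous_on_eq_continuous_at)
      from isCont_tendsto_compose[OF this q_lim]
      have "(\<lambda>n. (h ^^ k) (q n)) \<longlonglongrightarrow> y" using fix_y[OF pow_in[OF h(1)]] by simp
      then show ?thesis using U topological_tendstoD by blast
    qed
    then have "\<forall>\<^sub>F n in sequentially. \<forall>k\<in>{..<N}. (h ^^ k) (q n) \<in> U"
      by (intro eventually_ball_finite) auto
    then show ?thesis
    proof eventually_elim
      case (elim n)
      show ?case
      proof (rule ccontr)
        assume "\<not> N \<le> m n"
        then show False using elim m_out[of n] by auto
      qed
    qed
  qed
  then have m_top: "filterlim m at_top sequentially" by (simp add: filterlim_at_top)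
  have m_K: "\<forall>\<^sub>F n in sequentially. (h ^^ m n) (q n) \<in> K"
    using ev_m[of 1]
  proof eventually_elim
    case (elim n)
    then obtain j where j: "m n = Suc j" by (metis One_nat_def Suc_le_D)
    then have "(h ^^ j) (q n) \<in> closure U" using m_in[of j n] closure_subset by auto
    then show ?case using m_out[of n] unfolding K_def j by auto
  qed
  define \<phi> where "\<phi> n = h ^^ m n \<circ> inv g ^^ n" for n
  have \<phi>G: "\<phi> n \<in> \<Gamma>" for n
    unfolding \<phi>_def using comp_in[OF pow_in[OF h(1)] pow_in[OF inv_in[OF g(1)]]] .
  have \<phi>a: "\<phi> n a = (h ^^ m n) a" for n by (simp add: \<phi>_def ga_pow)
  have \<phi>a_lim: "(\<lambda>n. \<phi> n a) \<longlonglongrightarrow> c"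
    unfolding \<phi>a using filterlim_compose[OF h_lim[OF g(3)] m_top] .
  have \<phi>p: "\<forall>\<^sub>F n in sequentially. \<phi> n p \<in> K"
    using m_K by (simp add: \<phi>_def q_def)
  show False
  proof (cases rule: seq_dichotomy[of \<phi>, OF \<phi>G, case_names const conv])
    case (const r \<gamma>)
    have "(\<lambda>n. \<phi> (r n) a) \<longlonglongrightarrow> c"
      using LIMSEQ_subseq_LIMSEQ[OF \<phi>a_lim const(1)] by (simp add: o_def)
    then have "\<gamma> a = c" using const(3) by (simp add: LIMSEQ_const_iff)
    then have "(h ^^ m (r 0)) a = c" using \<phi>a[of "r 0"] const(3) by simp
    moreover have "(h ^^ k) c = c" for k using h(2) by (induction k) auto
    ultimately have "(h ^^ m (r 0)) a = (h ^^ m (r 0)) c" by simp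
    then show False using inj_iff_in[OF pow_in[OF h(1)]] ac by blast
  next
    case (conv r x0 z0)
    have a_x0: "x0 = c" if "a \<noteq> z0"
    proof -
      have "(\<lambda>n. \<phi> (r n) a) \<longlonglongrightarrow> x0" by (rule conv_seqM[OF conv(2) tendsto_const that])
      moreover have "(\<lambda>n. \<phi> (r n) a) \<longlonglongrightarrow> c"
        using LIMSEQ_subseq_LIMSEQ[OF \<phi>a_lim conv(1)] by (simp add: o_def)
      ultimately show ?thesis using LIMSEQ_unique by blast
    qed
    have y_x0: "x0 = y" if "y \<noteq> z0"
    proof -
      have "(\<lambda>n. \<phi> (r n) y) \<longlonglongrightarrow> x0" by (rule conv_seqM[OF conv(2) tendsto_const that])
      then show ?thesis using fix_y[OF \<phi>G] by (simp add: LIMSEQ_const_iff)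
    qed
    have p_x0: "x0 \<in> K" if "p \<noteq> z0"
    proof -
      have "(\<lambda>n. \<phi> (r n) p) \<longlonglongrightarrow> x0" by (rule conv_seqM[OF conv(2) tendsto_const that])
      moreover have "\<forall>\<^sub>F n in sequentially. \<phi> (r n) p \<in> K"
        by (rule eventually_subseq[OF conv(1) \<phi>p])
      ultimately show ?thesis using Lim_in_closed_set[OF K(1), of "\<lambda>n. \<phi> (r n) p" sequentially x0] by simp
    qed
    \<comment> \<open>At most one of \<open>a\<close>, \<open>y\<close> and \<open>p\<close> is the
      repelling point, so the attracting point would coincide with two of the following:
      \<open>c\<close>, \<open>y\<close>, a point of \<open>K\<close>.\<close>
    show False using a_x0 y_x0 p_x0 K h(3) p g(3) by metis
  qed
qed

section \<open>Magnitudes and quasi-conformal measures\<close>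

definition big :: "real \<Rightarrow> ('m \<Rightarrow> 'm) \<Rightarrow> 'm set" where
  "big e \<gamma> = {x. e < d (Inr x) (Inl (inv \<gamma>))}"

text \<open>The cocycle relation is evaluated at a point \<open>x\<close> away from
  \<open>inv \<theta>\<close> and from the inverse of the product, with \<open>\<theta> x\<close>
  away from \<open>inv \<gamma>\<close>: all three values then approximate magnitudes. Such a point
  is found along a subsequence. If the \<open>\<theta> n\<close> collapse M minus \<open>b\<close>
  to \<open>a\<close>, every \<open>x\<close> other than \<open>b\<close> works, since the inverses
  of the \<open>\<gamma> n\<close> tend to a point other than \<open>Inr a\<close>.\<close>

lemma magnitude_add:
  assumes co: "coarse_cocycle \<Gamma> \<sigma>" and mag: "magnitude_function \<Gamma> d \<sigma> N" and e: "e > 0"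
  shows "\<exists>C. \<forall>\<gamma>\<in>\<Gamma>. \<forall>\<theta>\<in>\<Gamma>. e < d (Inl \<theta>) (Inl (inv \<gamma>)) \<longrightarrow> \<bar>N (\<gamma> \<circ> \<theta>) - N \<gamma> - N \<theta>\<bar> \<le> C"
proof (rule ccontr)
  assume contr: "\<not> ?thesis"
  have "\<forall>n :: nat. \<exists>\<gamma> \<theta>. \<gamma> \<in> \<Gamma> \<and> \<theta> \<in> \<Gamma> \<and> e < d (Inl \<theta>) (Inl (inv \<gamma>)) \<and>
      \<bar>N (\<gamma> \<circ> \<theta>) - N \<gamma> - N \<theta>\<bar> > real n"
    using contr not_le by meson
  then obtain \<gamma> \<theta> where \<gamma>: "\<And>n :: nat. \<gamma> n \<in> \<Gamma>" and \<theta>: "\<And>n. \<theta> n \<in> \<Gamma>"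
    and sep: "\<And>n. e < d (Inl (\<theta> n)) (Inl (inv (\<gamma> n)))"
    and big: "\<And>n. \<bar>N (\<gamma> n \<circ> \<theta> n) - N (\<gamma> n) - N (\<theta> n)\<bar> > real n"
    by metis
  obtain \<kappa> where \<kappa>: "\<And>\<gamma>1 \<gamma>2 x. \<gamma>1 \<in> \<Gamma> \<Longrightarrow> \<gamma>2 \<in> \<Gamma> \<Longrightarrow>
      \<bar>\<sigma> (\<gamma>1 \<circ> \<gamma>2) x - (\<sigma> \<gamma>1 (\<gamma>2 x) + \<sigma> \<gamma>2 x)\<bar> \<le> \<kappa>"
    using co unfolding coarse_cocycle_def coarse_cocycle_const_def by blast
  \<comment> \<open>A suitable point along a subsequence bounds the defect by three magnitude errors
    and one cocycle error, whereas by choice it exceeds the index.\<close>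
  have finish: False
    if k: "strict_mono (k :: nat \<Rightarrow> nat)"
      and es: "\<exists>e>0. \<forall>\<^sub>F n in sequentially. e < d (Inr x) (Inl (inv (\<theta> (k n))))"
         "\<exists>e>0. \<forall>\<^sub>F n in sequentially. e < d (Inr (\<theta> (k n) x)) (Inl (inv (\<gamma> (k n))))"
        "\<exists>e>0. \<forall>\<^sub>F n in sequentially. e < d (Inr x) (Inl (inv (\<gamma> (k n) \<circ> \<theta> (k n))))"
    for k x
  proof -
    obtain e1 e2 e3 where e123: "e1 > 0" "e2 > 0" "e3 > 0"
      "\<forall>\<^sub>F n in sequentially. e1 < d (Inr x) (Inl (inv (\<theta> (k n))))"
      "\<forall>\<^sub>F n in sequentially. e2 < d (Inr (\<theta> (k n) x)) (Inl (inv (\<gamma> (k n))))"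
      "\<forall>\<^sub>F n in sequentially. e3 < d (Inr x) (Inl (inv (\<gamma> (k n) \<circ> \<theta> (k n))))"
      using es by blast
    define e' where "e' = min e1 (min e2 e3)"
    have "e' > 0" using e123 by (simp add: e'_def)
    then obtain C where C: "\<And>\<gamma> x. \<gamma> \<in> \<Gamma> \<Longrightarrow> e' < d (Inr x) (Inl (inv \<gamma>)) \<Longrightarrow> \<bar>\<sigma> \<gamma> x - N \<gamma>\<bar> \<le> C"
      using mag unfolding magnitude_function_def by (metis abs_diff_le_iff diff_le_eq add.commute)
    have "\<forall>\<^sub>F n in sequentially. real n > 3 * C + \<kappa>"
      using filterlim_real_sequentially by (simp add: filterlim_at_top_dense)
    with e123(4-6) have "\<forall>\<^sub>F n in sequentially. False"
    proof eventually_elim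
      case (elim n)
      have "\<bar>\<sigma> (\<theta> (k n)) x - N (\<theta> (k n))\<bar> \<le> C"
        "\<bar>\<sigma> (\<gamma> (k n)) (\<theta> (k n) x) - N (\<gamma> (k n))\<bar> \<le> C"
        "\<bar>\<sigma> (\<gamma> (k n) \<circ> \<theta> (k n)) x - N (\<gamma> (k n) \<circ> \<theta> (k n))\<bar> \<le> C"
        by (rule C; use elim \<gamma> \<theta> in \<open>simp add: e'_def\<close>)+
      moreover have "real n \<le> real (k n)" using seq_suble[OF k, of n] by simp
      ultimately show False using \<kappa>[OF \<gamma>[of "k n"] \<theta>[of "k n"], of x] big[of "k n"] elim(4) by linarith
    qed
    then show False by simp
  qed
  show False
  proof (cases rule: seq_dichotomy[of \<theta>, OF \<theta>, case_names const conv])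
    case (const r t)
    obtain p q where q: "p \<in> X" "strict_mono (q :: nat \<Rightarrow> nat)" "cvg (\<lambda>n. Inl (inv (\<gamma> (r (q n))))) p"
      by (rule X_subseq[of "\<lambda>n. Inl (inv (\<gamma> (r n)))"]) (use \<gamma> in auto)
    define k where "k n = r (q n)" for n
    have k: "strict_mono k" using const(1) q(2) by (simp add: strict_mono_def k_def)
    have tk: "\<theta> (k n) = t" for n by (simp add: k_def const)
    have q3: "cvg (\<lambda>n. Inl (inv (\<gamma> (k n)))) p" using q(3) by (simp add: k_def)
    have "\<exists>x. Inr (t x) \<noteq> p"
    proof (rule ccontr)
      assume *: "\<nexists>x. Inr (t x) \<noteq> p"
      obtain u v :: 'm where "u \<noteq> v" using ex_three by blast
      then show False using * inj_iff_in[OF const(2), of u v] by (metis Inr_inject)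
    qed
    then obtain x where x: "Inr (t x) \<noteq> p" by blast
    have 1: "\<exists>e>0. \<forall>\<^sub>F n in sequentially. e < d (Inr x) (Inl (inv (\<theta> (k n))))"
      by (rule cvg_ne[of _ "Inr x" _ "Inl (inv t)"]) (use const(2) tk in auto)
    have 2: "\<exists>e>0. \<forall>\<^sub>F n in sequentially. e < d (Inr (\<theta> (k n) x)) (Inl (inv (\<gamma> (k n))))"
      by (rule cvg_ne[of _ "Inr (t x)" _ p]) (use const(2) tk x q q3 \<gamma> in auto)
    have "cvg (\<lambda>n. act (inv t) (Inl (inv (\<gamma> (k n))))) (act (inv t) p)"
      by (rule cvg_act) (use const(2) q3 q(1) \<gamma> in auto)
    then have c3: "cvg (\<lambda>n. Inl (inv (\<gamma> (k n) \<circ> \<theta> (k n)))) (act (inv t) p)"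
      using tk \<gamma> const(2) by simp
    have "Inr x \<noteq> act (inv t) p"
      using x act_inv(1)[OF const(2), of p] by (metis map_sum.simps(2))
    then have 3: "\<exists>e>0. \<forall>\<^sub>F n in sequentially. e < d (Inr x) (Inl (inv (\<gamma> (k n) \<circ> \<theta> (k n))))"
      by (intro cvg_ne[OF _ c3]) (use const(2) q(1) \<gamma> \<theta> in \<open>auto simp del: inv_comp\<close>)
    show False by (rule finish[OF k 1 2 3])
  next
    case (conv r a b)
    obtain p q where q: "p \<in> X" "strict_mono (q :: nat \<Rightarrow> nat)" "cvg (\<lambda>n. Inl (inv (\<gamma> (r (q n))))) p"
      by (rule X_subseq[of "\<lambda>n. Inl (inv (\<gamma> (r n)))"]) (use \<gamma> in auto)
    define k where "k n = r (q n)" for n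
    have k: "strict_mono k" using conv(1) q(2) by (simp add: strict_mono_def k_def)
    have c: "conv_seq (\<lambda>n. \<theta> (k n)) a b"
      using conv_seq_sub[OF conv(2) q(2)] by (simp add: k_def)
    have q3: "cvg (\<lambda>n. Inl (inv (\<gamma> (k n)))) p" using q(3) by (simp add: k_def)
    have pa: "Inr a \<noteq> p"
      by (rule cvg_ge_ne[OF conv_seq_Inl[OF c] q3 _ _ _ q(1) e less_imp_le[OF sep]]) (use \<gamma> \<theta> in auto)
    obtain x where x: "x \<noteq> b" using ex_avoid2 by blast
    have 1: "\<exists>e>0. \<forall>\<^sub>F n in sequentially. e < d (Inr x) (Inl (inv (\<theta> (k n))))"
      by (rule cvg_ne[OF _ conv_seq_Inl_inv[OF c], of _ "Inr x"]) (use x \<theta> in auto)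
    have "cvg (\<lambda>n. Inr (\<theta> (k n) x)) (Inr a)"
      unfolding cvg_Inr by (rule conv_seqM[OF c tendsto_const x])
    then have 2: "\<exists>e>0. \<forall>\<^sub>F n in sequentially. e < d (Inr (\<theta> (k n) x)) (Inl (inv (\<gamma> (k n))))"
      by (rule cvg_ne[OF _ q3]) (use pa q \<gamma> in auto)
    have "cvg (\<lambda>n. act (inv (\<theta> (k n))) (Inl (inv (\<gamma> (k n))))) (Inr b)"
      by (rule conv_seqD[OF conv_seq_inv[OF c] _ q(1) _ q3]) (use \<gamma> pa in auto)
    then have c3: "cvg (\<lambda>n. Inl (inv (\<gamma> (k n) \<circ> \<theta> (k n)))) (Inr b)"
      using \<gamma> \<theta> by simp
    have 3: "\<exists>e>0. \<forall>\<^sub>F n in sequentially. e < d (Inr x) (Inl (inv (\<gamma> (k n) \<circ> \<theta> (k n))))"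
      by (rule cvg_ne[OF _ c3, of _ "Inr x"]) (use x \<gamma> \<theta> in \<open>auto simp del: inv_comp\<close>)
    show False by (rule finish[OF k 1 2 3])
  qed
qed

text \<open>The elements are eventually loxodromic with fixed points near \<open>a\<close> and
  \<open>b\<close>, so properness drives their cocycle values at the attracting fixed points to
  infinity. These points stay away from the inverses, which tend to \<open>b\<close>, so the
  magnitudes have to grow as well.\<close>

lemma magnitude_unbounded_conv:
  assumes pr: "proper_cocycle \<Gamma> d \<sigma>" and mag: "magnitude_function \<Gamma> d \<sigma> N"
    and g: "conv_seq g a b" "inj g" and ab: "a \<noteq> b" and bd: "\<forall>\<^sub>F n in sequentially. N (g n) \<le> C"
  shows False
proof -
  let ?P = "\<lambda>n e. \<exists>a' b'. loxodromic \<Gamma> (g n) a' b' \<and> dist a' a < e \<and> dist b' b < e"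
  have evP: "\<exists>n>m. ?P n (1 / real (Suc k)) \<and> N (g n) \<le> C" for m k :: nat
  proof -
    have "\<forall>\<^sub>F n in sequentially. ?P n (1 / real (Suc k)) \<and> N (g n) \<le> C \<and> n > m"
      by (intro eventually_conj conv_seq_loxodromic[OF g(1) ab] bd eventually_gt_at_top) simp
    then show ?thesis using eventually_happens'[OF sequentially_bot] by blast
  qed
  have "\<exists>f. \<forall>n. (?P (f n) (1 / real (Suc n)) \<and> N (g (f n)) \<le> C) \<and> f n < f (Suc n)"
    by (rule dependent_nat_choice) (use evP in blast)+
  then obtain f where f: "\<And>n. ?P (f n) (1 / real (Suc n))" "\<And>n. N (g (f n)) \<le> C" "\<And>n. f n < f (Suc n)"
    by blast
  have fm: "strict_mono f" using f(3) by (simp add: strict_mono_Suc_iff)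
  obtain a' b' where ab': "\<And>n. loxodromic \<Gamma> (g (f n)) (a' n) (b' n)"
    "\<And>n. dist (a' n) a < 1 / real (Suc n)" "\<And>n. dist (b' n) b < 1 / real (Suc n)"
    using f(1) by metis
  have inv_lim: "(\<lambda>n. 1 / real (Suc n)) \<longlonglongrightarrow> 0" using LIMSEQ_inverse_real_of_nat by (simp add: inverse_eq_divide)
  have a_lim: "a' \<longlonglongrightarrow> a"
    by (rule metric_tendsto_imp_tendsto[OF inv_lim]) (use ab' in \<open>auto simp: less_imp_le dist_real_def\<close>)
  have b_lim: "b' \<longlonglongrightarrow> b"
    by (rule metric_tendsto_imp_tendsto[OF inv_lim]) (use ab' in \<open>auto simp: less_imp_le dist_real_def\<close>)
  obtain e where e: "e > 0" "\<forall>\<^sub>F n in sequentially. e < d (Inr (b' n)) (Inr (a' n))"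
    using cvg_ne[of "\<lambda>n. Inr (b' n)" "Inr b" "\<lambda>n. Inr (a' n)" "Inr a"] a_lim b_lim ab
    by (auto simp: cvg_Inr)
  have "ereal e \<le> Liminf sequentially (\<lambda>n. ereal (d (Inr (b' n)) (Inr (a' n))))"
    by (rule Liminf_bounded) (use e(2) in \<open>auto elim: eventually_mono\<close>)
  then have "Liminf sequentially (\<lambda>n. ereal (d (Inr (b' n)) (Inr (a' n)))) > 0"
    using e(1) by (metis ereal_less(2) less_le_trans)
  moreover have "inj (\<lambda>n. g (f n))"
    using inj_compose[OF g(2) strict_mono_imp_inj_on[OF fm]] by (simp add: o_def)
  ultimately have top: "filterlim (\<lambda>n. \<sigma> (g (f n)) (a' n)) at_top sequentially"
    using pr ab'(1) unfolding proper_cocycle_def by blast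
  have c: "conv_seq (\<lambda>n. g (f n)) a b" by (rule conv_seq_sub[OF g(1) fm])
  obtain e' where e': "e' > 0" "\<forall>\<^sub>F n in sequentially. e' < d (Inr (a' n)) (Inl (inv (g (f n))))"
    using cvg_ne[OF _ conv_seq_Inl_inv[OF c], of "\<lambda>n. Inr (a' n)" "Inr a"] a_lim ab conv_seq_in[OF c]
    by (auto simp: cvg_Inr)
  obtain C' where C': "\<And>\<gamma> x. \<gamma> \<in> \<Gamma> \<Longrightarrow> e' < d (Inr x) (Inl (inv \<gamma>)) \<Longrightarrow> \<sigma> \<gamma> x \<le> N \<gamma> + C'"
    using mag e'(1) unfolding magnitude_function_def by blast
  have "\<forall>\<^sub>F n in sequentially. C + C' < \<sigma> (g (f n)) (a' n)"
    using top by (simp add: filterlim_at_top_dense)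
  with e'(2) have "\<forall>\<^sub>F n in sequentially. False"
  proof eventually_elim
    case (elim n)
    have "\<sigma> (g (f n)) (a' n) \<le> N (g (f n)) + C'" by (rule C'[OF conv_seq_in[OF c] elim(1)])
    then show False using f(2)[of n] elim(2) by linarith
  qed
  then show False by simp
qed

text \<open>If the attracting and repelling points of a sequence of bounded magnitude differ,
  \<open>magnitude_unbounded_conv\<close> applies. If they agree, composing with an element that
  moves the attracting point separates them, and \<open>magnitude_add\<close> keeps the magnitudes
  bounded.\<close>

lemma magnitude_proper:
  assumes ex: "expanding_coarse_cocycle \<Gamma> d \<sigma>" and mag: "magnitude_function \<Gamma> d \<sigma> N"
  shows "finite {\<gamma> \<in> \<Gamma>. N \<gamma> \<le> C}"
proof (rule ccontr)
  assume "infinite {\<gamma> \<in> \<Gamma>. N \<gamma> \<le> C}"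
  then obtain g :: "nat \<Rightarrow> 'm \<Rightarrow> 'm" where g: "inj g" "range g \<subseteq> {\<gamma> \<in> \<Gamma>. N \<gamma> \<le> C}"
    using infinite_countable_subset by blast
  then have gG: "g n \<in> \<Gamma>" and gN: "N (g n) \<le> C" for n by auto
  have pr: "proper_cocycle \<Gamma> d \<sigma>" and co: "coarse_cocycle \<Gamma> \<sigma>"
    using ex by (auto simp: expanding_coarse_cocycle_def)
  obtain r a b where r: "strict_mono (r :: nat \<Rightarrow> nat)" "conv_seq (\<lambda>n. g (r n)) a b"
    using ex_conv_seq[of g, OF g(1) gG] by blast
  have inj: "inj (\<lambda>n. g (r n))"
    using inj_compose[OF g(1) strict_mono_imp_inj_on[OF r(1)]] by (simp add: o_def)
  show False
  proof (cases "a = b")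
    case False
    show False by (rule magnitude_unbounded_conv[OF pr mag r(2) inj False, of C]) (use gN in simp)
  next
    case True
    obtain \<eta> where \<eta>: "\<eta> \<in> \<Gamma>" "\<eta> a \<noteq> a" using no_global_fixed_point by blast
    have c: "conv_seq (\<lambda>n. \<eta> \<circ> g (r n)) (\<eta> a) b" by (rule conv_seq_comp_left[OF r(2) \<eta>(1)])
    obtain e where e: "e > 0" "\<forall>\<^sub>F n in sequentially. e < d (Inl (g (r n))) (Inl (inv \<eta>))"
      using cvg_ne[OF conv_seq_Inl[OF r(2)], of "\<lambda>n. Inl (inv \<eta>)" "Inl (inv \<eta>)"] \<eta> gG by auto
    obtain C' where C': "\<And>\<theta>. \<theta> \<in> \<Gamma> \<Longrightarrow> e < d (Inl \<theta>) (Inl (inv \<eta>)) \<Longrightarrow> \<bar>N (\<eta> \<circ> \<theta>) - N \<eta> - N \<theta>\<bar> \<le> C'"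
      using magnitude_add[OF co mag e(1)] \<eta>(1) by blast
    have "\<forall>\<^sub>F n in sequentially. N (\<eta> \<circ> g (r n)) \<le> N \<eta> + C + C'"
      using e(2)
    proof eventually_elim
      case (elim n)
      show ?case using C'[OF gG elim] gN[of "r n"] by linarith
    qed
    moreover have "inj (\<lambda>n. \<eta> \<circ> g (r n))"
    proof (rule injI)
      fix m n assume "\<eta> \<circ> g (r m) = \<eta> \<circ> g (r n)"
      then have "inv \<eta> \<circ> (\<eta> \<circ> g (r m)) = inv \<eta> \<circ> (\<eta> \<circ> g (r n))" by simp
      then have "g (r m) = g (r n)" using \<eta>(1) by simp
      then show "m = n" by (rule injD[OF inj])
    qed
    ultimately show False
      using magnitude_unbounded_conv[OF pr mag c] \<eta>(2) True by blast
  qed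
qed

text \<open>The Radon-Nikodym bounds of a Patterson-Sullivan measure in integrated form, on sets
  where the derivative is comparable to \<open>exp (- N \<gamma>)\<close>. The total mass is left
  free, zero included, so that restrictions to invariant sets qualify.\<close>

definition quasi_conformal :: "'m measure \<Rightarrow> (('m \<Rightarrow> 'm) \<Rightarrow> real) \<Rightarrow> bool" where
  "quasi_conformal \<mu> N \<longleftrightarrow> finite_measure \<mu> \<and> sets \<mu> = sets borel \<and>
     (\<forall>e>0. \<exists>C>0. \<forall>\<gamma>\<in>\<Gamma>. \<forall>E\<in>sets borel. E \<subseteq> big e \<gamma> \<longrightarrow>
        measure \<mu> (\<gamma> ` E) \<le> C * exp (- N \<gamma>) * measure \<mu> E \<and>
        exp (- N \<gamma>) * measure \<mu> E \<le> C * measure \<mu> (\<gamma> ` E))"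

lemma PS_quasi_conformal:
  assumes PS: "coarse_PS_measure \<Gamma> \<sigma> \<delta> \<mu>" and mag: "magnitude_function \<Gamma> d \<sigma> N"
  shows "quasi_conformal \<mu> (\<lambda>\<gamma>. \<delta> * N \<gamma>)"
proof -
  obtain C0 where C0: "PS_measure_const C0 \<Gamma> \<sigma> \<delta> \<mu>"
    using PS by (auto simp: coarse_PS_measure_def)
  have sets: "sets \<mu> = sets borel" and tot: "emeasure \<mu> UNIV = 1"
    using C0 by (auto simp: PS_measure_const_def)
  have space: "space \<mu> = UNIV" using sets_eq_imp_space_eq[OF sets] by simp
  interpret finite_measure \<mu> by standard (simp add: space tot)
  have "\<exists>C>0. \<forall>\<gamma>\<in>\<Gamma>. \<forall>E\<in>sets borel. E \<subseteq> big e \<gamma> \<longrightarrow>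
        measure \<mu> (\<gamma> ` E) \<le> C * exp (- (\<delta> * N \<gamma>)) * measure \<mu> E \<and>
        exp (- (\<delta> * N \<gamma>)) * measure \<mu> E \<le> C * measure \<mu> (\<gamma> ` E)"
    if "e > 0" for e
  proof -
    obtain C1 where C1: "C1 > 0" "\<And>\<gamma> x. \<gamma> \<in> \<Gamma> \<Longrightarrow> e < d (Inr x) (Inl (inv \<gamma>)) \<Longrightarrow>
        N \<gamma> - C1 \<le> \<sigma> \<gamma> x \<and> \<sigma> \<gamma> x \<le> N \<gamma> + C1"
      using mag \<open>e > 0\<close> unfolding magnitude_function_def by blast
    \<comment> \<open>The sign of \<delta> is not known here, so the error of \<sigma> enters with
      its absolute value.\<close>
    define K where "K = C0 + \<bar>\<delta>\<bar> * C1"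
    have main: "measure \<mu> (\<gamma> ` E) \<le> exp K * exp (- (\<delta> * N \<gamma>)) * measure \<mu> E \<and>
        exp (- (\<delta> * N \<gamma>)) * measure \<mu> E \<le> exp K * measure \<mu> (\<gamma> ` E)"
      if \<gamma>: "\<gamma> \<in> \<Gamma>" and E: "E \<in> sets borel" "E \<subseteq> big e \<gamma>" for \<gamma> E
    proof -
      \<comment> \<open>The push-forward by \<open>inv \<gamma>\<close> gives \<open>E\<close> the
        mass of its image under \<open>\<gamma>\<close>, and its density is governed by
        \<open>\<sigma> \<gamma>\<close>.\<close>
      let ?\<nu> = "distr \<mu> borel (inv \<gamma>)"
      let ?f = "RN_deriv \<mu> ?\<nu>"
      have ac: "absolutely_continuous \<mu> ?\<nu>" and
        AE: "AE x in \<mu>. ennreal (exp (- C0 - \<delta> * \<sigma> \<gamma> x)) \<le> ?f x \<and>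
           ?f x \<le> ennreal (exp (C0 - \<delta> * \<sigma> \<gamma> x))"
        using C0 inv_in[OF \<gamma>] inv_inv[OF \<gamma>] unfolding PS_measure_const_def by fastforce+
      have bm: "inv \<gamma> \<in> borel_measurable \<mu>"
        using borel_measurable_continuous_onI[OF cont_in[OF inv_in[OF \<gamma>]]] sets
          measurable_cong_sets[OF sets refl] by blast
      have "density \<mu> ?f = ?\<nu>"
        by (rule density_RN_deriv[OF ac]) (simp add: sets)
      then have "emeasure ?\<nu> E = (\<integral>\<^sup>+x. ?f x * indicator E x \<partial>\<mu>)"
        using emeasure_density[of ?f \<mu> E] E sets by (metis borel_measurable_RN_deriv)
      moreover have "emeasure ?\<nu> E = emeasure \<mu> (\<gamma> ` E)"
        using emeasure_distr[OF bm E(1)] by (simp add: space image_eq_vimage_inv[OF \<gamma>])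
      ultimately have eq: "emeasure \<mu> (\<gamma> ` E) = (\<integral>\<^sup>+x. ?f x * indicator E x \<partial>\<mu>)" by simp
      have \<sigma>: "\<bar>\<delta> * \<sigma> \<gamma> x - \<delta> * N \<gamma>\<bar> \<le> \<bar>\<delta>\<bar> * C1" if "x \<in> E" for x
      proof -
        have "\<bar>\<sigma> \<gamma> x - N \<gamma>\<bar> \<le> C1" using C1(2)[OF \<gamma>, of x] E that by (auto simp: big_def abs_le_iff)
        then have "\<bar>\<delta>\<bar> * \<bar>\<sigma> \<gamma> x - N \<gamma>\<bar> \<le> \<bar>\<delta>\<bar> * C1" by (intro mult_left_mono) auto
        then show ?thesis by (simp add: abs_mult[symmetric] right_diff_distrib)
      qed
      have Es: "E \<in> sets \<mu>" using E sets by simp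
      have "emeasure \<mu> (\<gamma> ` E) \<le> (\<integral>\<^sup>+x. ennreal (exp K * exp (- (\<delta> * N \<gamma>))) * indicator E x \<partial>\<mu>)"
        unfolding eq
      proof (rule nn_integral_mono_AE)
        show "AE x in \<mu>. ?f x * indicator E x \<le> ennreal (exp K * exp (- (\<delta> * N \<gamma>))) * indicator E x"
          using AE
        proof eventually_elim
          case (elim x)
          show ?case
          proof (cases "x \<in> E")
            case True
            have "exp (C0 - \<delta> * \<sigma> \<gamma> x) \<le> exp K * exp (- (\<delta> * N \<gamma>))"
              using \<sigma>[OF True] by (simp add: exp_add[symmetric] K_def)
            then have "ennreal (exp (C0 - \<delta> * \<sigma> \<gamma> x)) \<le> ennreal (exp K * exp (- (\<delta> * N \<gamma>)))"
              by (rule ennreal_leI)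
            from order_trans[OF conjunct2[OF elim] this] show ?thesis using True by simp
          qed simp
        qed
      qed
      also have "\<dots> = ennreal (exp K * exp (- (\<delta> * N \<gamma>))) * emeasure \<mu> E"
        using Es by (rule nn_integral_cmult_indicator)
      finally have up: "emeasure \<mu> (\<gamma> ` E) \<le> ennreal (exp K * exp (- (\<delta> * N \<gamma>)) * measure \<mu> E)"
        by (simp add: emeasure_eq_measure ennreal_mult)
      have "ennreal (exp (- K) * exp (- (\<delta> * N \<gamma>))) * emeasure \<mu> E =
          (\<integral>\<^sup>+x. ennreal (exp (- K) * exp (- (\<delta> * N \<gamma>))) * indicator E x \<partial>\<mu>)"
        using Es by (rule nn_integral_cmult_indicator[symmetric])
      also have "\<dots> \<le> emeasure \<mu> (\<gamma> ` E)"
        unfolding eq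
      proof (rule nn_integral_mono_AE)
        show "AE x in \<mu>. ennreal (exp (- K) * exp (- (\<delta> * N \<gamma>))) * indicator E x \<le> ?f x * indicator E x"
          using AE
        proof eventually_elim
          case (elim x)
          show ?case
          proof (cases "x \<in> E")
            case True
            have "exp (- K) * exp (- (\<delta> * N \<gamma>)) \<le> exp (- C0 - \<delta> * \<sigma> \<gamma> x)"
              using \<sigma>[OF True] by (simp add: exp_add[symmetric] K_def)
            then have "ennreal (exp (- K) * exp (- (\<delta> * N \<gamma>))) \<le> ennreal (exp (- C0 - \<delta> * \<sigma> \<gamma> x))"
              by (rule ennreal_leI)
            from order_trans[OF this conjunct1[OF elim]] show ?thesis using True by simp
          qed simp
        qed
      qed
      finally have lo: "ennreal (exp (- K) * exp (- (\<delta> * N \<gamma>)) * measure \<mu> E) \<le> emeasure \<mu> (\<gamma> ` E)"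
        by (simp add: emeasure_eq_measure ennreal_mult)
      have "measure \<mu> (\<gamma> ` E) \<le> exp K * exp (- (\<delta> * N \<gamma>)) * measure \<mu> E"
        using up by (simp add: emeasure_eq_measure ennreal_le_iff)
      moreover have "exp (- K) * exp (- (\<delta> * N \<gamma>)) * measure \<mu> E \<le> measure \<mu> (\<gamma> ` E)"
        using lo by (simp add: emeasure_eq_measure ennreal_le_iff)
      then have "exp K * (exp (- K) * exp (- (\<delta> * N \<gamma>)) * measure \<mu> E) \<le> exp K * measure \<mu> (\<gamma> ` E)"
        by (rule mult_left_mono) simp
      then have "exp (- (\<delta> * N \<gamma>)) * measure \<mu> E \<le> exp K * measure \<mu> (\<gamma> ` E)"
        by (simp add: mult.assoc[symmetric] exp_add[symmetric])
      ultimately show ?thesis by blast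
    qed
    show ?thesis by (intro exI[of _ "exp K"] conjI ballI impI) (use main in auto)
  qed
  then show ?thesis
    unfolding quasi_conformal_def using finite_measure_axioms sets by blast
qed

section \<open>Shadows\<close>

definition shadow :: "real \<Rightarrow> ('m \<Rightarrow> 'm) \<Rightarrow> 'm set" where
  "shadow e \<gamma> = \<gamma> ` big e \<gamma>"

lemma big_mono: "e \<le> e' \<Longrightarrow> big e' \<gamma> \<subseteq> big e \<gamma>"
  by (auto simp: big_def)

lemma shadow_mono: "e \<le> e' \<Longrightarrow> shadow e' \<gamma> \<subseteq> shadow e \<gamma>"
  unfolding shadow_def by (intro image_mono big_mono)

lemma continuous_d_Inr:
  assumes "p \<in> X" shows "continuous_on UNIV (\<lambda>x. d (Inr x) p)"
  unfolding continuous_on_sequentially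
proof (intro allI ballI impI)
  fix x :: "nat \<Rightarrow> 'm" and a assume "a \<in> UNIV" "(\<forall>n. x n \<in> UNIV) \<and> x \<longlonglongrightarrow> a"
  then have "(\<lambda>n. d (Inr (x n)) p) \<longlonglongrightarrow> d (Inr a) p"
    using assms by (intro d_cvg) (auto simp: cvg_Inr)
  then show "((\<lambda>x. d (Inr x) p) \<circ> x) \<longlonglongrightarrow> d (Inr a) p" by (simp add: o_def)
qed

lemma open_far: "p \<in> X \<Longrightarrow> open {x. e < d (Inr x) p}"
  and open_near: "p \<in> X \<Longrightarrow> open {x. d (Inr x) p < e}"
  by (intro open_Collect_less continuous_d_Inr continuous_on_const; simp)+

lemma open_big: "\<gamma> \<in> \<Gamma> \<Longrightarrow> open (big e \<gamma>)"
  unfolding big_def by (rule open_far) simp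

lemma open_shadow: "\<gamma> \<in> \<Gamma> \<Longrightarrow> open (shadow e \<gamma>)"
  unfolding shadow_def by (rule open_image_in[OF _ open_big])

lemma far_subset_big:
  assumes c: "cvg (\<lambda>n. Inl (inv (g n))) p" and g: "\<And>n. g n \<in> \<Gamma>" and p: "p \<in> X" and e: "e' < e"
  shows "\<forall>\<^sub>F n in sequentially. {x. e < d (Inr x) p} \<subseteq> big e' (g n)"
proof -
  have "\<forall>\<^sub>F n in sequentially. d (Inl (inv (g n))) p < e - e'"
    using c e unfolding cvg_def by (intro order_tendstoD(2)) auto
  then show ?thesis
  proof eventually_elim
    case (elim n)
    have "e' < d (Inr x) (Inl (inv (g n)))" if "e < d (Inr x) p" for x
      using triangle[of "Inr x" "Inl (inv (g n))" p] that elim p g by simp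
    then show ?case by (auto simp: big_def)
  qed
qed

lemma big_lim_ne:
  assumes "cvg (\<lambda>n. Inl (inv (g n))) p" "\<And>n. g n \<in> \<Gamma>" "p \<in> X" "e > 0"
    and "u \<longlonglongrightarrow> l" "\<And>n. u n \<in> big e (g n)"
  shows "Inr l \<noteq> p"
  by (rule cvg_ge_ne[of "\<lambda>n. Inr (u n)" _ "\<lambda>n. Inl (inv (g n))" _ e])
     (use assms in \<open>auto simp: cvg_Inr big_def less_imp_le\<close>)

lemma mem_shadow: "\<gamma> \<in> \<Gamma> \<Longrightarrow> x \<in> shadow e \<gamma> \<longleftrightarrow> inv \<gamma> x \<in> big e \<gamma>"
  by (simp add: shadow_def image_eq_vimage_inv)

text \<open>Some element moves \<open>b\<close>, and \<open>b\<close> has positive distance from the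
  inverse of that element, a point of \<Gamma>. An atom at \<open>b\<close> would therefore give
  mass to a different point.\<close>

lemma quasi_conformal_point:
  assumes qc: "quasi_conformal \<mu> N" and b: "measure \<mu> (- {b}) = 0"
  shows "measure \<mu> UNIV = 0"
proof (rule ccontr)
  assume nz: "measure \<mu> UNIV \<noteq> 0"
  interpret finite_measure \<mu> using qc by (simp add: quasi_conformal_def)
  have sets: "sets \<mu> = sets borel" using qc by (simp add: quasi_conformal_def)
  have bs: "{b} \<in> sets \<mu>" "- {b} \<in> sets \<mu>" by (simp_all add: sets)
  have "measure \<mu> UNIV = measure \<mu> {b} + measure \<mu> (- {b})"
    using finite_measure_Union[OF bs] by (simp add: Compl_partition)
  then have pos: "measure \<mu> {b} > 0" using nz b by (metis add.right_neutral measure_nonneg order_le_less)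
  obtain \<gamma> where \<gamma>: "\<gamma> \<in> \<Gamma>" "\<gamma> b \<noteq> b" using no_global_fixed_point by blast
  define e where "e = d (Inr b) (Inl (inv \<gamma>)) / 2"
  have "d (Inr b) (Inl (inv \<gamma>)) \<noteq> 0" using zero[of "Inr b" "Inl (inv \<gamma>)"] \<gamma> by simp
  then have "d (Inr b) (Inl (inv \<gamma>)) > 0" using nonneg[of "Inr b" "Inl (inv \<gamma>)"] by linarith
  then have e: "e > 0" "{b} \<subseteq> big e \<gamma>" by (auto simp: e_def big_def)
  obtain C where "exp (- N \<gamma>) * measure \<mu> {b} \<le> C * measure \<mu> (\<gamma> ` {b})"
    using qc e \<gamma>(1) bs(1) unfolding quasi_conformal_def sets by blast
  moreover have "measure \<mu> (\<gamma> ` {b}) \<le> measure \<mu> (- {b})"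
    by (rule finite_measure_mono) (use \<gamma> bs in auto)
  then have "measure \<mu> (\<gamma> ` {b}) = 0" using b measure_nonneg[of \<mu> "\<gamma> ` {b}"] by linarith
  ultimately have "exp (- N \<gamma>) * measure \<mu> {b} \<le> 0" by simp
  then show False using pos by (simp add: mult_le_0_iff not_le)
qed

lemma far_null:
  assumes fm: "finite_measure \<mu>" and sets: "sets \<mu> = sets borel" and E: "E \<in> sets borel" and p: "p \<in> X"
    and null: "\<And>e. e > 0 \<Longrightarrow> measure \<mu> (E \<inter> {x. e < d (Inr x) p}) = 0"
  shows "measure \<mu> (E \<inter> {x. Inr x \<noteq> p}) = 0"
proof -
  interpret finite_measure \<mu> by fact
  let ?A = "\<lambda>n. E \<inter> {x. inverse (real (Suc n)) < d (Inr x) p}"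
  have "?A n \<in> null_sets \<mu>" for n
    using null[of "inverse (real (Suc n))"] E open_far[OF p] sets
    by (auto simp: null_sets_def emeasure_eq_measure)
  then have "(\<Union>n. ?A n) \<in> null_sets \<mu>" by blast
  moreover have "(\<Union>n. ?A n) = E \<inter> {x. Inr x \<noteq> p}"
  proof (intro equalityI subsetI)
    fix x assume x: "x \<in> E \<inter> {x. Inr x \<noteq> p}"
    then have "d (Inr x) p > 0" using p nonneg[of "Inr x" p] zero[of "Inr x" p] by (simp add: less_le)
    then obtain n where "inverse (real (Suc n)) < d (Inr x) p" using reals_Archimedean by blast
    then show "x \<in> (\<Union>n. ?A n)" using x by blast
  next
    fix x assume "x \<in> (\<Union>n. ?A n)"
    then obtain n where "x \<in> E" "inverse (real (Suc n)) < d (Inr x) p" by blast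
    moreover have "inverse (real (Suc n)) > 0" by simp
    ultimately have "d (Inr x) p \<noteq> 0" by linarith
    then show "x \<in> E \<inter> {x. Inr x \<noteq> p}" using \<open>x \<in> E\<close> p by auto
  qed
  ultimately show ?thesis by (simp add: null_sets_def measure_def)
qed

text \<open>The lower half of the shadow lemma. If it failed with parameter and mass both tending to
  zero, \<mu> would vanish away from a limit \<open>p\<close> of the inverses. For \<open>p\<close>
  in \<Gamma> this means that \<mu> is zero; for \<open>p\<close> in M it contradicts
  \<open>quasi_conformal_point\<close>.\<close>

lemma big_measure_lower_bound:
  assumes qc: "quasi_conformal \<mu> N" and pos: "measure \<mu> UNIV > 0"
  shows "\<exists>e0>0. \<exists>c>0. \<forall>\<gamma>\<in>\<Gamma>. c \<le> measure \<mu> (big e0 \<gamma>)"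
proof (rule ccontr)
  assume contr: "\<not> ?thesis"
  interpret finite_measure \<mu> using qc by (simp add: quasi_conformal_def)
  have sets: "sets \<mu> = sets borel" using qc by (simp add: quasi_conformal_def)
  have "\<forall>n. \<exists>\<gamma>\<in>\<Gamma>. measure \<mu> (big (inverse (real (Suc n))) \<gamma>) < inverse (real (Suc n))"
  proof
    fix n
    have "inverse (real (Suc n)) > 0" by simp
    with contr show "\<exists>\<gamma>\<in>\<Gamma>. measure \<mu> (big (inverse (real (Suc n))) \<gamma>) < inverse (real (Suc n))"
      using not_le by blast
  qed
  then obtain g where g: "\<And>n. g n \<in> \<Gamma>"
    "\<And>n. measure \<mu> (big (inverse (real (Suc n))) (g n)) < inverse (real (Suc n))" by metis
  obtain p r where p: "p \<in> X" and r: "strict_mono (r :: nat \<Rightarrow> nat)" and c: "cvg (\<lambda>n. Inl (inv (g (r n)))) p"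
    by (rule X_subseq[of "\<lambda>n. Inl (inv (g n))"]) (use g in auto)
  have lim: "(\<lambda>n. inverse (real (Suc (r n)))) \<longlonglongrightarrow> 0"
    using LIMSEQ_subseq_LIMSEQ[OF LIMSEQ_inverse_real_of_nat r] by (simp add: o_def)
  have "measure \<mu> {x. e < d (Inr x) p} = 0" if "e > 0" for e
  proof -
    have "\<forall>\<^sub>F n in sequentially. {x. e < d (Inr x) p} \<subseteq> big (e / 2) (g (r n))"
      by (rule far_subset_big[OF c g(1) p]) (use that in simp)
    moreover have "\<forall>\<^sub>F n in sequentially. inverse (real (Suc (r n))) < e / 2"
      by (rule order_tendstoD(2)[OF lim]) (use that in simp)
    ultimately have "\<forall>\<^sub>F n in sequentially. measure \<mu> {x. e < d (Inr x) p} \<le> inverse (real (Suc (r n)))"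
    proof eventually_elim
      case (elim n)
      then have "{x. e < d (Inr x) p} \<subseteq> big (inverse (real (Suc (r n)))) (g (r n))"
        using big_mono[of "inverse (real (Suc (r n)))" "e / 2" "g (r n)"] by auto
      moreover have "big (inverse (real (Suc (r n)))) (g (r n)) \<in> sets \<mu>"
        using open_big[OF g(1)] sets by auto
      ultimately have "measure \<mu> {x. e < d (Inr x) p} \<le> measure \<mu> (big (inverse (real (Suc (r n)))) (g (r n)))"
        by (rule finite_measure_mono)
      then show ?case using g(2)[of "r n"] by linarith
    qed
    from tendsto_lowerbound[OF lim this] show ?thesis
      using measure_nonneg[of \<mu> "{x. e < d (Inr x) p}"] by simp
  qed
  then have null: "measure \<mu> {x. Inr x \<noteq> p} = 0"
    using far_null[OF finite_measure_axioms sets, of UNIV p] p by simp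
  show False
  proof (cases p)
    case (Inl \<gamma>)
    then show False using null pos by simp
  next
    case (Inr b)
    have "{x. Inr x \<noteq> p} = - {b}" using Inr by auto
    then show False using null quasi_conformal_point[OF qc, of b] pos by simp
  qed
qed

text \<open>Shadows through \<open>x\<close> shrink to \<open>x\<close>. Points of the shadow of
  \<open>g n\<close> are images of points that stay away from the repelling point, so they all tend
  to the attracting point; lying in every one of the shadows, \<open>x\<close> is that
  point.\<close>

lemma finite_shadow_not_subset:
  assumes U: "open U" "x \<in> U" and e: "e > 0"
  shows "finite {\<gamma> \<in> \<Gamma>. x \<in> shadow e \<gamma> \<and> \<not> shadow e \<gamma> \<subseteq> U}"
proof (rule ccontr)
  assume "infinite {\<gamma> \<in> \<Gamma>. x \<in> shadow e \<gamma> \<and> \<not> shadow e \<gamma> \<subseteq> U}"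
  then obtain g :: "nat \<Rightarrow> 'm \<Rightarrow> 'm" where
    g: "inj g" "range g \<subseteq> {\<gamma> \<in> \<Gamma>. x \<in> shadow e \<gamma> \<and> \<not> shadow e \<gamma> \<subseteq> U}"
    using infinite_countable_subset by blast
  then have gG: "g n \<in> \<Gamma>" and gx: "x \<in> shadow e (g n)" and gU: "\<not> shadow e (g n) \<subseteq> U" for n by auto
  obtain r a b where r: "strict_mono (r :: nat \<Rightarrow> nat)" "conv_seq (\<lambda>n. g (r n)) a b"
    using ex_conv_seq[of g, OF g(1) gG] by blast
  have lim: "\<exists>q :: nat \<Rightarrow> nat. strict_mono q \<and> (\<lambda>n. z (q n)) \<longlonglongrightarrow> a"
    if z: "\<And>n. z n \<in> shadow e (g (r n))" for z
  proof -
    obtain l q where q: "strict_mono (q :: nat \<Rightarrow> nat)" "(\<lambda>n. inv (g (r (q n))) (z (q n))) \<longlonglongrightarrow> l"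
      by (rule M_subseq[of "\<lambda>n. inv (g (r n)) (z n)"])
    have c: "conv_seq (\<lambda>n. g (r (q n))) a b" by (rule conv_seq_sub[OF r(2) q(1)])
    have "(Inr l :: ('m \<Rightarrow> 'm) + 'm) \<noteq> Inr b"
      by (rule big_lim_ne[OF conv_seq_Inl_inv[OF c] gG _ e q(2)]) (use z gG mem_shadow in auto)
    then have "l \<noteq> b" by simp
    from conv_seqM[OF c q(2) this] show ?thesis using q(1) gG by auto
  qed
  have "x = a" using lim[of "\<lambda>n. x"] gx by (auto simp: LIMSEQ_const_iff)
  have "\<forall>n. \<exists>z. z \<in> shadow e (g (r n)) \<and> z \<notin> U" using gU by blast
  then obtain z where z: "\<And>n. z n \<in> shadow e (g (r n))" "\<And>n. z n \<notin> U" by metis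
  obtain q :: "nat \<Rightarrow> nat" where q: "(\<lambda>n. z (q n)) \<longlonglongrightarrow> a" using lim[OF z(1)] by blast
  have "a \<in> - U" by (rule closed_sequentially[OF _ _ q]) (use U z in auto)
  then show False using U \<open>x = a\<close> by simp
qed

end

text \<open>What the geometry of shadows asks of a magnitude, with no cocycle left. It is
  instantiated first with the magnitude of the first cocycle, which gives the sign of the dimension,
  and then with both magnitudes scaled by their dimensions.\<close>

locale additive_magnitude = compactified_group \<Gamma> d
  for \<Gamma> :: "('m::metric_space \<Rightarrow> 'm) set" and d +
  fixes N :: "('m \<Rightarrow> 'm) \<Rightarrow> real"
  assumes additive: "e > 0 \<Longrightarrow> \<exists>C. \<forall>\<gamma>\<in>\<Gamma>. \<forall>\<theta>\<in>\<Gamma>. e < d (Inl \<theta>) (Inl (inv \<gamma>)) \<longrightarrow>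
      \<bar>N (\<gamma> \<circ> \<theta>) - N \<gamma> - N \<theta>\<bar> \<le> C"
    and proper: "finite {\<gamma> \<in> \<Gamma>. N \<gamma> \<le> C}"
begin

lemma conv_seq_N_unbounded:
  assumes g: "conv_seq g a b"
  shows "\<forall>\<^sub>F n in sequentially. C < N (g n)"
proof (rule ccontr)
  assume "\<not> ?thesis"
  then obtain r :: "nat \<Rightarrow> nat" where r: "strict_mono r" "\<And>n. \<not> C < N (g (r n))"
    using not_eventually_subseq by fast
  then have sub: "range (\<lambda>n. g (r n)) \<subseteq> {\<gamma> \<in> \<Gamma>. N \<gamma> \<le> C}" using conv_seq_in[OF g] by (auto simp: not_less)
  have gG: "\<And>n. g (r n) \<in> \<Gamma>" using conv_seq_in[OF g] by blast
  have "finite (range (\<lambda>n. g (r n)))" by (rule finite_subset[OF sub proper])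
  then obtain m where m: "infinite {n. g (r n) = g (r m)}"
    using pigeonhole_infinite[of "UNIV :: nat set" "\<lambda>n. g (r n)"] by auto
  have q: "strict_mono (enumerate {n. g (r n) = g (r m)})" by (rule strict_mono_enumerate[OF m])
  have qe: "g (r (enumerate {n. g (r n) = g (r m)} k)) = g (r m)" for k
    using enumerate_in_set[OF m, of k] by simp
  have "cvg (\<lambda>n. Inl (g (r m))) (Inr a)"
    using conv_seq_Inl[OF conv_seq_sub[OF conv_seq_sub[OF g r(1)] q]] by (simp add: qe)
  then show False
    using cvg_unique[of "\<lambda>n. Inl (g (r m))" "Inr a" "Inl (g (r m))"] gG by simp
qed

text \<open>As \<open>Inl \<theta>\<close> is isolated, the separation asked for by
  \<open>additive\<close> fails only for the single element \<open>inv \<theta>\<close>, whose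
  defect goes into the maximum.\<close>

lemma additive_fixed:
  assumes \<theta>: "\<theta> \<in> \<Gamma>"
  shows "\<exists>C. \<forall>\<gamma>\<in>\<Gamma>. \<bar>N (\<gamma> \<circ> \<theta>) - N \<gamma> - N \<theta>\<bar> \<le> C"
proof -
  obtain e where e: "e > 0" "\<And>p. p \<in> X \<Longrightarrow> d p (Inl \<theta>) < e \<Longrightarrow> p = Inl \<theta>"
    using isolated_Inl[OF \<theta>] by blast
  have "e / 2 > 0" using e(1) by simp
  from additive[OF this] obtain C where
    C: "\<And>\<gamma>. \<gamma> \<in> \<Gamma> \<Longrightarrow> e / 2 < d (Inl \<theta>) (Inl (inv \<gamma>)) \<Longrightarrow> \<bar>N (\<gamma> \<circ> \<theta>) - N \<gamma> - N \<theta>\<bar> \<le> C"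
    using \<theta> by blast
  have "\<bar>N (\<gamma> \<circ> \<theta>) - N \<gamma> - N \<theta>\<bar> \<le> max C \<bar>N id - N (inv \<theta>) - N \<theta>\<bar>" if \<gamma>: "\<gamma> \<in> \<Gamma>" for \<gamma>
  proof (cases "inv \<gamma> = \<theta>")
    case True
    then have "\<gamma> = inv \<theta>" using inv_inv[OF \<gamma>] by simp
    then show ?thesis using \<theta> by simp
  next
    case False
    then have "\<not> d (Inl (inv \<gamma>)) (Inl \<theta>) < e" using e(2)[of "Inl (inv \<gamma>)"] \<gamma> by auto
    then have "e / 2 < d (Inl \<theta>) (Inl (inv \<gamma>))" using e(1) commute[of "Inl \<theta>"] by simp
    then show ?thesis using C[OF \<gamma>] by simp
  qed
  then show ?thesis by blast
qed

text \<open>The common source of \<open>shadow_magnitude\<close> and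
  \<open>shadow_inclusion\<close>. A point in both shadows is the image under
  \<open>\<eta> n\<close> of a point \<open>v n\<close> that stays away from \<open>q\<close>.
  Suppose the quotients collapse and \<open>v n\<close> approaches their repelling point. Then the
  inverse quotients stay away from \<open>inv (\<eta> n)\<close>, and additivity makes
  \<open>N (\<gamma> n)\<close> exceed \<open>N (\<eta> n)\<close> by an unbounded amount. So the
  quotients carry \<open>v n\<close> to \<open>a\<close>, while the images stay away from
  \<open>p\<close>. The sequence \<open>x\<close> is refined along with the others for use in
  \<open>shadow_inclusion\<close>.\<close>

lemma shadow_sequences:
  fixes \<gamma> \<eta> :: "nat \<Rightarrow> 'm \<Rightarrow> 'm" and x :: "nat \<Rightarrow> 'm"
  assumes e: "e > 0" and \<gamma>: "\<And>n. \<gamma> n \<in> \<Gamma>" and \<eta>: "\<And>n. \<eta> n \<in> \<Gamma>"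
    and int: "\<And>n. shadow e (\<gamma> n) \<inter> shadow e (\<eta> n) \<noteq> {}"
    and le: "\<And>n. N (\<gamma> n) \<le> N (\<eta> n) + R"
  obtains k :: "nat \<Rightarrow> nat" and p q l where "strict_mono k" "p \<in> X" "q \<in> X"
    "cvg (\<lambda>n. Inl (inv (\<gamma> (k n)))) p" "cvg (\<lambda>n. Inl (inv (\<eta> (k n)))) q" "(\<lambda>n. x (k n)) \<longlonglongrightarrow> l"
    "(\<exists>\<theta>\<in>\<Gamma>. \<forall>n. inv (\<gamma> (k n)) \<circ> \<eta> (k n) = \<theta>) \<or>
     (\<exists>a b. conv_seq (\<lambda>n. inv (\<gamma> (k n)) \<circ> \<eta> (k n)) a b \<and> p \<noteq> Inr a)"
proof -
  note goal = that
  have "\<forall>n. \<exists>w. w \<in> shadow e (\<gamma> n) \<and> w \<in> shadow e (\<eta> n)" using int by blast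
  then obtain w where w: "\<And>n. w n \<in> shadow e (\<gamma> n)" "\<And>n. w n \<in> shadow e (\<eta> n)" by metis
  define v where "v n = inv (\<eta> n) (w n)" for n
  define \<theta> where "\<theta> n = inv (\<gamma> n) \<circ> \<eta> n" for n
  have \<theta>: "\<theta> n \<in> \<Gamma>" for n using \<gamma> \<eta> by (simp add: \<theta>_def)
  have vb: "v n \<in> big e (\<eta> n)" for n using w(2)[of n] \<eta> by (simp add: mem_shadow v_def)
  have ub: "\<theta> n (v n) \<in> big e (\<gamma> n)" for n
    using w(1)[of n] \<gamma> \<eta> by (simp add: mem_shadow v_def \<theta>_def)
  obtain p k1 where k1: "p \<in> X" "strict_mono (k1 :: nat \<Rightarrow> nat)" "cvg (\<lambda>n. Inl (inv (\<gamma> (k1 n)))) p"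
    by (rule X_subseq[of "\<lambda>n. Inl (inv (\<gamma> n))"]) (use \<gamma> in auto)
  obtain q k2 where k2: "q \<in> X" "strict_mono (k2 :: nat \<Rightarrow> nat)" "cvg (\<lambda>n. Inl (inv (\<eta> (k1 (k2 n))))) q"
    by (rule X_subseq[of "\<lambda>n. Inl (inv (\<eta> (k1 n)))"]) (use \<eta> in auto)
  obtain l k3 where k3: "strict_mono (k3 :: nat \<Rightarrow> nat)" "(\<lambda>n. x (k1 (k2 (k3 n)))) \<longlonglongrightarrow> l"
    by (rule M_subseq[of "\<lambda>n. x (k1 (k2 n))"])
  obtain l' k4 where k4: "strict_mono (k4 :: nat \<Rightarrow> nat)" "(\<lambda>n. v (k1 (k2 (k3 (k4 n))))) \<longlonglongrightarrow> l'"
    by (rule M_subseq[of "\<lambda>n. v (k1 (k2 (k3 n)))"])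
  define K where "K n = k1 (k2 (k3 (k4 n)))" for n
  have K: "strict_mono K" using k1(2) k2(2) k3(1) k4(1) by (simp add: strict_mono_def K_def)
  have k34: "strict_mono (\<lambda>n. k3 (k4 n))" using k3(1) k4(1) by (simp add: strict_mono_def)
  have k234: "strict_mono (\<lambda>n. k2 (k3 (k4 n)))" using k2(2) k34 by (simp add: strict_mono_def)
  have Kp: "cvg (\<lambda>n. Inl (inv (\<gamma> (K n)))) p" using cvg_subseq[OF k1(3) k234] by (simp add: K_def)
  have Kq: "cvg (\<lambda>n. Inl (inv (\<eta> (K n)))) q" using cvg_subseq[OF k2(3) k34] by (simp add: K_def)
  have Kx: "(\<lambda>n. x (K n)) \<longlonglongrightarrow> l" using LIMSEQ_subseq_LIMSEQ[OF k3(2) k4(1)] by (simp add: K_def o_def)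
  have Kv: "(\<lambda>n. v (K n)) \<longlonglongrightarrow> l'" using k4(2) by (simp add: K_def)
  have fin: thesis if r: "strict_mono (r :: nat \<Rightarrow> nat)" and
    "(\<exists>\<theta>'\<in>\<Gamma>. \<forall>n. \<theta> (K (r n)) = \<theta>') \<or> (\<exists>a b. conv_seq (\<lambda>n. \<theta> (K (r n))) a b \<and> p \<noteq> Inr a)" for r
  proof (rule goal[of "\<lambda>n. K (r n)" p q l])
    show "strict_mono (\<lambda>n. K (r n))" using K r by (simp add: strict_mono_def)
    show "(\<lambda>n. x (K (r n))) \<longlonglongrightarrow> l" using LIMSEQ_subseq_LIMSEQ[OF Kx r] by (simp add: o_def)
    show "(\<exists>\<theta>\<in>\<Gamma>. \<forall>n. inv (\<gamma> (K (r n))) \<circ> \<eta> (K (r n)) = \<theta>) \<or>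
     (\<exists>a b. conv_seq (\<lambda>n. inv (\<gamma> (K (r n))) \<circ> \<eta> (K (r n))) a b \<and> p \<noteq> Inr a)"
      using that(2) unfolding \<theta>_def .
  qed (use k1(1) k2(1) cvg_subseq[OF Kp r] cvg_subseq[OF Kq r] in auto)
  show thesis
  proof (cases rule: seq_dichotomy[of "\<lambda>n. \<theta> (K n)", OF \<theta>, case_names const conv])
    case (const r t)
    show thesis by (rule fin[OF const(1)]) (use const in blast)
  next
    case (conv r a b)
    have Kq': "cvg (\<lambda>n. Inl (inv (\<eta> (K (r n))))) q" by (rule cvg_subseq[OF Kq conv(1)])
    have Kp': "cvg (\<lambda>n. Inl (inv (\<gamma> (K (r n))))) p" by (rule cvg_subseq[OF Kp conv(1)])
    have Kv': "(\<lambda>n. v (K (r n))) \<longlonglongrightarrow> l'" using LIMSEQ_subseq_LIMSEQ[OF Kv conv(1)] by (simp add: o_def)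
    have l'q: "Inr l' \<noteq> q" by (rule big_lim_ne[OF Kq' \<eta> k2(1) e Kv' vb])
    have "l' \<noteq> b"
    proof
      assume "l' = b"
      obtain e' where e': "e' > 0"
        "\<forall>\<^sub>F n in sequentially. e' < d (Inl (inv (\<theta> (K (r n))))) (Inl (inv (\<eta> (K (r n)))))"
        using cvg_ne[OF conv_seq_Inl_inv[OF conv(2)] Kq'] \<theta> \<eta> k2(1) l'q \<open>l' = b\<close> by auto
      obtain C where C: "\<And>\<gamma> \<theta>. \<gamma> \<in> \<Gamma> \<Longrightarrow> \<theta> \<in> \<Gamma> \<Longrightarrow> e' < d (Inl \<theta>) (Inl (inv \<gamma>)) \<Longrightarrow>
          \<bar>N (\<gamma> \<circ> \<theta>) - N \<gamma> - N \<theta>\<bar> \<le> C"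
        using additive[OF e'(1)] by blast
      from e'(2) conv_seq_N_unbounded[OF conv_seq_inv[OF conv(2)], of "R + C"]
      have "\<forall>\<^sub>F n in sequentially. False"
      proof eventually_elim
        case (elim n)
        have "\<eta> (K (r n)) \<circ> inv (\<theta> (K (r n))) = \<gamma> (K (r n))"
          using \<gamma> \<eta> by (auto simp: \<theta>_def fun_eq_iff)
        then show False
          using C[OF \<eta>[of "K (r n)"] inv_in[OF \<theta>] elim(1)] le[of "K (r n)"] elim(2) by simp
      qed
      then show False by simp
    qed
    have "(\<lambda>n. \<theta> (K (r n)) (v (K (r n)))) \<longlonglongrightarrow> a" by (rule conv_seqM[OF conv(2) Kv' \<open>l' \<noteq> b\<close>])
    from big_lim_ne[OF Kp' \<gamma> k1(1) e this ub] have "p \<noteq> Inr a" by simp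
    then show thesis by (intro fin[OF conv(1)]) (use conv(2) in blast)
  qed
qed

text \<open>Since \<open>\<eta>\<close> is \<open>\<gamma>\<close> times the quotient, this is
  additivity once the quotient stays away from \<open>inv \<gamma>\<close>; a constant quotient is
  covered by \<open>additive_fixed\<close>.\<close>

lemma shadow_magnitude:
  assumes e: "e > 0"
  shows "\<exists>C. \<forall>\<gamma>\<in>\<Gamma>. \<forall>\<eta>\<in>\<Gamma>. shadow e \<gamma> \<inter> shadow e \<eta> \<noteq> {} \<longrightarrow> N \<gamma> \<le> N \<eta> + R \<longrightarrow>
     \<bar>N (inv \<gamma> \<circ> \<eta>) - (N \<eta> - N \<gamma>)\<bar> \<le> C"
proof (rule ccontr)
  assume contr: "\<not> ?thesis"
  have "\<forall>n :: nat. \<exists>\<gamma> \<eta>. \<gamma> \<in> \<Gamma> \<and> \<eta> \<in> \<Gamma> \<and> shadow e \<gamma> \<inter> shadow e \<eta> \<noteq> {} \<and> N \<gamma> \<le> N \<eta> + R \<and>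
      real n < \<bar>N (inv \<gamma> \<circ> \<eta>) - (N \<eta> - N \<gamma>)\<bar>"
    using contr not_le by meson
  then obtain \<gamma> \<eta> where \<gamma>: "\<And>n :: nat. \<gamma> n \<in> \<Gamma>" and \<eta>: "\<And>n. \<eta> n \<in> \<Gamma>"
    and int: "\<And>n. shadow e (\<gamma> n) \<inter> shadow e (\<eta> n) \<noteq> {}" and le: "\<And>n. N (\<gamma> n) \<le> N (\<eta> n) + R"
    and big: "\<And>n. real n < \<bar>N (inv (\<gamma> n) \<circ> \<eta> n) - (N (\<eta> n) - N (\<gamma> n))\<bar>"
    by metis
  obtain k :: "nat \<Rightarrow> nat" and p where k: "strict_mono k" and p: "p \<in> X"
    and kp: "cvg (\<lambda>n. Inl (inv (\<gamma> (k n)))) p"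
    and alt: "(\<exists>\<theta>\<in>\<Gamma>. \<forall>n. inv (\<gamma> (k n)) \<circ> \<eta> (k n) = \<theta>) \<or>
     (\<exists>a b. conv_seq (\<lambda>n. inv (\<gamma> (k n)) \<circ> \<eta> (k n)) a b \<and> p \<noteq> Inr a)"
    by (rule shadow_sequences[of e \<gamma> \<eta> R "\<lambda>n. undefined", OF e \<gamma> \<eta> int le]) blast
  have "\<exists>C. \<forall>\<^sub>F n in sequentially. \<bar>N (\<gamma> (k n) \<circ> (inv (\<gamma> (k n)) \<circ> \<eta> (k n))) - N (\<gamma> (k n))
      - N (inv (\<gamma> (k n)) \<circ> \<eta> (k n))\<bar> \<le> C"
    using alt
  proof
    assume "\<exists>\<theta>\<in>\<Gamma>. \<forall>n. inv (\<gamma> (k n)) \<circ> \<eta> (k n) = \<theta>"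
    then obtain \<theta> where \<theta>: "\<theta> \<in> \<Gamma>" "\<And>n. inv (\<gamma> (k n)) \<circ> \<eta> (k n) = \<theta>" by blast
    obtain C where C: "\<And>\<gamma>. \<gamma> \<in> \<Gamma> \<Longrightarrow> \<bar>N (\<gamma> \<circ> \<theta>) - N \<gamma> - N \<theta>\<bar> \<le> C"
      using additive_fixed[OF \<theta>(1)] by blast
    show ?thesis unfolding \<theta>(2) by (rule exI[of _ C], rule always_eventually, rule allI, rule C[OF \<gamma>])
  next
    assume "\<exists>a b. conv_seq (\<lambda>n. inv (\<gamma> (k n)) \<circ> \<eta> (k n)) a b \<and> p \<noteq> Inr a"
    then obtain a b where c: "conv_seq (\<lambda>n. inv (\<gamma> (k n)) \<circ> \<eta> (k n)) a b" "p \<noteq> Inr a" by blast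
    obtain e' where e': "e' > 0"
      "\<forall>\<^sub>F n in sequentially. e' < d (Inl (inv (\<gamma> (k n)) \<circ> \<eta> (k n))) (Inl (inv (\<gamma> (k n))))"
      using cvg_ne[OF conv_seq_Inl[OF c(1)] kp] \<gamma> \<eta> p c(2) by auto
    obtain C where C: "\<And>\<gamma> \<theta>. \<gamma> \<in> \<Gamma> \<Longrightarrow> \<theta> \<in> \<Gamma> \<Longrightarrow> e' < d (Inl \<theta>) (Inl (inv \<gamma>)) \<Longrightarrow>
          \<bar>N (\<gamma> \<circ> \<theta>) - N \<gamma> - N \<theta>\<bar> \<le> C"
      using additive[OF e'(1)] by blast
    show ?thesis
      by (rule exI[of _ C], rule eventually_mono[OF e'(2)]) (rule C[OF \<gamma> comp_in[OF inv_in[OF \<gamma>] \<eta>]])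
  qed
  then obtain C where C: "\<forall>\<^sub>F n in sequentially. \<bar>N (\<gamma> (k n) \<circ> (inv (\<gamma> (k n)) \<circ> \<eta> (k n))) - N (\<gamma> (k n))
      - N (inv (\<gamma> (k n)) \<circ> \<eta> (k n))\<bar> \<le> C" by blast
  have "\<forall>\<^sub>F n in sequentially. real n > C"
    using filterlim_real_sequentially by (simp add: filterlim_at_top_dense)
  with C have "\<forall>\<^sub>F n in sequentially. False"
  proof eventually_elim
    case (elim n)
    have "real n \<le> real (k n)" using seq_suble[OF k, of n] by simp
    then show False using elim big[of "k n"] \<gamma> by simp
  qed
  then show False by simp
qed

text \<open>The engulfing property behind the Vitali covering. A point of the shadow of
  \<open>\<eta>\<close>, pulled back by \<open>\<gamma>\<close>, is the image under the quotient of
  a point \<open>y n\<close>, and it must not approach \<open>inv \<gamma>\<close>. The quotient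
  sends \<open>inv \<eta>\<close> to \<open>inv \<gamma>\<close>, and \<open>y n\<close> stays away
  from \<open>inv \<eta>\<close>. A constant quotient preserves this separation; a collapsing one
  sends \<open>y n\<close> to \<open>a\<close>, since otherwise \<open>inv \<gamma>\<close> would
  itself tend to \<open>a\<close>.\<close>

lemma shadow_inclusion:
  assumes e: "e > 0"
  shows "\<exists>e'>0. \<forall>\<gamma>\<in>\<Gamma>. \<forall>\<eta>\<in>\<Gamma>. shadow e \<gamma> \<inter> shadow e \<eta> \<noteq> {} \<longrightarrow> N \<gamma> \<le> N \<eta> + R \<longrightarrow>
     shadow e \<eta> \<subseteq> shadow e' \<gamma>"
proof (rule ccontr)
  assume contr: "\<not> ?thesis"
  have "\<forall>n :: nat. \<exists>\<gamma> \<eta> z. \<gamma> \<in> \<Gamma> \<and> \<eta> \<in> \<Gamma> \<and> shadow e \<gamma> \<inter> shadow e \<eta> \<noteq> {} \<and> N \<gamma> \<le> N \<eta> + R \<and>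
      z \<in> shadow e \<eta> \<and> z \<notin> shadow (inverse (real (Suc n))) \<gamma>"
  proof
    fix n
    have "inverse (real (Suc n)) > 0" by simp
    then show "\<exists>\<gamma> \<eta> z. \<gamma> \<in> \<Gamma> \<and> \<eta> \<in> \<Gamma> \<and> shadow e \<gamma> \<inter> shadow e \<eta> \<noteq> {} \<and> N \<gamma> \<le> N \<eta> + R \<and>
      z \<in> shadow e \<eta> \<and> z \<notin> shadow (inverse (real (Suc n))) \<gamma>" using contr by blast
  qed
  then obtain \<gamma> \<eta> z where \<gamma>: "\<And>n :: nat. \<gamma> n \<in> \<Gamma>" and \<eta>: "\<And>n. \<eta> n \<in> \<Gamma>"
    and int: "\<And>n. shadow e (\<gamma> n) \<inter> shadow e (\<eta> n) \<noteq> {}" and le: "\<And>n. N (\<gamma> n) \<le> N (\<eta> n) + R"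
    and z: "\<And>n. z n \<in> shadow e (\<eta> n)" "\<And>n. z n \<notin> shadow (inverse (real (Suc n))) (\<gamma> n)"
    by metis
  define y where "y n = inv (\<eta> n) (z n)" for n
  have yb: "y n \<in> big e (\<eta> n)" for n using z(1)[of n] \<eta> by (simp add: mem_shadow y_def)
  obtain k :: "nat \<Rightarrow> nat" and p q l where k: "strict_mono k" and p: "p \<in> X" and q: "q \<in> X"
    and kp: "cvg (\<lambda>n. Inl (inv (\<gamma> (k n)))) p" and kq: "cvg (\<lambda>n. Inl (inv (\<eta> (k n)))) q"
    and ky: "(\<lambda>n. y (k n)) \<longlonglongrightarrow> l"
    and alt: "(\<exists>\<theta>\<in>\<Gamma>. \<forall>n. inv (\<gamma> (k n)) \<circ> \<eta> (k n) = \<theta>) \<or>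
     (\<exists>a b. conv_seq (\<lambda>n. inv (\<gamma> (k n)) \<circ> \<eta> (k n)) a b \<and> p \<noteq> Inr a)"
    by (rule shadow_sequences[of e \<gamma> \<eta> R y, OF e \<gamma> \<eta> int le])
  have lq: "Inr l \<noteq> q" by (rule big_lim_ne[OF kq \<eta> q e ky yb])
  have zy: "inv (\<gamma> (k n)) (z (k n)) = (inv (\<gamma> (k n)) \<circ> \<eta> (k n)) (y (k n))" for n
    using \<eta> by (simp add: y_def)
  have \<gamma>\<eta>: "act (inv (\<gamma> (k n)) \<circ> \<eta> (k n)) (Inl (inv (\<eta> (k n)))) = Inl (inv (\<gamma> (k n)))" for n
    using \<eta> by (simp add: fun_eq_iff)
  have "\<exists>m. cvg (\<lambda>n. Inr (inv (\<gamma> (k n)) (z (k n)))) m \<and> m \<in> X \<and> m \<noteq> p"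
    using alt
  proof
    assume "\<exists>\<theta>\<in>\<Gamma>. \<forall>n. inv (\<gamma> (k n)) \<circ> \<eta> (k n) = \<theta>"
    then obtain \<theta> where \<theta>: "\<theta> \<in> \<Gamma>" "\<And>n. inv (\<gamma> (k n)) \<circ> \<eta> (k n) = \<theta>" by blast
    have "cvg (\<lambda>n. act \<theta> (Inr (y (k n)))) (act \<theta> (Inr l))"
      by (rule cvg_act[OF \<theta>(1)]) (use ky in \<open>auto simp: cvg_Inr\<close>)
    then have 1: "cvg (\<lambda>n. Inr (inv (\<gamma> (k n)) (z (k n)))) (act \<theta> (Inr l))"
      unfolding zy \<theta>(2) by simp
    have "cvg (\<lambda>n. act \<theta> (Inl (inv (\<eta> (k n))))) (act \<theta> q)"
      by (rule cvg_act[OF \<theta>(1) kq _ q]) (use \<eta> in auto)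
    then have "cvg (\<lambda>n. Inl (inv (\<gamma> (k n)))) (act \<theta> q)" using \<gamma>\<eta> unfolding \<theta>(2) by simp
    then have "act \<theta> q = p" by (rule cvg_unique[OF _ kp _ _ p]) (use \<gamma> q \<theta> in auto)
    moreover have "act \<theta> (Inr l) \<noteq> act \<theta> q" using lq act_inv(2)[OF \<theta>(1)] by metis
    ultimately show ?thesis using 1 \<theta>(1) by auto
  next
    assume "\<exists>a b. conv_seq (\<lambda>n. inv (\<gamma> (k n)) \<circ> \<eta> (k n)) a b \<and> p \<noteq> Inr a"
    then obtain a b where c: "conv_seq (\<lambda>n. inv (\<gamma> (k n)) \<circ> \<eta> (k n)) a b" "p \<noteq> Inr a" by blast
    have "l \<noteq> b"
    proof
      assume "l = b"
      then have "cvg (\<lambda>n. act (inv (\<gamma> (k n)) \<circ> \<eta> (k n)) (Inl (inv (\<eta> (k n))))) (Inr a)"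
        by (intro conv_seqD[OF c(1) _ q _ kq]) (use \<eta> lq in auto)
      then have "cvg (\<lambda>n. Inl (inv (\<gamma> (k n)))) (Inr a)" unfolding \<gamma>\<eta> .
      then have "Inr a = p" by (rule cvg_unique[OF _ kp _ _ p]) (use \<gamma> in auto)
      then show False using c(2) by simp
    qed
    from conv_seqM[OF c(1) ky this] show ?thesis
      unfolding zy using c(2) by (intro exI[of _ "Inr a"]) (auto simp: cvg_Inr)
  qed
  then obtain m where m: "cvg (\<lambda>n. Inr (inv (\<gamma> (k n)) (z (k n)))) m" "m \<in> X" "m \<noteq> p" by blast
  obtain e' where e': "e' > 0"
    "\<forall>\<^sub>F n in sequentially. e' < d (Inr (inv (\<gamma> (k n)) (z (k n)))) (Inl (inv (\<gamma> (k n))))"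
    using cvg_ne[OF m(1) kp _ _ m(2) p m(3)] \<gamma> by auto
  have "(\<lambda>n. inverse (real (Suc (k n)))) \<longlonglongrightarrow> 0"
    using LIMSEQ_subseq_LIMSEQ[OF LIMSEQ_inverse_real_of_nat k] by (simp add: o_def)
  then have "\<forall>\<^sub>F n in sequentially. inverse (real (Suc (k n))) < e'"
    by (rule order_tendstoD(2)) (rule e'(1))
  with e'(2) have "\<forall>\<^sub>F n in sequentially. False"
  proof eventually_elim
    case (elim n)
    then have "inv (\<gamma> (k n)) (z (k n)) \<in> big (inverse (real (Suc (k n)))) (\<gamma> (k n))"
      by (simp add: big_def)
    then show False using z(2)[of "k n"] \<gamma> by (simp add: mem_shadow)
  qed
  then show False by simp
qed

end

section \<open>Second moments and regularity of measures\<close>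

lemma (in finite_measure) integral_sum_indicator:
  assumes "finite I" "\<And>i. i \<in> I \<Longrightarrow> A i \<in> sets M"
  shows "integrable M (\<lambda>x. \<Sum>i\<in>I. indicator (A i) x :: real)"
    and "(\<integral>x. (\<Sum>i\<in>I. indicator (A i) x :: real) \<partial>M) = (\<Sum>i\<in>I. measure M (A i))"
proof -
  have int: "integrable M (indicator (A i) :: _ \<Rightarrow> real)" if "i \<in> I" for i
    using assms(2)[OF that] by (simp add: less_top[symmetric])
  then show "integrable M (\<lambda>x. \<Sum>i\<in>I. indicator (A i) x :: real)" by (intro Bochner_Integration.integrable_sum)
  have "(\<integral>x. (\<Sum>i\<in>I. indicator (A i) x :: real) \<partial>M) = (\<Sum>i\<in>I. \<integral>x. indicator (A i) x \<partial>M)"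
    using int by (intro Bochner_Integration.integral_sum)
  also have "\<dots> = (\<Sum>i\<in>I. measure M (A i))"
    using assms(2) by (intro sum.cong) (auto simp: sets.Int_space_eq2)
  finally show "(\<integral>x. (\<Sum>i\<in>I. indicator (A i) x :: real) \<partial>M) = (\<Sum>i\<in>I. measure M (A i))" .
qed

lemma sum_indicator_card_Collect:
  assumes "finite I"
  shows "(\<Sum>i\<in>I. indicator (A i) x :: real) = real (card {i\<in>I. x \<in> A i})"
  using assms by (simp add: indicator_def sum.If_cases Int_def)

lemma (in finite_measure) sum_measure_le_multiplicity:
  assumes "finite I" "\<And>i. i \<in> I \<Longrightarrow> A i \<in> sets M" "\<And>x. card {i\<in>I. x \<in> A i} \<le> k"
  shows "(\<Sum>i\<in>I. measure M (A i)) \<le> real k * measure M (space M)"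
proof -
  have "(\<integral>x. (\<Sum>i\<in>I. indicator (A i) x :: real) \<partial>M) \<le> (\<integral>x. real k \<partial>M)"
    using assms(3) by (intro integral_mono integral_sum_indicator(1)[OF assms(1,2)])
      (auto simp: sum_indicator_card_Collect[OF assms(1)])
  then show ?thesis using integral_sum_indicator(2)[OF assms(1,2)] by (simp add: mult.commute)
qed

text \<open>A Paley-Zygmund argument for the counting function \<open>Z\<close>, whose integral is
  \<open>S\<close>: the second moment bound keeps \<open>Z\<close> from living on a set of small
  measure. A pointwise quadratic inequality takes the place of Cauchy-Schwarz.\<close>

lemma (in finite_measure) second_moment_bound:
  assumes I: "finite I" "\<And>i. i \<in> I \<Longrightarrow> A i \<in> sets M" and K: "K > 0" and h: "h \<ge> 0"
    and S: "S = (\<Sum>i\<in>I. measure M (A i))" "S > 0" "h * measure M (space M) \<le> S / 2"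
    and Q: "(\<Sum>i\<in>I. \<Sum>j\<in>I. measure M (A i \<inter> A j)) \<le> K * S\<^sup>2"
  shows "1 / (4 * K) \<le> measure M {x \<in> space M. h \<le> real (card {i\<in>I. x \<in> A i})}"
proof -
  define Z where "Z x = (\<Sum>i\<in>I. indicator (A i) x :: real)" for x
  define W where "W = {x \<in> space M. h \<le> Z x}"
  \<comment> \<open>Chosen so that the quadratic term contributes at most \<open>S / 4\<close>. With
    at most \<open>S / 2\<close> from \<open>h\<close>, a quarter of \<open>S\<close> remains to be
    accounted for by \<open>W\<close>.\<close>
  define t where "t = 1 / (2 * K * S)"
  have t: "t > 0" using K S by (simp add: t_def)
  note int = integral_sum_indicator[where A = A, OF I, simplified, folded Z_def]
  have Zm: "Z \<in> borel_measurable M" using int(1) by simp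
  then have Ws: "W \<in> sets M" by (simp add: W_def)
  have Zsq: "(Z x)\<^sup>2 = (\<Sum>p\<in>I \<times> I. indicator (A (fst p) \<inter> A (snd p)) x)" for x
    by (simp add: Z_def power2_eq_square sum_product sum.cartesian_product indicator_inter_arith case_prod_beta)
  have As: "A (fst p) \<inter> A (snd p) \<in> sets M" if "p \<in> I \<times> I" for p using that I by auto
  have fI: "finite (I \<times> I)" using I by simp
  have i2: "integrable M (\<lambda>x. (Z x)\<^sup>2)" and
    e2: "(\<integral>x. (Z x)\<^sup>2 \<partial>M) = (\<Sum>i\<in>I. \<Sum>j\<in>I. measure M (A i \<inter> A j))"
    using integral_sum_indicator[where A = "\<lambda>p. A (fst p) \<inter> A (snd p)", OF fI As]
    unfolding Zsq by (simp_all add: sum.cartesian_product case_prod_beta)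
  have iW: "integrable M (indicator W :: _ \<Rightarrow> real)" using Ws by (simp add: less_top[symmetric])
  have pt: "Z x \<le> h + (t / 2 * (Z x)\<^sup>2 + 1 / (2 * t) * indicator W x)" if "x \<in> space M" for x
  proof (cases "x \<in> W")
    case True
    have "0 \<le> (t * Z x - 1)\<^sup>2 / (2 * t)" using t by simp
    also have "\<dots> = t / 2 * (Z x)\<^sup>2 + 1 / (2 * t) - Z x"
      using t by (simp add: power2_eq_square field_simps)
    finally show ?thesis using True h by simp
  next
    case False
    then have "Z x < h" using that by (simp add: W_def)
    moreover have "0 \<le> t / 2 * (Z x)\<^sup>2" using t by simp
    ultimately show ?thesis using False by simp
  qed
  have "S = (\<integral>x. Z x \<partial>M)" using int(2) S by simp
  also have "\<dots> \<le> (\<integral>x. h + (t / 2 * (Z x)\<^sup>2 + 1 / (2 * t) * indicator W x) \<partial>M)"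
    by (rule integral_mono[OF int(1)]) (use i2 iW pt in auto)
  also have "\<dots> = h * measure M (space M) + (t / 2 * (\<integral>x. (Z x)\<^sup>2 \<partial>M) + 1 / (2 * t) * measure M W)"
    using i2 iW Ws by (simp add: sets.Int_space_eq2 mult.commute)
  also have "\<dots> \<le> S / 2 + (t / 2 * (K * S\<^sup>2) + 1 / (2 * t) * measure M W)"
    using S(3) Q t e2 by (intro add_mono mult_left_mono) auto
  also have "\<dots> = S / 2 + S / 4 + K * S * measure M W"
    using S K by (simp add: t_def power2_eq_square field_simps)
  finally have "S * (1 / 4) \<le> S * (K * measure M W)" by (simp add: algebra_simps)
  then have "1 / 4 \<le> K * measure M W" using S(2) by simp
  then show ?thesis
    using K by (simp add: W_def Z_def sum_indicator_card_Collect[OF I(1)] field_simps)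
qed

text \<open>Unions over finite subfamilies keep the set open when the \<open>A i\<close> are open,
  whatever the index set. For growing \<open>m\<close> these sets decrease to the points that lie in
  infinitely many \<open>A i\<close>.\<close>

definition at_least :: "nat \<Rightarrow> 'i set \<Rightarrow> ('i \<Rightarrow> 'a set) \<Rightarrow> 'a set" where
  "at_least m I A = (\<Union>F\<in>{F. F \<subseteq> I \<and> finite F \<and> card F = m}. \<Inter>i\<in>F. A i)"

lemma open_at_least: "(\<And>i. i \<in> I \<Longrightarrow> open (A i)) \<Longrightarrow> open (at_least m I A)"
  unfolding at_least_def by (intro open_UN ballI open_INT) auto

lemma infinite_eq_at_least: "{x. infinite {i\<in>I. x \<in> A i}} = (\<Inter>m. at_least m I A)"
proof (intro equalityI subsetI INT_I)
  fix x m assume "x \<in> {x. infinite {i\<in>I. x \<in> A i}}"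
  then obtain F where "finite F" "card F = m" "F \<subseteq> {i\<in>I. x \<in> A i}"
    using infinite_arbitrarily_large by blast
  then show "x \<in> at_least m I A" unfolding at_least_def by auto
next
  fix x assume x: "x \<in> (\<Inter>m. at_least m I A)"
  have "infinite {i\<in>I. x \<in> A i}"
  proof
    assume fin: "finite {i\<in>I. x \<in> A i}"
    have "x \<in> at_least (Suc (card {i\<in>I. x \<in> A i})) I A" using x by (rule INT_D) simp
    then obtain F where "F \<subseteq> I" "card F = Suc (card {i\<in>I. x \<in> A i})" "\<forall>i\<in>F. x \<in> A i"
      by (auto simp: at_least_def)
    then show False using card_mono[OF fin, of F] by auto
  qed
  then show "x \<in> {x. infinite {i\<in>I. x \<in> A i}}" by simp
qed

lemma at_least_Suc_subset: "at_least (Suc m) I A \<subseteq> at_least m I A"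
proof
  fix x assume "x \<in> at_least (Suc m) I A"
  then obtain F where F: "F \<subseteq> I" "finite F" "card F = Suc m" "\<forall>i\<in>F. x \<in> A i"
    unfolding at_least_def by auto
  then obtain i where "i \<in> F" by (metis card_eq_0_iff ex_in_conv nat.distinct(1))
  then have "F - {i} \<subseteq> I" "finite (F - {i})" "card (F - {i}) = m" "\<forall>i\<in>F - {i}. x \<in> A i"
    using F by auto
  then show "x \<in> at_least m I A" unfolding at_least_def by blast
qed

lemma borel_infinitely_many:
  "(\<And>i. i \<in> I \<Longrightarrow> open (A i)) \<Longrightarrow> {x. infinite {i\<in>I. x \<in> A i}} \<in> sets borel"
  unfolding infinite_eq_at_least by (intro sets.countable_INT) (auto intro!: borel_open open_at_least)

lemma measure_infinitely_many:
  assumes "finite_measure \<mu>" "sets \<mu> = sets borel" "\<And>i. i \<in> I \<Longrightarrow> open (A i)"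
    and c: "\<And>m. c \<le> measure \<mu> (at_least m I A)"
  shows "c \<le> measure \<mu> {x. infinite {i\<in>I. x \<in> A i}}"
proof -
  interpret finite_measure \<mu> by fact
  have "range (\<lambda>m. at_least m I A) \<subseteq> sets \<mu>"
    using assms(2,3) open_at_least[of I A] by auto
  moreover have "decseq (\<lambda>m. at_least m I A)"
    using at_least_Suc_subset by (intro decseq_SucI)
  ultimately have "(\<lambda>m. measure \<mu> (at_least m I A)) \<longlonglongrightarrow> measure \<mu> (\<Inter>m. at_least m I A)"
    by (rule finite_Lim_measure_decseq)
  then show ?thesis using c unfolding infinite_eq_at_least by (meson LIMSEQ_le_const)
qed

lemma finite_borel_measure_regular:
  fixes \<mu> :: "'a::metric_space measure"
  assumes fm: "finite_measure \<mu>" and sets: "sets \<mu> = sets borel" and A: "A \<in> sets borel" and e: "e > 0"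
  shows "\<exists>F U. closed F \<and> open U \<and> F \<subseteq> A \<and> A \<subseteq> U \<and> measure \<mu> (U - F) < e"
proof -
  interpret finite_measure \<mu> by fact
  have "A \<in> sigma_sets UNIV {S :: 'a set. open S}" using A by (simp add: borel_def)
  then show ?thesis using e
  proof (induction arbitrary: e rule: sigma_sets.induct)
    case (Basic U)
    show ?case
    \<comment> \<open>\<open>infdist\<close> to the empty set is \<open>0\<close>, so the sets
      \<open>?F n\<close> would not exhaust the whole space.\<close>
    proof (cases "U = UNIV")
      case True
      then show ?thesis using Basic by (intro exI[of _ U] exI[of _ U]) auto
    next
      case False
      then have ne: "- U \<noteq> {}" by auto
      let ?F = "\<lambda>n. {x. inverse (real (Suc n)) \<le> infdist x (- U)}"
      have cl: "closed (?F n)" for n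
        by (intro closed_Collect_le continuous_intros) 
      have Un: "(\<Union>n. ?F n) = U"
      proof (intro equalityI subsetI)
        fix x assume "x \<in> (\<Union>n. ?F n)"
        then obtain n where "inverse (real (Suc n)) \<le> infdist x (- U)" by blast
        moreover have "inverse (real (Suc n)) > 0" by simp
        ultimately have "infdist x (- U) \<noteq> 0" by linarith
        then show "x \<in> U" by (metis ComplI infdist_zero)
      next
        fix x assume "x \<in> U"
        then have "infdist x (- U) \<noteq> 0"
          using in_closed_iff_infdist_zero[OF _ ne, of x] Basic by auto
        then have "infdist x (- U) > 0" using infdist_nonneg[of x "- U"] by linarith
        then obtain n where "inverse (real (Suc n)) < infdist x (- U)" using reals_Archimedean by blast
        then show "x \<in> (\<Union>n. ?F n)" by (auto intro: less_imp_le)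
      qed
      have "incseq ?F"
      proof (rule incseq_SucI, rule subsetI)
        fix n x assume x: "x \<in> ?F n"
        have "inverse (real (Suc (Suc n))) \<le> inverse (real (Suc n))"
          by (intro le_imp_inverse_le) auto
        also have "\<dots> \<le> infdist x (- U)" using x by blast
        finally show "x \<in> ?F (Suc n)" by blast
      qed
      then have "(\<lambda>n. measure \<mu> (?F n)) \<longlonglongrightarrow> measure \<mu> (\<Union>n. ?F n)"
        using cl sets by (intro finite_Lim_measure_incseq) auto
      then have "(\<lambda>n. measure \<mu> (?F n)) \<longlonglongrightarrow> measure \<mu> U" unfolding Un .
      then have "\<forall>\<^sub>F n in sequentially. measure \<mu> U - e < measure \<mu> (?F n)"
        by (rule order_tendstoD(1)) (use Basic in simp)
      then obtain n where n: "measure \<mu> U - e < measure \<mu> (?F n)"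
        by (auto simp: eventually_sequentially)
      have sub: "?F n \<subseteq> U" using Un by blast
      have "measure \<mu> (U - ?F n) = measure \<mu> U - measure \<mu> (?F n)"
        by (rule finite_measure_Diff[OF _ _ sub]) (use Basic cl sets in auto)
      then show ?thesis using n sub cl Basic by (intro exI[of _ "?F n"] exI[of _ U]) auto
    qed
  next
    case Empty
    then show ?case by (intro exI[of _ "{}"]) auto
  next
    case (Compl a)
    from Compl.IH[OF Compl.prems] obtain F U where
      FU: "closed F" "open U" "F \<subseteq> a" "a \<subseteq> U" "measure \<mu> (U - F) < e" by blast
    have "- F - (- U) = U - F" by auto
    then show ?case using FU by (intro exI[of _ "- U"] exI[of _ "- F"]) auto
  next
    case (Union a)
    \<comment> \<open>Half of \<open>e\<close> is shared among the pieces by a geometric series; the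
      rest is the slack for replacing the union of the closed sets, which need not be closed, by a
      finite subunion.\<close>
    have "\<forall>i. \<exists>F U. closed F \<and> open U \<and> F \<subseteq> a i \<and> a i \<subseteq> U \<and> measure \<mu> (U - F) < e / 2 * (1/2) ^ Suc i"
    proof
      fix i
      have "0 < e / 2 * (1/2) ^ Suc i" using Union.prems by simp
      then show "\<exists>F U. closed F \<and> open U \<and> F \<subseteq> a i \<and> a i \<subseteq> U \<and> measure \<mu> (U - F) < e / 2 * (1/2) ^ Suc i"
        by (rule Union.IH)
    qed
    then obtain F U where FU: "\<And>i. closed (F i)" "\<And>i. open (U i)" "\<And>i. F i \<subseteq> a i" "\<And>i. a i \<subseteq> U i"
      "\<And>i. measure \<mu> (U i - F i) < e / 2 * (1/2) ^ Suc i" by metis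
    have ms: "U i - F i \<in> sets \<mu>" for i using FU sets by auto
    have geo: "(\<lambda>i. e / 2 * (1/2) ^ Suc i) sums (e / 2 * 1)"
      by (rule sums_mult[OF power_half_series])
    have summ: "summable (\<lambda>i. measure \<mu> (U i - F i))"
      by (rule summable_comparison_test'[OF sums_summable[OF geo], of 0]) (use FU(5) less_imp_le in auto)
    have "measure \<mu> (\<Union>i. U i - F i) \<le> (\<Sum>i. measure \<mu> (U i - F i))"
      by (rule finite_measure_subadditive_countably) (use ms summ in auto)
    also have "\<dots> \<le> (\<Sum>i. e / 2 * (1/2) ^ Suc i)"
      by (rule suminf_le[OF _ summ sums_summable[OF geo]]) (use FU(5) less_imp_le in auto)
    also have "\<dots> = e / 2" using sums_unique[OF geo] by simp
    finally have half: "measure \<mu> (\<Union>i. U i - F i) \<le> e / 2" .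
    let ?D = "\<lambda>n. (\<Union>i. U i) - (\<Union>i<n. F i)"
    have clD: "closed (\<Union>i<n. F i)" for n using FU(1) by (intro closed_UN) auto
    have "?D n \<in> sets borel" for n
      by (rule sets.Diff[OF borel_open[OF open_UN] borel_closed[OF clD]]) (use FU(2) in blast)
    then have D: "range ?D \<subseteq> sets \<mu>" using sets by blast
    have "decseq ?D" by (auto simp: decseq_def)
    from finite_Lim_measure_decseq[OF D this]
    have "(\<lambda>n. measure \<mu> (?D n)) \<longlonglongrightarrow> measure \<mu> (\<Inter>n. ?D n)" .
    moreover have "measure \<mu> (\<Inter>n. ?D n) \<le> measure \<mu> (\<Union>i. U i - F i)"
      by (rule finite_measure_mono) (use ms in auto)
    then have "measure \<mu> (\<Inter>n. ?D n) < e" using half Union.prems by linarith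
    ultimately have "\<forall>\<^sub>F n in sequentially. measure \<mu> (?D n) < e" by (rule order_tendstoD(2))
    then obtain n where "measure \<mu> (?D n) < e" by (auto simp: eventually_sequentially)
    moreover have "(\<Union>i<n. F i) \<subseteq> (\<Union>i. a i)" "(\<Union>i. a i) \<subseteq> (\<Union>i. U i)" using FU(3,4) by blast+
    ultimately show ?case using clD FU(2) by (intro exI[of _ "\<Union>i<n. F i"] exI[of _ "\<Union>i. U i"]) auto
  qed
qed

section \<open>Conical points and density along shadows\<close>

context compactified_group
begin

lemma quasi_conformal_bounds:
  assumes qc: "quasi_conformal \<mu> N" and e: "e > 0"
  obtains C where "C > 0"
    and "\<And>\<gamma> E. \<gamma> \<in> \<Gamma> \<Longrightarrow> E \<in> sets borel \<Longrightarrow> E \<subseteq> big e \<gamma> \<Longrightarrow>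
        measure \<mu> (\<gamma> ` E) \<le> C * exp (- N \<gamma>) * measure \<mu> E"
    and "\<And>\<gamma> E. \<gamma> \<in> \<Gamma> \<Longrightarrow> E \<in> sets borel \<Longrightarrow> E \<subseteq> big e \<gamma> \<Longrightarrow>
        exp (- N \<gamma>) * measure \<mu> E \<le> C * measure \<mu> (\<gamma> ` E)"
proof -
  have "\<exists>C>0. \<forall>\<gamma>\<in>\<Gamma>. \<forall>E\<in>sets borel. E \<subseteq> big e \<gamma> \<longrightarrow>
        measure \<mu> (\<gamma> ` E) \<le> C * exp (- N \<gamma>) * measure \<mu> E \<and>
        exp (- N \<gamma>) * measure \<mu> E \<le> C * measure \<mu> (\<gamma> ` E)"
    using qc e unfolding quasi_conformal_def by simp
  then obtain C where C: "C > 0" "\<forall>\<gamma>\<in>\<Gamma>. \<forall>E\<in>sets borel. E \<subseteq> big e \<gamma> \<longrightarrow>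
        measure \<mu> (\<gamma> ` E) \<le> C * exp (- N \<gamma>) * measure \<mu> E \<and>
        exp (- N \<gamma>) * measure \<mu> E \<le> C * measure \<mu> (\<gamma> ` E)" by (elim exE conjE)
  show thesis
    by (rule that[OF C(1)]) (use C(2) in simp_all)
qed

definition conical :: "real \<Rightarrow> 'm set" where
  "conical e = {x. infinite {\<gamma>\<in>\<Gamma>. x \<in> shadow e \<gamma>}}"

lemma conical_borel: "conical e \<in> sets borel"
  unfolding conical_def by (rule borel_infinitely_many[OF open_shadow])

end

section \<open>Positive mass of the conical set, covering and density along shadows\<close>

context additive_magnitude
begin

definition sublevel :: "real \<Rightarrow> ('m \<Rightarrow> 'm) set" where
  "sublevel T = {\<gamma>\<in>\<Gamma>. N \<gamma> \<le> T}"

lemma finite_sublevel [simp]: "finite (sublevel T)"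
  using proper by (simp add: sublevel_def)

lemma N_bounded_below: "\<exists>m0\<le>0. \<forall>\<gamma>\<in>\<Gamma>. m0 \<le> N \<gamma>"
proof -
  have fin: "finite (insert 0 (N ` sublevel 0))" by simp
  show ?thesis
  proof (intro exI[of _ "Min (insert 0 (N ` sublevel 0))"] conjI ballI)
    show "Min (insert 0 (N ` sublevel 0)) \<le> 0" by (rule Min_le[OF fin]) simp
    fix \<gamma> assume \<gamma>: "\<gamma> \<in> \<Gamma>"
    show "Min (insert 0 (N ` sublevel 0)) \<le> N \<gamma>"
    proof (cases "N \<gamma> \<le> 0")
      case True
      then show ?thesis using \<gamma> by (intro Min_le[OF fin]) (auto simp: sublevel_def)
    next
      case False
      then show ?thesis using \<open>Min (insert 0 (N ` sublevel 0)) \<le> 0\<close> by linarith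
    qed
  qed
qed

lemma inj_on_left_mult: "\<gamma> \<in> \<Gamma> \<Longrightarrow> inj_on ((\<circ>) \<gamma>) A"
proof (rule inj_onI)
  fix x y assume "\<gamma> \<in> \<Gamma>" "\<gamma> \<circ> x = \<gamma> \<circ> y"
  then have "inv \<gamma> \<circ> (\<gamma> \<circ> x) = inv \<gamma> \<circ> (\<gamma> \<circ> y)" by simp
  then show "x = y" using \<open>\<gamma> \<in> \<Gamma>\<close> by simp
qed

text \<open>The shadows of elements with \<open>N \<gamma> \<le> T\<close> have total mass
  comparable to the partial Poincare sum \<open>S T\<close>. If the shadows of
  \<open>\<gamma>\<close> and \<open>\<eta>\<close> meet and
  \<open>N \<gamma> \<le> N \<eta>\<close>, then \<open>\<eta>\<close> is \<open>\<gamma>\<close>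
  times a quotient with magnitudes adding up, so the intersection has mass at most a constant times
  the product of the two exponentials. Thus the second moment is bounded by a multiple of
  \<open>S T * S (T + R2)\<close>. Divergence makes \<open>S T\<close> large enough to absorb the
  excess of \<open>S (T + R2)\<close> and to force any prescribed number of overlaps.\<close>

lemma conical_pos:
  assumes qc: "quasi_conformal \<mu> N" and pos: "measure \<mu> UNIV > 0"
    and div: "\<And>B. \<exists>F\<subseteq>\<Gamma>. finite F \<and> B \<le> (\<Sum>\<gamma>\<in>F. exp (- N \<gamma>))"
  shows "\<exists>e>0. 0 < measure \<mu> (conical e)"
proof -
  interpret finite_measure \<mu> using qc by (simp add: quasi_conformal_def)
  have sets: "sets \<mu> = sets borel" using qc by (simp add: quasi_conformal_def)
  have space: "space \<mu> = UNIV" using sets_eq_imp_space_eq[OF sets] by simp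
  define m where "m = measure \<mu> UNIV"
  have m: "m > 0" using pos by (simp add: m_def)
  obtain e c where e: "e > 0" and c: "c > 0" "\<And>\<gamma>. \<gamma> \<in> \<Gamma> \<Longrightarrow> c \<le> measure \<mu> (big e \<gamma>)"
    using big_measure_lower_bound[OF qc pos] by blast
  obtain C where C: "C > 0"
    "\<And>\<gamma> E. \<gamma> \<in> \<Gamma> \<Longrightarrow> E \<in> sets borel \<Longrightarrow> E \<subseteq> big e \<gamma> \<Longrightarrow>
        measure \<mu> (\<gamma> ` E) \<le> C * exp (- N \<gamma>) * measure \<mu> E"
    "\<And>\<gamma> E. \<gamma> \<in> \<Gamma> \<Longrightarrow> E \<in> sets borel \<Longrightarrow> E \<subseteq> big e \<gamma> \<Longrightarrow>
        exp (- N \<gamma>) * measure \<mu> E \<le> C * measure \<mu> (\<gamma> ` E)"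
    using quasi_conformal_bounds[OF qc e] by metis
  let ?O = "\<lambda>\<gamma>. measure \<mu> (shadow e \<gamma>)"
  have sh [simp]: "shadow e \<gamma> \<in> sets \<mu>" if "\<gamma> \<in> \<Gamma>" for \<gamma> using open_shadow[OF that] sets by simp
  have up: "?O \<gamma> \<le> C * m * exp (- N \<gamma>)" and lo: "c * exp (- N \<gamma>) \<le> C * ?O \<gamma>" if \<gamma>: "\<gamma> \<in> \<Gamma>" for \<gamma>
  proof -
    have b: "big e \<gamma> \<in> sets borel" using open_big[OF \<gamma>] by simp
    have "?O \<gamma> \<le> C * exp (- N \<gamma>) * measure \<mu> (big e \<gamma>)"
      using C(2)[OF \<gamma> b] by (simp add: shadow_def)
    also have "measure \<mu> (big e \<gamma>) \<le> m"
      unfolding m_def by (rule finite_measure_mono) (auto simp: sets)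
    then have "C * exp (- N \<gamma>) * measure \<mu> (big e \<gamma>) \<le> C * exp (- N \<gamma>) * m"
      using C(1) by (intro mult_left_mono) auto
    finally show "?O \<gamma> \<le> C * m * exp (- N \<gamma>)" by (simp add: mult_ac)
    have "exp (- N \<gamma>) * c \<le> exp (- N \<gamma>) * measure \<mu> (big e \<gamma>)"
      using c(2)[OF \<gamma>] by (intro mult_left_mono) auto
    also have "\<dots> \<le> C * ?O \<gamma>" using C(3)[OF \<gamma> b] by (simp add: shadow_def)
    finally show "c * exp (- N \<gamma>) \<le> C * ?O \<gamma>" by (simp add: mult.commute)
  qed
  define S where "S T = (\<Sum>\<gamma>\<in>sublevel T. exp (- N \<gamma>))" for T
  define s where "s T = (\<Sum>\<gamma>\<in>sublevel T. ?O \<gamma>)" for T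
  have Ss: "c * S T \<le> C * s T" for T
    unfolding S_def s_def sum_distrib_left by (intro sum_mono lo) (simp add: sublevel_def)
  obtain m0 where m0: "m0 \<le> 0" "\<And>\<gamma>. \<gamma> \<in> \<Gamma> \<Longrightarrow> m0 \<le> N \<gamma>" using N_bounded_below by blast
  obtain R1 where R1: "\<And>\<gamma> \<eta>. \<gamma> \<in> \<Gamma> \<Longrightarrow> \<eta> \<in> \<Gamma> \<Longrightarrow> shadow e \<gamma> \<inter> shadow e \<eta> \<noteq> {} \<Longrightarrow> N \<gamma> \<le> N \<eta> + 0 \<Longrightarrow>
     \<bar>N (inv \<gamma> \<circ> \<eta>) - (N \<eta> - N \<gamma>)\<bar> \<le> R1"
    using shadow_magnitude[OF e, of 0] by blast
  \<comment> \<open>The quotients in the second moment have magnitude at most \<open>T + R2\<close>: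
    \<open>R1\<close> is the additivity error, and \<open>- m0\<close> comes from the lower bound on
    \<open>N\<close>.\<close>
  define R2 where "R2 = \<bar>R1\<bar> - m0"
  have R2: "R2 \<ge> 0" using m0 by (simp add: R2_def)
  obtain R3 where R3: "\<And>\<gamma> \<eta>. \<gamma> \<in> \<Gamma> \<Longrightarrow> \<eta> \<in> \<Gamma> \<Longrightarrow> shadow e \<gamma> \<inter> shadow e \<eta> \<noteq> {} \<Longrightarrow> N \<gamma> \<le> N \<eta> + R2 \<Longrightarrow>
     \<bar>N (inv \<gamma> \<circ> \<eta>) - (N \<eta> - N \<gamma>)\<bar> \<le> R3"
    using shadow_magnitude[OF e, of R2] by blast
  define k where "k = card (sublevel (R2 + R3))"
  \<comment> \<open>Within a band of width \<open>R2\<close> the shadows overlap with multiplicity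
    at most \<open>k\<close>, since quotients of elements whose shadows share a point have magnitude
    at most \<open>R2 + R3\<close>. So passing from \<open>T\<close> to \<open>T + R2\<close> adds a
    bounded amount to the Poincare sum.\<close>
  have annulus: "c * (\<Sum>\<gamma>\<in>sublevel (T + R2) - sublevel T. exp (- N \<gamma>)) \<le> C * (real k * m)" for T
  proof -
    let ?D = "sublevel (T + R2) - sublevel T"
    have D: "\<gamma> \<in> \<Gamma>" "T < N \<gamma>" "N \<gamma> \<le> T + R2" if "\<gamma> \<in> ?D" for \<gamma> using that by (auto simp: sublevel_def)
    have "card {\<gamma>\<in>?D. x \<in> shadow e \<gamma>} \<le> k" for x
    proof (cases "{\<gamma>\<in>?D. x \<in> shadow e \<gamma>} = {}")
      case False
      then obtain \<gamma>0 where \<gamma>0: "\<gamma>0 \<in> ?D" "x \<in> shadow e \<gamma>0" by blast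
      have "(\<circ>) (inv \<gamma>0) ` {\<gamma>\<in>?D. x \<in> shadow e \<gamma>} \<subseteq> sublevel (R2 + R3)"
      proof clarify
        fix \<eta> assume \<eta>: "\<eta> \<in> sublevel (T + R2)" "\<eta> \<notin> sublevel T" "x \<in> shadow e \<eta>"
        then have \<eta>D: "\<eta> \<in> ?D" by simp
        have "shadow e \<gamma>0 \<inter> shadow e \<eta> \<noteq> {}" using \<eta> \<gamma>0 by blast
        moreover have "N \<gamma>0 \<le> N \<eta> + R2" using D[OF \<gamma>0(1)] D[OF \<eta>D] by linarith
        ultimately have "\<bar>N (inv \<gamma>0 \<circ> \<eta>) - (N \<eta> - N \<gamma>0)\<bar> \<le> R3"
          using R3 D(1)[OF \<gamma>0(1)] D(1)[OF \<eta>D] by blast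
        then have "N (inv \<gamma>0 \<circ> \<eta>) \<le> R2 + R3" using D[OF \<gamma>0(1)] D[OF \<eta>D] by linarith
        then show "inv \<gamma>0 \<circ> \<eta> \<in> sublevel (R2 + R3)"
          using D(1)[OF \<gamma>0(1)] D(1)[OF \<eta>D] by (simp add: sublevel_def)
      qed
      from card_inj_on_le[OF inj_on_left_mult[OF inv_in[OF D(1)[OF \<gamma>0(1)]]] this]
      show ?thesis by (simp add: k_def)
    qed (simp only: card.empty)
    then have "(\<Sum>\<gamma>\<in>?D. ?O \<gamma>) \<le> real k * measure \<mu> (space \<mu>)"
      by (intro sum_measure_le_multiplicity sh D(1)) auto
    then have "(\<Sum>\<gamma>\<in>?D. ?O \<gamma>) \<le> real k * m" by (simp add: space m_def)
    moreover have "c * (\<Sum>\<gamma>\<in>?D. exp (- N \<gamma>)) \<le> C * (\<Sum>\<gamma>\<in>?D. ?O \<gamma>)"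
      unfolding sum_distrib_left by (intro sum_mono lo D(1))
    ultimately show ?thesis using C(1) by (meson mult_left_mono less_imp_le order_trans)
  qed
  define B where "B = C * (real k * m) / c"
  have SR: "S (T + R2) \<le> S T + B" for T
  proof -
    have "sublevel T \<subseteq> sublevel (T + R2)" using R2 by (auto simp: sublevel_def)
    then have "S (T + R2) = (\<Sum>\<gamma>\<in>sublevel (T + R2) - sublevel T. exp (- N \<gamma>)) + S T"
      unfolding S_def by (intro sum.subset_diff) auto
    moreover have "(\<Sum>\<gamma>\<in>sublevel (T + R2) - sublevel T. exp (- N \<gamma>)) \<le> B"
      using annulus[of T] c(1) by (simp add: B_def field_simps)
    ultimately show ?thesis by linarith
  qed
  define K1 where "K1 = C * m * exp \<bar>R1\<bar>"
  have K1: "K1 > 0" using C m by (simp add: K1_def)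
  have pairs: "(\<Sum>\<gamma>\<in>sublevel T. \<Sum>\<eta>\<in>sublevel T. measure \<mu> (shadow e \<gamma> \<inter> shadow e \<eta>)) \<le> 2 * K1 * S T * S (T + R2)"
    for T
  proof -
    \<comment> \<open>Orders each pair by magnitude; the full double sum is at most twice the sum of
      \<open>a\<close>.\<close>
    define a where "a \<gamma> \<eta> = (if N \<gamma> \<le> N \<eta> then measure \<mu> (shadow e \<gamma> \<inter> shadow e \<eta>) else 0)" for \<gamma> \<eta>
    have row: "(\<Sum>\<eta>\<in>sublevel T. a \<gamma> \<eta>) \<le> K1 * exp (- N \<gamma>) * S (T + R2)" if \<gamma>: "\<gamma> \<in> sublevel T" for \<gamma>
    proof -
      have \<gamma>G: "\<gamma> \<in> \<Gamma>" using \<gamma> by (simp add: sublevel_def)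
      define A where "A = {\<eta>\<in>sublevel T. N \<gamma> \<le> N \<eta> \<and> shadow e \<gamma> \<inter> shadow e \<eta> \<noteq> {}}"
      have A: "\<eta> \<in> \<Gamma>" "N \<eta> \<le> T" "N \<gamma> \<le> N \<eta>" "\<bar>N (inv \<gamma> \<circ> \<eta>) - (N \<eta> - N \<gamma>)\<bar> \<le> R1" if "\<eta> \<in> A" for \<eta>
        using that R1[OF \<gamma>G, of \<eta>] by (auto simp: A_def sublevel_def)
      have "(\<Sum>\<eta>\<in>sublevel T. a \<gamma> \<eta>) = (\<Sum>\<eta>\<in>A. a \<gamma> \<eta>)"
        by (rule sum.mono_neutral_right) (auto simp: A_def a_def)
      also have "\<dots> \<le> (\<Sum>\<eta>\<in>A. K1 * exp (- N \<gamma>) * exp (- N (inv \<gamma> \<circ> \<eta>)))"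
      proof (rule sum_mono)
        fix \<eta> assume \<eta>: "\<eta> \<in> A"
        have "a \<gamma> \<eta> \<le> ?O \<eta>"
          unfolding a_def using A[OF \<eta>] by (auto intro!: finite_measure_mono)
        also have "\<dots> \<le> C * m * exp (- N \<eta>)" by (rule up[OF A(1)[OF \<eta>]])
        also have "exp (- N \<eta>) \<le> exp (\<bar>R1\<bar> + (- N \<gamma>) + (- N (inv \<gamma> \<circ> \<eta>)))"
          using A(4)[OF \<eta>] by simp
        then have "C * m * exp (- N \<eta>) \<le> C * m * exp (\<bar>R1\<bar> + (- N \<gamma>) + (- N (inv \<gamma> \<circ> \<eta>)))"
          using C(1) m by (intro mult_left_mono) auto
        also have "\<dots> = K1 * exp (- N \<gamma>) * exp (- N (inv \<gamma> \<circ> \<eta>))"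
          by (simp only: exp_add K1_def mult.assoc)
        finally show "a \<gamma> \<eta> \<le> K1 * exp (- N \<gamma>) * exp (- N (inv \<gamma> \<circ> \<eta>))" .
      qed
      also have "\<dots> = K1 * exp (- N \<gamma>) * (\<Sum>\<theta>\<in>(\<circ>) (inv \<gamma>) ` A. exp (- N \<theta>))"
        unfolding sum_distrib_left sum.reindex[OF inj_on_left_mult[OF inv_in[OF \<gamma>G]]] by (simp only: o_apply)
      also have "\<dots> \<le> K1 * exp (- N \<gamma>) * S (T + R2)"
      proof (rule mult_left_mono)
        have "(\<circ>) (inv \<gamma>) ` A \<subseteq> sublevel (T + R2)"
        proof clarify
          fix \<eta> assume \<eta>: "\<eta> \<in> A"
          have "N (inv \<gamma> \<circ> \<eta>) \<le> T + R2" using A[OF \<eta>] m0(2)[OF \<gamma>G] by (simp add: R2_def)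
          then show "inv \<gamma> \<circ> \<eta> \<in> sublevel (T + R2)" using A(1)[OF \<eta>] \<gamma>G by (simp add: sublevel_def)
        qed
        then show "(\<Sum>\<theta>\<in>(\<circ>) (inv \<gamma>) ` A. exp (- N \<theta>)) \<le> S (T + R2)"
          unfolding S_def by (intro sum_mono2) auto
      qed (use K1 in simp)
      finally show ?thesis .
    qed
    have "measure \<mu> (shadow e \<gamma> \<inter> shadow e \<eta>) \<le> a \<gamma> \<eta> + a \<eta> \<gamma>" for \<gamma> \<eta>
      by (auto simp: a_def Int_commute)
    then have "(\<Sum>\<gamma>\<in>sublevel T. \<Sum>\<eta>\<in>sublevel T. measure \<mu> (shadow e \<gamma> \<inter> shadow e \<eta>)) \<le>
        (\<Sum>\<gamma>\<in>sublevel T. \<Sum>\<eta>\<in>sublevel T. a \<gamma> \<eta> + a \<eta> \<gamma>)"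
      by (intro sum_mono)
    also have "\<dots> = 2 * (\<Sum>\<gamma>\<in>sublevel T. \<Sum>\<eta>\<in>sublevel T. a \<gamma> \<eta>)"
      by (simp add: sum.distrib sum.swap[of "\<lambda>\<gamma> \<eta>. a \<eta> \<gamma>"])
    also have "\<dots> \<le> 2 * (\<Sum>\<gamma>\<in>sublevel T. K1 * exp (- N \<gamma>) * S (T + R2))"
      by (intro mult_left_mono sum_mono row) auto
    also have "\<dots> = 2 * K1 * S T * S (T + R2)"
      by (simp add: S_def sum_distrib_left sum_distrib_right mult_ac)
    finally show ?thesis .
  qed
  define K where "K = 4 * K1 * (C / c)\<^sup>2"
  have K: "K > 0" using K1 C c by (simp add: K_def)
  have "1 / (4 * K) \<le> measure \<mu> (at_least h \<Gamma> (shadow e))" for h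
  proof -
    \<comment> \<open>Three demands on \<open>S T\<close>: positivity, absorbing \<open>B\<close> so
      that \<open>S (T + R2)\<close> is at most \<open>2 * S T\<close>, and a mean overlap of at
      least \<open>2 * h\<close>.\<close>
    define L where "L = max (max 1 B) (C / c * (2 * real h * m))"
    obtain F where F: "F \<subseteq> \<Gamma>" "finite F" "L \<le> (\<Sum>\<gamma>\<in>F. exp (- N \<gamma>))" using div by blast
    define T where "T = Max (insert 0 (N ` F))"
    have "F \<subseteq> sublevel T" using F by (auto simp: sublevel_def T_def intro!: Max_ge)
    then have "(\<Sum>\<gamma>\<in>F. exp (- N \<gamma>)) \<le> S T" unfolding S_def by (intro sum_mono2) auto
    then have ST: "1 \<le> S T" "B \<le> S T" "C / c * (2 * real h * m) \<le> S T"
      using F(3) unfolding L_def by linarith+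
    have SsT: "S T \<le> C / c * s T" using Ss[of T] c(1) by (simp add: field_simps)
    have Cc: "C / c > 0" using C c by simp
    have "C / c * (2 * real h * m) \<le> C / c * s T" using ST(3) SsT by linarith
    then have hs: "real h * m \<le> s T / 2" using Cc mult_le_cancel_left_pos[OF Cc] by simp
    have "0 < C / c * s T" using ST(1) SsT by linarith
    then have s0: "s T > 0" using Cc zero_less_mult_pos by blast
    have "(\<Sum>\<gamma>\<in>sublevel T. \<Sum>\<eta>\<in>sublevel T. measure \<mu> (shadow e \<gamma> \<inter> shadow e \<eta>)) \<le> 2 * K1 * S T * S (T + R2)"
      by (rule pairs)
    also have "\<dots> \<le> 2 * K1 * S T * (2 * S T)"
      using SR[of T] ST K1 by (intro mult_left_mono) auto
    also have "\<dots> = 4 * K1 * (S T)\<^sup>2" by (simp add: power2_eq_square)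
    also have "\<dots> \<le> 4 * K1 * (C / c * s T)\<^sup>2"
      using SsT ST K1 by (intro mult_left_mono power_mono) auto
    also have "\<dots> = K * (s T)\<^sup>2" by (simp add: K_def power_mult_distrib power_divide)
    finally have Qf: "(\<Sum>\<gamma>\<in>sublevel T. \<Sum>\<eta>\<in>sublevel T. measure \<mu> (shadow e \<gamma> \<inter> shadow e \<eta>)) \<le> K * (s T)\<^sup>2" .
    have "1 / (4 * K) \<le> measure \<mu> {x \<in> space \<mu>. real h \<le> real (card {\<gamma>\<in>sublevel T. x \<in> shadow e \<gamma>})}"
    proof (rule second_moment_bound[OF finite_sublevel _ K _ s_def s0 _ Qf])
      show "real h * measure \<mu> (space \<mu>) \<le> s T / 2" using hs by (simp add: space m_def)
    qed (auto simp: sublevel_def)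
    also have "\<dots> \<le> measure \<mu> (at_least h \<Gamma> (shadow e))"
    proof (rule finite_measure_mono)
      show "at_least h \<Gamma> (shadow e) \<in> sets \<mu>"
        using open_at_least[of \<Gamma> "shadow e", OF open_shadow] sets by simp
      show "{x \<in> space \<mu>. real h \<le> real (card {\<gamma>\<in>sublevel T. x \<in> shadow e \<gamma>})} \<subseteq> at_least h \<Gamma> (shadow e)"
      proof
        fix x assume "x \<in> {x \<in> space \<mu>. real h \<le> real (card {\<gamma>\<in>sublevel T. x \<in> shadow e \<gamma>})}"
        then have "h \<le> card {\<gamma>\<in>sublevel T. x \<in> shadow e \<gamma>}" by simp
        then obtain G where "G \<subseteq> {\<gamma>\<in>sublevel T. x \<in> shadow e \<gamma>}" "card G = h" "finite G"
          by (rule obtain_subset_with_card_n)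
        then show "x \<in> at_least h \<Gamma> (shadow e)"
          unfolding at_least_def by (auto simp: sublevel_def subset_iff intro!: exI[of _ G])
      qed
    qed
    finally show ?thesis .
  qed
  then have "1 / (4 * K) \<le> measure \<mu> (conical e)"
    unfolding conical_def by (intro measure_infinitely_many[OF finite_measure_axioms sets open_shadow])
  then show ?thesis using e K by (intro exI[of _ e]) (auto intro: less_le_trans[of 0 "1 / (4 * K)"])
qed

text \<open>Greedy selection: the enlarged shadow of an element of least magnitude covers every
  shadow that meets it, so those are discarded and the remaining ones are treated by
  induction.\<close>

lemma finite_vitali:
  assumes incl: "\<And>\<gamma> \<eta>. \<gamma> \<in> \<Gamma> \<Longrightarrow> \<eta> \<in> \<Gamma> \<Longrightarrow> shadow e \<gamma> \<inter> shadow e \<eta> \<noteq> {} \<Longrightarrow> N \<gamma> \<le> N \<eta> \<Longrightarrow>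
     shadow e \<eta> \<subseteq> shadow e' \<gamma>" and le: "e' \<le> e"
    and F: "finite F" "F \<subseteq> \<Gamma>"
  shows "\<exists>G\<subseteq>F. disjoint_family_on (shadow e) G \<and> (\<Union>\<gamma>\<in>F. shadow e \<gamma>) \<subseteq> (\<Union>\<gamma>\<in>G. shadow e' \<gamma>)"
  using F
proof (induction F rule: finite_psubset_induct)
  case (psubset F)
  show ?case
  proof (cases "F = {}")
    case True
    then show ?thesis by (auto simp: disjoint_family_on_def)
  next
    case False
    obtain \<gamma> where \<gamma>: "\<gamma> \<in> F" "\<And>\<eta>. \<eta> \<in> F \<Longrightarrow> N \<gamma> \<le> N \<eta>"
      using ex_min_if_finite[of "N ` F"] False psubset(1)
      by (metis (no_types, lifting) arg_min_if_finite(1) arg_min_least)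
    define F' where "F' = {\<eta>\<in>F - {\<gamma>}. shadow e \<gamma> \<inter> shadow e \<eta> = {}}"
    have F'F: "F' \<subset> F" using \<gamma> by (auto simp: F'_def)
    have F'G: "F' \<subseteq> \<Gamma>" using psubset.prems by (auto simp: F'_def)
    from psubset.IH[OF F'F F'G] obtain G where G: "G \<subseteq> F'" "disjoint_family_on (shadow e) G"
      "(\<Union>\<gamma>\<in>F'. shadow e \<gamma>) \<subseteq> (\<Union>\<gamma>\<in>G. shadow e' \<gamma>)" by (elim exE conjE)
    have "disjoint_family_on (shadow e) (insert \<gamma> G)"
      using G unfolding disjoint_family_on_def F'_def by blast
    moreover have "shadow e \<eta> \<subseteq> (\<Union>\<gamma>\<in>insert \<gamma> G. shadow e' \<gamma>)" if \<eta>: "\<eta> \<in> F" for \<eta>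
    proof (cases "\<eta> \<in> F'")
      case True
      then show ?thesis using G(3) by blast
    next
      case False
      show ?thesis
      proof (cases "\<eta> = \<gamma>")
        case True
        then show ?thesis using shadow_mono[OF le] by blast
      next
        case neq: False
        then have "shadow e \<gamma> \<inter> shadow e \<eta> \<noteq> {}" using False \<eta> by (simp add: F'_def)
        then have "shadow e \<eta> \<subseteq> shadow e' \<gamma>" using incl \<gamma> \<eta> psubset.prems by blast
        then show ?thesis by blast
      qed
    qed
    moreover have "insert \<gamma> G \<subseteq> F" using G(1) \<gamma> by (auto simp: F'_def)
    ultimately show ?thesis by blast
  qed
qed

text \<open>A Lebesgue density theorem with shadows in place of balls and
  \<open>exp (- N \<gamma>)\<close> in place of their mass. All but finitely many bad shadows
  through a point of \<open>E\<close> lie in an open \<open>U\<close> slightly larger than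
  \<open>E\<close>. A disjoint subfamily, whose enlargements still cover, has its mass outside
  \<open>E\<close> inside \<open>U - E\<close>, so the exceptional set has mass at most a multiple
  of \<open>\<epsilon>\<close>.\<close>

lemma shadow_density:
  assumes qc: "quasi_conformal \<mu> N" and e: "e > 0" and E: "E \<in> sets borel" and t: "t > 0"
  shows "measure \<mu> (E \<inter> {x. infinite {\<gamma>\<in>{\<gamma>\<in>\<Gamma>. t * exp (- N \<gamma>) < measure \<mu> (shadow e \<gamma> - E)}. x \<in> shadow e \<gamma>}}) = 0"
proof -
  interpret finite_measure \<mu> using qc by (simp add: quasi_conformal_def)
  have sets: "sets \<mu> = sets borel" using qc by (simp add: quasi_conformal_def)
  define J where "J = {\<gamma>\<in>\<Gamma>. t * exp (- N \<gamma>) < measure \<mu> (shadow e \<gamma> - E)}"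
  define B where "B = E \<inter> {x. infinite {\<gamma>\<in>J. x \<in> shadow e \<gamma>}}"
  obtain e1 where e1: "e1 > 0" "\<And>\<gamma> \<eta>. \<gamma> \<in> \<Gamma> \<Longrightarrow> \<eta> \<in> \<Gamma> \<Longrightarrow> shadow e \<gamma> \<inter> shadow e \<eta> \<noteq> {} \<Longrightarrow> N \<gamma> \<le> N \<eta> + 0 \<Longrightarrow>
     shadow e \<eta> \<subseteq> shadow e1 \<gamma>"
    using shadow_inclusion[OF e, of 0] by blast
  define e' where "e' = min e e1"
  have e': "e' > 0" "e' \<le> e" using e e1 by (auto simp: e'_def)
  have incl: "shadow e \<eta> \<subseteq> shadow e' \<gamma>"
    if "\<gamma> \<in> \<Gamma>" "\<eta> \<in> \<Gamma>" "shadow e \<gamma> \<inter> shadow e \<eta> \<noteq> {}" "N \<gamma> \<le> N \<eta>" for \<gamma> \<eta>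
    using e1(2)[OF that(1-3)] that(4) shadow_mono[of e' e1 \<gamma>] by (auto simp: e'_def)
  obtain C where C: "C > 0"
    "\<And>\<gamma> E. \<gamma> \<in> \<Gamma> \<Longrightarrow> E \<in> sets borel \<Longrightarrow> E \<subseteq> big e' \<gamma> \<Longrightarrow>
        measure \<mu> (\<gamma> ` E) \<le> C * exp (- N \<gamma>) * measure \<mu> E"
    "\<And>\<gamma> E. \<gamma> \<in> \<Gamma> \<Longrightarrow> E \<in> sets borel \<Longrightarrow> E \<subseteq> big e' \<gamma> \<Longrightarrow>
        exp (- N \<gamma>) * measure \<mu> E \<le> C * measure \<mu> (\<gamma> ` E)"
    using quasi_conformal_bounds[OF qc e'(1)] by metis
  \<comment> \<open>The factor by which an enlarged shadow can outweigh the part of a bad shadow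
    outside \<open>E\<close>.\<close>
  define M where "M = C * measure \<mu> UNIV / t"
  have M: "M \<ge> 0" using C t by (simp add: M_def)
  have sh': "measure \<mu> (shadow e' \<gamma>) \<le> M * (t * exp (- N \<gamma>))" if \<gamma>: "\<gamma> \<in> \<Gamma>" for \<gamma>
  proof -
    have "measure \<mu> (shadow e' \<gamma>) \<le> C * exp (- N \<gamma>) * measure \<mu> (big e' \<gamma>)"
      unfolding shadow_def by (rule C(2)[OF \<gamma>]) (use open_big[OF \<gamma>] in auto)
    also have "\<dots> \<le> C * exp (- N \<gamma>) * measure \<mu> UNIV"
      using C(1) by (intro mult_left_mono finite_measure_mono) (auto simp: sets)
    also have "\<dots> = M * (t * exp (- N \<gamma>))" using t by (simp add: M_def)
    finally show ?thesis .
  qed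
  have "measure \<mu> B \<le> M * \<epsilon>" if eps: "\<epsilon> > 0" for \<epsilon>
  proof -
    obtain F0 U where U: "open U" "E \<subseteq> U" "F0 \<subseteq> E" "closed F0" "measure \<mu> (U - F0) < \<epsilon>"
      using finite_borel_measure_regular[OF finite_measure_axioms sets E eps] by blast
    have UE: "measure \<mu> (U - E) \<le> \<epsilon>"
    proof -
      have "measure \<mu> (U - E) \<le> measure \<mu> (U - F0)"
        by (rule finite_measure_mono) (use U sets in auto)
      then show ?thesis using U by simp
    qed
    \<comment> \<open>Finite stages, to which the covering lemma applies; they increase to all bad
      shadows inside \<open>U\<close>.\<close>
    define H where "H n = {\<gamma>\<in>J. shadow e \<gamma> \<subseteq> U} \<inter> sublevel (real n)" for n
    let ?V = "\<lambda>n. \<Union>\<gamma>\<in>H n. shadow e \<gamma>"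
    have H: "H n \<subseteq> \<Gamma>" "finite (H n)" for n by (auto simp: H_def J_def)
    have bound: "measure \<mu> (?V n) \<le> M * \<epsilon>" for n
    proof -
      obtain G where G: "G \<subseteq> H n" "disjoint_family_on (shadow e) G" "?V n \<subseteq> (\<Union>\<gamma>\<in>G. shadow e' \<gamma>)"
        using finite_vitali[of e e' "H n", OF incl e'(2) H(2,1)] by blast
      have GG: "finite G" "\<And>\<gamma>. \<gamma> \<in> G \<Longrightarrow> \<gamma> \<in> \<Gamma>" using G(1) H finite_subset by blast+
      have GJ: "t * exp (- N \<gamma>) \<le> measure \<mu> (shadow e \<gamma> - E)" "shadow e \<gamma> \<subseteq> U" if "\<gamma> \<in> G" for \<gamma>
        using that G(1) by (auto simp: H_def J_def)
      have "measure \<mu> (?V n) \<le> measure \<mu> (\<Union>\<gamma>\<in>G. shadow e' \<gamma>)"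
        by (rule finite_measure_mono[OF G(3)]) (use GG open_shadow sets in auto)
      also have "\<dots> \<le> (\<Sum>\<gamma>\<in>G. measure \<mu> (shadow e' \<gamma>))"
        by (rule finite_measure_subadditive_finite) (use GG open_shadow sets in auto)
      also have "\<dots> \<le> (\<Sum>\<gamma>\<in>G. M * measure \<mu> (shadow e \<gamma> - E))"
      proof (rule sum_mono)
        fix \<gamma> assume \<gamma>: "\<gamma> \<in> G"
        have "M * (t * exp (- N \<gamma>)) \<le> M * measure \<mu> (shadow e \<gamma> - E)"
          using GJ(1)[OF \<gamma>] M by (rule mult_left_mono)
        then show "measure \<mu> (shadow e' \<gamma>) \<le> M * measure \<mu> (shadow e \<gamma> - E)"
          using sh'[OF GG(2)[OF \<gamma>]] by linarith
      qed
      also have "\<dots> = M * measure \<mu> (\<Union>\<gamma>\<in>G. shadow e \<gamma> - E)"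
      proof -
        have "disjoint_family_on (\<lambda>\<gamma>. shadow e \<gamma> - E) G"
          using G(2) unfolding disjoint_family_on_def by blast
        then have "measure \<mu> (\<Union>\<gamma>\<in>G. shadow e \<gamma> - E) = (\<Sum>\<gamma>\<in>G. measure \<mu> (shadow e \<gamma> - E))"
          using GG E open_shadow sets by (intro finite_measure_finite_Union) auto
        then show ?thesis by (simp add: sum_distrib_left)
      qed
      also have "\<dots> \<le> M * measure \<mu> (U - E)"
      proof (rule mult_left_mono[OF finite_measure_mono M])
        show "(\<Union>\<gamma>\<in>G. shadow e \<gamma> - E) \<subseteq> U - E" using GJ(2) by blast
      qed (use U E sets in auto)
      also have "\<dots> \<le> M * \<epsilon>" using UE M by (rule mult_left_mono)
      finally show ?thesis .
    qed
    have Vs: "range ?V \<subseteq> sets \<mu>" using H(1) open_shadow sets by (auto intro!: borel_open open_UN)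
    have "incseq ?V"
      by (rule incseq_SucI) (auto simp: H_def sublevel_def)
    from finite_Lim_measure_incseq[OF Vs this]
    have "measure \<mu> (\<Union>n. ?V n) \<le> M * \<epsilon>"
      using bound by (meson LIMSEQ_le_const2)
    moreover have "B \<subseteq> (\<Union>n. ?V n)"
    proof
      fix x assume x: "x \<in> B"
      then have inf: "infinite {\<gamma>\<in>J. x \<in> shadow e \<gamma>}" and "x \<in> U" using U by (auto simp: B_def)
      have fin: "finite {\<gamma>\<in>\<Gamma>. x \<in> shadow e \<gamma> \<and> \<not> shadow e \<gamma> \<subseteq> U}"
        by (rule finite_shadow_not_subset[OF U(1) \<open>x \<in> U\<close> e])
      from Diff_infinite_finite[OF fin inf] obtain \<gamma> where "\<gamma> \<in> {\<gamma>\<in>J. x \<in> shadow e \<gamma>} - {\<gamma>\<in>\<Gamma>. x \<in> shadow e \<gamma> \<and> \<not> shadow e \<gamma> \<subseteq> U}"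
        using infinite_imp_nonempty by blast
      then have \<gamma>: "\<gamma> \<in> J" "x \<in> shadow e \<gamma>" "shadow e \<gamma> \<subseteq> U" by (auto simp: J_def)
      obtain n where "N \<gamma> \<le> real n" using real_arch_simple by blast
      then have "\<gamma> \<in> H n" using \<gamma> by (auto simp: H_def J_def sublevel_def)
      then show "x \<in> (\<Union>n. ?V n)" using \<gamma> by blast
    qed
    then have "measure \<mu> B \<le> measure \<mu> (\<Union>n. ?V n)"
      by (rule finite_measure_mono) (use Vs in auto)
    ultimately show ?thesis by linarith
  qed
  note small = this
  have "measure \<mu> B \<le> 0"
  proof (rule field_le_epsilon)
    fix \<epsilon> :: real assume "\<epsilon> > 0"
    then have "\<epsilon> / (M + 1) > 0" using M by simp
    from small[OF this] have "measure \<mu> B \<le> M * (\<epsilon> / (M + 1))" .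
    also have "\<dots> \<le> \<epsilon>" using M \<open>\<epsilon> > 0\<close> by (simp add: field_simps)
    finally show "measure \<mu> B \<le> 0 + \<epsilon>" by simp
  qed
  then have "measure \<mu> B = 0" using measure_nonneg[of \<mu> B] by linarith
  then show ?thesis unfolding B_def J_def .
qed

text \<open>At almost every point \<open>x\<close> of the set, each density estimate fails for
  finitely many shadows only. Along a sequence of shadows through \<open>x\<close>, the mass outside
  \<open>E\<close> is small relative to \<open>exp (- N (g n))\<close>; undoing \<open>g n\<close>
  multiplies it by the reciprocal factor, on regions that fill up M without
  \<open>b\<close>.\<close>

lemma zoom:
  assumes qc: "quasi_conformal \<mu> N" and e: "e > 0" and E: "E \<in> sets borel"
    and pos: "0 < measure \<mu> (E \<inter> conical e)"
  shows "\<exists>g a b. conv_seq g a b \<and>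
    (\<forall>s>0. (\<lambda>n. measure \<mu> ({x. s < d (Inr x) (Inr b)} - inv (g n) ` E)) \<longlonglongrightarrow> 0)"
proof -
  interpret finite_measure \<mu> using qc by (simp add: quasi_conformal_def)
  have sets: "sets \<mu> = sets borel" using qc by (simp add: quasi_conformal_def)
  \<comment> \<open>Countably many parameters and tolerances keep the union of the exceptional sets
    null. No \<open>\<epsilon> k\<close> exceeds \<open>e\<close>, so \<open>x\<close> stays in the
    shadows with these parameters.\<close>
  define \<epsilon> where "\<epsilon> k = e / real (Suc k)" for k :: nat
  define t where "t j = 1 / real (Suc j)" for j :: nat
  have \<epsilon>: "\<epsilon> k > 0" "\<epsilon> k \<le> e" for k using e by (auto simp: \<epsilon>_def field_simps)
  have t: "t j > 0" for j by (simp add: t_def)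
  define J where "J k j = {\<gamma>\<in>\<Gamma>. t j * exp (- N \<gamma>) < measure \<mu> (shadow (\<epsilon> k) \<gamma> - E)}" for k j
  define B where "B k j = E \<inter> {x. infinite {\<gamma>\<in>J k j. x \<in> shadow (\<epsilon> k) \<gamma>}}" for k j
  have Bs: "B k j \<in> sets \<mu>" for k j
    unfolding B_def using E sets borel_infinitely_many[of "J k j" "shadow (\<epsilon> k)"] open_shadow
    by (auto simp: J_def)
  have "measure \<mu> (B k j) = 0" for k j
    using shadow_density[OF qc \<epsilon>(1) E t, of j k] unfolding B_def J_def .
  then have "B k j \<in> null_sets \<mu>" for k j
    using Bs[of k j] by (simp add: null_sets_def emeasure_eq_measure)
  then have null: "(\<Union>k j. B k j) \<in> null_sets \<mu>" by blast
  have "\<not> E \<inter> conical e \<subseteq> (\<Union>k j. B k j)"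
  proof
    assume "E \<inter> conical e \<subseteq> (\<Union>k j. B k j)"
    then have "measure \<mu> (E \<inter> conical e) \<le> measure \<mu> (\<Union>k j. B k j)"
      by (rule finite_measure_mono) (use null in auto)
    also have "\<dots> = 0" using null by (simp add: null_sets_def measure_def)
    finally show False using pos by simp
  qed
  then obtain x where x0: "x \<in> E \<inter> conical e" "x \<notin> (\<Union>k j. B k j)" by (meson subsetI)
  then have x: "x \<in> E" "x \<in> conical e" "\<And>k j. x \<notin> B k j" by simp_all
  have fin: "finite {\<gamma>\<in>J k j. x \<in> shadow (\<epsilon> k) \<gamma>}" for k j using x(1) x(3)[of k j] by (simp add: B_def)
  have "infinite {\<gamma>\<in>\<Gamma>. x \<in> shadow e \<gamma>}" using x(2) by (simp add: conical_def)
  then obtain h :: "nat \<Rightarrow> 'm \<Rightarrow> 'm" where h: "inj h" "range h \<subseteq> {\<gamma>\<in>\<Gamma>. x \<in> shadow e \<gamma>}"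
    using infinite_countable_subset by blast
  then have hG: "h n \<in> \<Gamma>" and hx: "x \<in> shadow e (h n)" for n by auto
  obtain r a b where r: "strict_mono (r :: nat \<Rightarrow> nat)" and c: "conv_seq (\<lambda>n. h (r n)) a b"
    using ex_conv_seq[of h, OF h(1) hG] by blast
  define g where "g n = h (r n)" for n
  have c: "conv_seq g a b" using c by (simp add: g_def[abs_def])
  have injg: "inj g" using inj_compose[OF h(1) strict_mono_imp_inj_on[OF r]] by (simp add: o_def g_def[abs_def])
  have gG: "g n \<in> \<Gamma>" and gx: "x \<in> shadow e (g n)" for n using hG hx by (auto simp: g_def)
  have "(\<lambda>n. measure \<mu> ({x. s < d (Inr x) (Inr b)} - inv (g n) ` E)) \<longlonglongrightarrow> 0" if s: "s > 0" for s
  proof (rule tendstoI)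
    fix \<tau> :: real assume \<tau>: "\<tau> > 0"
    \<comment> \<open>The order matters: \<open>k\<close> depends on \<open>s\<close>, the constant
      \<open>C\<close> on \<open>k\<close>, and the tolerance index \<open>j\<close> on
      \<open>C\<close>.\<close>
    obtain k where "inverse (real (Suc k)) < s / e" using reals_Archimedean[of "s / e"] s e by auto
    then have k: "\<epsilon> k < s" using e by (simp add: \<epsilon>_def field_simps)
    obtain C where C: "C > 0"
    "\<And>\<gamma> E. \<gamma> \<in> \<Gamma> \<Longrightarrow> E \<in> sets borel \<Longrightarrow> E \<subseteq> big (\<epsilon> k) \<gamma> \<Longrightarrow>
        measure \<mu> (\<gamma> ` E) \<le> C * exp (- N \<gamma>) * measure \<mu> E"
    "\<And>\<gamma> E. \<gamma> \<in> \<Gamma> \<Longrightarrow> E \<in> sets borel \<Longrightarrow> E \<subseteq> big (\<epsilon> k) \<gamma> \<Longrightarrow>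
        exp (- N \<gamma>) * measure \<mu> E \<le> C * measure \<mu> (\<gamma> ` E)"
    using quasi_conformal_bounds[OF qc \<epsilon>(1)[of k]] by metis
    obtain j where "inverse (real (Suc j)) < \<tau> / C" using reals_Archimedean[of "\<tau> / C"] \<tau> C(1) by auto
    then have j: "C * t j < \<tau>" using C(1) by (simp add: t_def field_simps)
    have "finite (g -` {\<gamma>\<in>J k j. x \<in> shadow (\<epsilon> k) \<gamma>})" by (rule finite_vimageI[OF fin injg])
    then have "\<forall>\<^sub>F n in sequentially. g n \<notin> {\<gamma>\<in>J k j. x \<in> shadow (\<epsilon> k) \<gamma>}"
      by (simp add: cofinite_eq_sequentially[symmetric] eventually_cofinite vimage_def)
    moreover have "\<forall>\<^sub>F n in sequentially. {x. s < d (Inr x) (Inr b)} \<subseteq> big (\<epsilon> k) (g n)"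
      by (rule far_subset_big[OF conv_seq_Inl_inv[OF c] gG _ k]) simp
    ultimately show "\<forall>\<^sub>F n in sequentially. dist (measure \<mu> ({x. s < d (Inr x) (Inr b)} - inv (g n) ` E)) 0 < \<tau>"
    proof eventually_elim
      case (elim n)
      have "x \<in> shadow (\<epsilon> k) (g n)" using gx[of n] shadow_mono[OF \<epsilon>(2)] by blast
      then have "g n \<notin> J k j" using elim(1) by blast
      then have small: "measure \<mu> (shadow (\<epsilon> k) (g n) - E) \<le> t j * exp (- N (g n))"
        using gG by (simp add: J_def not_less)
      let ?D = "big (\<epsilon> k) (g n) - inv (g n) ` E"
      have Ds: "?D \<in> sets borel" using open_big[OF gG] image_in_borel[OF inv_in[OF gG] E] by auto
      have "g n ` ?D = shadow (\<epsilon> k) (g n) - E"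
        using inj_in[OF gG, of n] gG by (simp add: image_set_diff shadow_def image_image)
      then have "exp (- N (g n)) * measure \<mu> ?D \<le> C * measure \<mu> (shadow (\<epsilon> k) (g n) - E)"
        using C(3)[OF gG[of n] Ds Diff_subset] by simp
      also have "\<dots> \<le> C * (t j * exp (- N (g n)))" using small C(1) by (intro mult_left_mono) auto
      finally have "exp (- N (g n)) * measure \<mu> ?D \<le> exp (- N (g n)) * (C * t j)" by (simp add: mult_ac)
      then have "measure \<mu> ?D \<le> C * t j" by simp
      moreover have "measure \<mu> ({x. s < d (Inr x) (Inr b)} - inv (g n) ` E) \<le> measure \<mu> ?D"
        by (rule finite_measure_mono) (use elim(2) Ds sets in auto)
      ultimately show ?case using j by simp
    qed
  qed
  then show ?thesis using c by blast
qed

end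

section \<open>Ergodicity\<close>

text \<open>\<open>E k\<close> is where the density of \<nu> lies between \<open>1 / Suc k\<close>
  and \<open>Suc k\<close>. The complements decrease to the set where the density is zero or
  infinite: the first part is \<nu>-null, hence \<mu>-null by the equivalence of null sets, and the
  second is \<mu>-null because \<nu> is finite.\<close>

lemma comparable_exhaustion:
  assumes fm: "finite_measure \<mu>" and fn: "finite_measure \<nu>" and sets: "sets \<nu> = sets \<mu>"
    and null: "\<And>F. F \<in> sets \<mu> \<Longrightarrow> measure \<mu> F = 0 \<longleftrightarrow> measure \<nu> F = 0"
  obtains E :: "nat \<Rightarrow> 'a set" where "\<And>k. E k \<in> sets \<mu>"
    "\<And>k F. F \<in> sets \<mu> \<Longrightarrow> F \<subseteq> E k \<Longrightarrow> measure \<mu> F \<le> real (Suc k) * measure \<nu> F"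
    "\<And>k F. F \<in> sets \<mu> \<Longrightarrow> F \<subseteq> E k \<Longrightarrow> measure \<nu> F \<le> real (Suc k) * measure \<mu> F"
    "(\<lambda>k. measure \<mu> (space \<mu> - E k)) \<longlonglongrightarrow> 0" "(\<lambda>k. measure \<nu> (space \<nu> - E k)) \<longlonglongrightarrow> 0"
proof -
  note goal = that
  interpret M: finite_measure \<mu> by fact
  interpret V: finite_measure \<nu> by fact
  have space: "space \<nu> = space \<mu>" by (rule sets_eq_imp_space_eq[OF sets])
  have ac: "absolutely_continuous \<mu> \<nu>"
    unfolding absolutely_continuous_def
  proof
    fix F assume F: "F \<in> null_sets \<mu>"
    then have "measure \<mu> F = 0" by (simp add: measure_def null_sets_def)
    then show "F \<in> null_sets \<nu>"
      using null[of F] F sets by (simp add: null_sets_def V.emeasure_eq_measure)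
  qed
  define f where "f = RN_deriv \<mu> \<nu>"
  have fm [measurable]: "f \<in> borel_measurable \<mu>" by (simp add: f_def)
  have eq: "emeasure \<nu> F = (\<integral>\<^sup>+x. f x * indicator F x \<partial>\<mu>)" if "F \<in> sets \<mu>" for F
    using M.density_RN_deriv[OF ac sets] emeasure_density[OF fm that] by (simp add: f_def)
  define E where "E k = {x \<in> space \<mu>. ennreal (1 / real (Suc k)) \<le> f x \<and> f x \<le> ennreal (real (Suc k))}" for k
  have Es: "E k \<in> sets \<mu>" for k by (simp add: E_def)
  have up: "measure \<nu> F \<le> real (Suc k) * measure \<mu> F" if F: "F \<in> sets \<mu>" "F \<subseteq> E k" for k F
  proof -
    have "emeasure \<nu> F \<le> (\<integral>\<^sup>+x. ennreal (real (Suc k)) * indicator F x \<partial>\<mu>)"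
      unfolding eq[OF F(1)] by (rule nn_integral_mono) (use F(2) in \<open>auto simp: E_def indicator_def\<close>)
    also have "\<dots> = ennreal (real (Suc k)) * emeasure \<mu> F"
      using F(1) by (rule nn_integral_cmult_indicator)
    finally have "ennreal (measure \<nu> F) \<le> ennreal (real (Suc k) * measure \<mu> F)"
      by (simp only: M.emeasure_eq_measure V.emeasure_eq_measure ennreal_mult' of_nat_0_le_iff)
    then show ?thesis by (subst (asm) ennreal_le_iff) auto
  qed
  have lo: "measure \<mu> F \<le> real (Suc k) * measure \<nu> F" if F: "F \<in> sets \<mu>" "F \<subseteq> E k" for k F
  proof -
    have "ennreal (1 / real (Suc k)) * emeasure \<mu> F = (\<integral>\<^sup>+x. ennreal (1 / real (Suc k)) * indicator F x \<partial>\<mu>)"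
      using F(1) by (rule nn_integral_cmult_indicator[symmetric])
    also have "\<dots> \<le> emeasure \<nu> F"
      unfolding eq[OF F(1)] by (rule nn_integral_mono) (use F(2) in \<open>auto simp: E_def indicator_def\<close>)
    finally have "ennreal (1 / real (Suc k) * measure \<mu> F) \<le> ennreal (measure \<nu> F)"
      by (simp only: M.emeasure_eq_measure V.emeasure_eq_measure ennreal_mult' of_nat_0_le_iff
          zero_le_divide_1_iff)
    then have "1 / real (Suc k) * measure \<mu> F \<le> measure \<nu> F" by (subst (asm) ennreal_le_iff) auto
    then show ?thesis by (simp add: field_simps)
  qed
  let ?D = "\<lambda>k. space \<mu> - E k"
  have Ds: "range ?D \<subseteq> sets \<mu>" using Es by auto
  have dec: "decseq ?D"
  proof (rule decseq_SucI, rule Diff_mono[OF order_refl], rule subsetI)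
    fix k x assume x: "x \<in> E k"
    have "ennreal (1 / real (Suc (Suc k))) \<le> ennreal (1 / real (Suc k))"
      by (intro ennreal_leI) (simp add: field_simps)
    moreover have "ennreal (real (Suc k)) \<le> ennreal (real (Suc (Suc k)))"
      by (intro ennreal_leI) simp
    ultimately show "x \<in> E (Suc k)" using x unfolding E_def by (blast intro: order_trans)
  qed
  define Z where "Z = {x \<in> space \<mu>. f x = 0}"
  define I where "I = {x \<in> space \<mu>. f x = \<infinity>}"
  have Zs: "Z \<in> sets \<mu>" and Is: "I \<in> sets \<mu>" by (auto simp: Z_def I_def)
  have "emeasure \<nu> Z = (\<integral>\<^sup>+x. 0 \<partial>\<mu>)"
    unfolding eq[OF Zs] by (rule nn_integral_cong) (auto simp: Z_def indicator_def)
  then have "measure \<nu> Z = 0" by (simp add: measure_def)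
  then have Z0: "measure \<mu> Z = 0" using null[OF Zs] by simp
  have "AE x in \<mu>. f x \<noteq> \<infinity>"
    unfolding f_def by (rule M.RN_deriv_finite[OF V.sigma_finite_measure_axioms ac sets])
  then have "emeasure \<mu> I = 0"
    using Is by (subst (asm) AE_iff_measurable[OF Is]) (auto simp: I_def)
  then have I0: "measure \<mu> I = 0" by (simp add: measure_def)
  have sub: "(\<Inter>k. ?D k) \<subseteq> Z \<union> I"
  proof
    fix x assume x: "x \<in> (\<Inter>k. ?D k)"
    then have xs: "x \<in> space \<mu>" and nE: "\<And>k. x \<notin> E k" by auto
    show "x \<in> Z \<union> I"
    proof (rule ccontr)
      assume "x \<notin> Z \<union> I"
      then have "f x \<noteq> 0" "f x \<noteq> \<infinity>" using xs by (auto simp: Z_def I_def)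
      then obtain r where r: "f x = ennreal r" "r > 0"
        by (cases "f x") (auto simp: less_le)
      obtain k1 where k1: "inverse (real (Suc k1)) < r" using reals_Archimedean[OF r(2)] by blast
      obtain k2 where k2: "r \<le> real k2" using real_arch_simple by blast
      define k where "k = max k1 k2"
      have "1 / real (Suc k) \<le> 1 / real (Suc k1)" by (simp add: k_def field_simps)
      then have "1 / real (Suc k) \<le> r" using k1 by (simp add: inverse_eq_divide)
      moreover have "r \<le> real (Suc k)" using k2 by (simp add: k_def)
      ultimately have "ennreal (1 / real (Suc k)) \<le> f x" "f x \<le> ennreal (real (Suc k))"
        unfolding r(1) by (blast intro: ennreal_leI)+
      then have "x \<in> E k" using xs unfolding E_def by blast
      then show False using nE by blast
    qed
  qed
  have inter: "(\<Inter>k. ?D k) \<in> sets \<mu>" using Ds by blast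
  have "measure \<mu> (\<Inter>k. ?D k) \<le> measure \<mu> (Z \<union> I)"
    by (rule M.finite_measure_mono[OF sub]) (use Zs Is in auto)
  also have "\<dots> \<le> measure \<mu> Z + measure \<mu> I" by (rule measure_Un_le[OF Zs Is])
  finally have m0: "measure \<mu> (\<Inter>k. ?D k) = 0"
    using Z0 I0 measure_nonneg[of \<mu> "\<Inter>k. ?D k"] by linarith
  then have n0: "measure \<nu> (\<Inter>k. ?D k) = 0" using null[OF inter] by simp
  show thesis
  proof (rule goal[of E, OF Es lo up])
    show "(\<lambda>k. measure \<mu> (space \<mu> - E k)) \<longlonglongrightarrow> 0"
      using M.finite_Lim_measure_decseq[OF Ds dec] unfolding m0 .
    have "range ?D \<subseteq> sets \<nu>" using Ds sets by simp
    from V.finite_Lim_measure_decseq[OF this dec]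
    show "(\<lambda>k. measure \<nu> (space \<nu> - E k)) \<longlonglongrightarrow> 0" unfolding n0 space .
  qed
qed

context compactified_group
begin

lemma quasi_conformal_finite: "quasi_conformal \<mu> N \<Longrightarrow> finite_measure \<mu>"
  and quasi_conformal_sets: "quasi_conformal \<mu> N \<Longrightarrow> sets \<mu> = sets borel"
  by (simp_all add: quasi_conformal_def)

text \<open>For invariant \<open>A\<close>, the part of an image in \<open>A\<close> is the image of
  the part in \<open>A\<close>, so the constants of \<mu> serve again. Ergodicity and the treatment
  of the absolutely continuous part of the second measure both rest on such restrictions.\<close>

lemma quasi_conformal_restrict:
  assumes qc: "quasi_conformal \<mu> N" and A: "A \<in> sets borel" and inv: "\<forall>\<gamma>\<in>\<Gamma>. \<gamma> ` A = A"
  shows "quasi_conformal (density \<mu> (indicator A)) N"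
    and "\<And>E. E \<in> sets borel \<Longrightarrow> measure (density \<mu> (indicator A)) E = measure \<mu> (A \<inter> E)"
proof -
  interpret finite_measure \<mu> by (rule quasi_conformal_finite[OF qc])
  note sets = quasi_conformal_sets[OF qc]
  let ?\<nu> = "density \<mu> (indicator A)"
  show meas: "measure ?\<nu> E = measure \<mu> (A \<inter> E)" if "E \<in> sets borel" for E
    by (rule measure_restricted) (use A that sets in auto)
  have "finite_measure ?\<nu>" by (rule finite_measure_restricted) (use A sets in auto)
  moreover have "\<exists>C>0. \<forall>\<gamma>\<in>\<Gamma>. \<forall>E\<in>sets borel. E \<subseteq> big e \<gamma> \<longrightarrow>
        measure ?\<nu> (\<gamma> ` E) \<le> C * exp (- N \<gamma>) * measure ?\<nu> E \<and>
        exp (- N \<gamma>) * measure ?\<nu> E \<le> C * measure ?\<nu> (\<gamma> ` E)" if e: "e > 0" for e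
  proof -
    obtain C where C: "C > 0"
      "\<And>\<gamma> E. \<gamma> \<in> \<Gamma> \<Longrightarrow> E \<in> sets borel \<Longrightarrow> E \<subseteq> big e \<gamma> \<Longrightarrow>
        measure \<mu> (\<gamma> ` E) \<le> C * exp (- N \<gamma>) * measure \<mu> E"
      "\<And>\<gamma> E. \<gamma> \<in> \<Gamma> \<Longrightarrow> E \<in> sets borel \<Longrightarrow> E \<subseteq> big e \<gamma> \<Longrightarrow>
        exp (- N \<gamma>) * measure \<mu> E \<le> C * measure \<mu> (\<gamma> ` E)"
      using quasi_conformal_bounds[OF qc e] by metis
    have "measure ?\<nu> (\<gamma> ` E) \<le> C * exp (- N \<gamma>) * measure ?\<nu> E \<and>
        exp (- N \<gamma>) * measure ?\<nu> E \<le> C * measure ?\<nu> (\<gamma> ` E)"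
      if \<gamma>: "\<gamma> \<in> \<Gamma>" and E: "E \<in> sets borel" "E \<subseteq> big e \<gamma>" for \<gamma> E
    proof -
      have "A \<inter> \<gamma> ` E = \<gamma> ` A \<inter> \<gamma> ` E" using inv \<gamma> by simp
      also have "\<dots> = \<gamma> ` (A \<inter> E)" by (rule image_Int[OF inj_in[OF \<gamma>], symmetric])
      finally have "A \<inter> \<gamma> ` E = \<gamma> ` (A \<inter> E)" .
      moreover have "A \<inter> E \<in> sets borel" "A \<inter> E \<subseteq> big e \<gamma>" using A E by auto
      ultimately show ?thesis
        using C(2,3)[OF \<gamma>, of "A \<inter> E"] by (simp add: meas E image_in_borel[OF \<gamma> E(1)])
    qed
    then show ?thesis using C(1) by blast
  qed
  ultimately show "quasi_conformal ?\<nu> N" unfolding quasi_conformal_def by (simp add: sets)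
qed

lemma invariant_Compl: "\<forall>\<gamma>\<in>\<Gamma>. \<gamma> ` A = A \<Longrightarrow> \<forall>\<gamma>\<in>\<Gamma>. \<gamma> ` (- A) = - A"
  by (simp add: bij_image_Compl_eq bij_in)

text \<open>As \<open>inv \<gamma>\<close> is isolated in the compactification, all of M lies in
  \<open>big\<close> for a small parameter. A single element thus distorts the mass of every Borel
  set by bounded factors, which depend on the element.\<close>

lemma quasi_conformal_element:
  assumes qc: "quasi_conformal \<mu> N" and \<gamma>: "\<gamma> \<in> \<Gamma>"
  shows "\<exists>C>0. \<forall>E\<in>sets borel. measure \<mu> (\<gamma> ` E) \<le> C * measure \<mu> E \<and> measure \<mu> E \<le> C * measure \<mu> (\<gamma> ` E)"
proof -
  obtain e where e: "e > 0" "\<And>p. p \<in> X \<Longrightarrow> d p (Inl (inv \<gamma>)) < e \<Longrightarrow> p = Inl (inv \<gamma>)"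
    using isolated_Inl[OF inv_in[OF \<gamma>]] by blast
  have big: "x \<in> big (e / 2) \<gamma>" for x
  proof -
    have "\<not> d (Inr x) (Inl (inv \<gamma>)) < e" using e(2)[of "Inr x"] by auto
    then show ?thesis using e(1) by (simp add: big_def)
  qed
  have "e / 2 > 0" using e(1) by simp
  then obtain C where C: "C > 0"
      "\<And>\<gamma> E. \<gamma> \<in> \<Gamma> \<Longrightarrow> E \<in> sets borel \<Longrightarrow> E \<subseteq> big (e / 2) \<gamma> \<Longrightarrow>
        measure \<mu> (\<gamma> ` E) \<le> C * exp (- N \<gamma>) * measure \<mu> E"
      "\<And>\<gamma> E. \<gamma> \<in> \<Gamma> \<Longrightarrow> E \<in> sets borel \<Longrightarrow> E \<subseteq> big (e / 2) \<gamma> \<Longrightarrow>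
        exp (- N \<gamma>) * measure \<mu> E \<le> C * measure \<mu> (\<gamma> ` E)"
    using quasi_conformal_bounds[OF qc] by metis
  define K where "K = C * exp (- N \<gamma>) + C * exp (N \<gamma>)"
  have "measure \<mu> (\<gamma> ` E) \<le> K * measure \<mu> E \<and> measure \<mu> E \<le> K * measure \<mu> (\<gamma> ` E)" if E: "E \<in> sets borel" for E
  proof
    have sub: "E \<subseteq> big (e / 2) \<gamma>" using big by blast
    have "measure \<mu> (\<gamma> ` E) \<le> C * exp (- N \<gamma>) * measure \<mu> E" by (rule C(2)[OF \<gamma> E sub])
    also have "\<dots> \<le> K * measure \<mu> E" using C(1) by (intro mult_right_mono) (auto simp: K_def)
    finally show "measure \<mu> (\<gamma> ` E) \<le> K * measure \<mu> E" .
    have "measure \<mu> E = exp (N \<gamma>) * (exp (- N \<gamma>) * measure \<mu> E)"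
      by (simp add: exp_minus)
    also have "\<dots> \<le> exp (N \<gamma>) * (C * measure \<mu> (\<gamma> ` E))"
      using C(3)[OF \<gamma> E sub] by (rule mult_left_mono) simp
    also have "\<dots> = C * exp (N \<gamma>) * measure \<mu> (\<gamma> ` E)" by (simp only: mult_ac)
    also have "\<dots> \<le> K * measure \<mu> (\<gamma> ` E)" using C(1) by (intro mult_right_mono) (auto simp: K_def)
    finally show "measure \<mu> E \<le> K * measure \<mu> (\<gamma> ` E)" .
  qed
  moreover have "K > 0" using C(1) by (simp add: K_def add_pos_pos)
  ultimately show ?thesis by blast
qed

lemma conv_seq_limit_set: "conv_seq g a b \<Longrightarrow> a \<in> limit_set \<Gamma>"
proof -
  assume g: "conv_seq g a b"
  have "loc_unif_to_const dist (UNIV - {b}) g a"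
  proof (rule loc_unif_criterion)
    fix r :: "nat \<Rightarrow> nat" and w l assume "strict_mono r" "w \<longlonglongrightarrow> l" "l \<noteq> b"
    then have "(\<lambda>n. g (r (id n)) (w (id n))) \<longlonglongrightarrow> a"
      using conv_seqM[OF conv_seq_sub[OF g]] by simp
    then show "\<exists>r'. strict_mono r' \<and> (\<lambda>n. g (r (r' n)) (w (r' n))) \<longlonglongrightarrow> a"
      using strict_mono_id by blast
  qed
  moreover have "range g \<subseteq> \<Gamma>" using conv_seq_in[OF g] by blast
  ultimately show ?thesis unfolding limit_set_def by blast
qed

lemma limit_set_invariant: "\<gamma> \<in> \<Gamma> \<Longrightarrow> x \<in> limit_set \<Gamma> \<Longrightarrow> \<gamma> x \<in> limit_set \<Gamma>"
  using limit_set_conv_seq conv_seq_comp_left conv_seq_limit_set by blast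

text \<open>On a finite invariant set, convergence to \<open>x\<close> under a collapsing sequence
  is eventually equality, so one injective map would send two different limit points to
  \<open>x\<close>.\<close>

lemma infinite_limit_set: "infinite (limit_set \<Gamma>)"
proof
  assume fin: "finite (limit_set \<Gamma>)"
  obtain x where "x \<in> limit_set \<Gamma>" using ex_avoid2 by blast
  then obtain g b where g: "conv_seq g x b" using limit_set_conv_seq by blast
  obtain p where p: "p \<in> limit_set \<Gamma>" "p \<noteq> b" using ex_avoid2 by blast
  obtain q where q: "q \<in> limit_set \<Gamma>" "q \<noteq> b" "q \<noteq> p" using ex_avoid2 by blast
  have ev: "\<forall>\<^sub>F n in sequentially. g n z = x" if z: "z \<in> limit_set \<Gamma>" "z \<noteq> b" for z
  proof -
    have op: "open (- (limit_set \<Gamma> - {x}))"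
      by (rule open_Compl, rule finite_imp_closed) (use fin in simp)
    have "x \<in> - (limit_set \<Gamma> - {x})" by simp
    from topological_tendstoD[OF conv_seqM[OF g tendsto_const z(2)] op this] show ?thesis
      by eventually_elim (use limit_set_invariant[OF conv_seq_in[OF g] z(1)] in blast)
  qed
  from ev[OF p] ev[OF q(1,2)] have "\<forall>\<^sub>F n in sequentially. False"
  proof eventually_elim
    case (elim n)
    then show False using inj_iff_in[OF conv_seq_in[OF g], of n p q] q(3) by simp
  qed
  then show False by simp
qed

end

section \<open>Positive dimension, ergodicity and invariant null sets\<close>

context additive_magnitude
begin

text \<open>If \<open>\<delta> \<le> 0\<close>, the masses of the shadows are bounded below, so every limit point is an atom of mass
  bounded below.\<close>

lemma dimension_pos:
  assumes qc: "quasi_conformal \<mu> (\<lambda>\<gamma>. \<delta> * N \<gamma>)" and pos: "measure \<mu> UNIV > 0"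
  shows "\<delta> > 0"
proof (rule ccontr)
  assume "\<not> \<delta> > 0"
  then have \<delta>: "\<delta> \<le> 0" by simp
  interpret finite_measure \<mu> by (rule quasi_conformal_finite[OF qc])
  note sets = quasi_conformal_sets[OF qc]
  obtain e c where e: "e > 0" and c: "c > 0" "\<And>\<gamma>. \<gamma> \<in> \<Gamma> \<Longrightarrow> c \<le> measure \<mu> (big e \<gamma>)"
    using big_measure_lower_bound[OF qc pos] by blast
  obtain C where C: "C > 0"
      "\<And>\<gamma> E. \<gamma> \<in> \<Gamma> \<Longrightarrow> E \<in> sets borel \<Longrightarrow> E \<subseteq> big e \<gamma> \<Longrightarrow>
        exp (- (\<delta> * N \<gamma>)) * measure \<mu> E \<le> C * measure \<mu> (\<gamma> ` E)"
    using quasi_conformal_bounds[OF qc e] by metis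
  have atom: "c / C \<le> measure \<mu> {x}" if x: "x \<in> limit_set \<Gamma>" for x
  proof -
    obtain g b where g: "conv_seq g x b" using limit_set_conv_seq[OF x] by blast
    have ball: "c / C \<le> measure \<mu> (ball x (inverse (real (Suc k))))" for k
    proof -
      \<comment> \<open>Once \<open>inv (g n)\<close> is within \<open>e / 2\<close> of
        \<open>b\<close>, this neighbourhood is disjoint from \<open>big e (g n)\<close>, so the
        whole shadow falls into the ball about \<open>x\<close>.\<close>
      let ?U = "{z. d (Inr z) (Inr b) < e / 2}"
      have U: "open ?U" "b \<in> ?U" using e by (simp_all only: open_near Inr_X) simp
      have "\<forall>\<^sub>F n in sequentially. \<forall>z. z \<notin> ?U \<longrightarrow> g n z \<in> ball x (inverse (real (Suc k)))"
        by (rule conv_seq_unif[OF g U]) auto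
      moreover have "\<forall>\<^sub>F n in sequentially. 0 < N (g n)" by (rule conv_seq_N_unbounded[OF g])
      moreover have "\<forall>\<^sub>F n in sequentially. d (Inl (inv (g n))) (Inr b) < e / 2"
        using conv_seq_Inl_inv[OF g] e unfolding cvg_def by (intro order_tendstoD(2)) auto
      ultimately have "\<forall>\<^sub>F n in sequentially. c / C \<le> measure \<mu> (ball x (inverse (real (Suc k))))"
      proof eventually_elim
        case (elim n)
        have gn: "g n \<in> \<Gamma>" by (rule conv_seq_in[OF g])
        have "z \<notin> ?U" if "z \<in> big e (g n)" for z
        proof
          assume "z \<in> ?U"
          then have "d (Inr z) (Inl (inv (g n))) < e"
            using triangle[of "Inr z" "Inr b" "Inl (inv (g n))"] elim(3) gn
              commute[of "Inr b" "Inl (inv (g n))"] by simp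
          then show False using that by (simp add: big_def)
        qed
        then have sub: "shadow e (g n) \<subseteq> ball x (inverse (real (Suc k)))"
          using elim(1) unfolding shadow_def by blast
        have "1 \<le> exp (- (\<delta> * N (g n)))" using \<delta> elim(2) by (simp add: mult_nonpos_nonneg)
        then have "1 * c \<le> exp (- (\<delta> * N (g n))) * measure \<mu> (big e (g n))"
          using c gn by (intro mult_mono) auto
        also have "\<dots> \<le> C * measure \<mu> (shadow e (g n))"
          unfolding shadow_def by (rule C(2)[OF gn]) (use open_big[OF gn] in auto)
        also have "\<dots> \<le> C * measure \<mu> (ball x (inverse (real (Suc k))))"
          using C(1) sub sets by (intro mult_left_mono finite_measure_mono) auto
        finally show ?case using C(1) by (simp add: field_simps)
      qed
      then show ?thesis by simp
    qed
    let ?A = "\<lambda>k. ball x (inverse (real (Suc k)))"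
    have "decseq ?A"
      by (rule decseq_SucI, rule subset_ball) (simp add: field_simps)
    then have "(\<lambda>k. measure \<mu> (?A k)) \<longlonglongrightarrow> measure \<mu> (\<Inter>k. ?A k)"
      by (intro finite_Lim_measure_decseq) (auto simp: sets)
    moreover have "(\<Inter>k. ?A k) = {x}"
    proof (intro equalityI subsetI)
      fix z assume z: "z \<in> (\<Inter>k. ?A k)"
      show "z \<in> {x}"
      proof (rule ccontr)
        assume "z \<notin> {x}"
        then obtain k where "inverse (real (Suc k)) < dist x z" using reals_Archimedean[of "dist x z"] by auto
        moreover have "z \<in> ?A k" using z by blast
        ultimately show False by simp
      qed
    qed auto
    ultimately have "(\<lambda>k. measure \<mu> (?A k)) \<longlonglongrightarrow> measure \<mu> {x}" by simp
    then show ?thesis by (rule LIMSEQ_le_const) (use ball in blast)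
  qed
  obtain n :: nat where n: "measure \<mu> UNIV * C / c < real n" using reals_Archimedean2 by blast
  obtain T where T: "T \<subseteq> limit_set \<Gamma>" "finite T" "card T = n"
    using infinite_arbitrarily_large[OF infinite_limit_set] by blast
  have "real n * (c / C) = (\<Sum>x\<in>T. c / C)" using T by simp
  also have "\<dots> \<le> (\<Sum>x\<in>T. measure \<mu> {x})" by (intro sum_mono atom) (use T in auto)
  also have "\<dots> = measure \<mu> T"
    by (rule finite_measure_eq_sum_singleton[symmetric]) (use T sets in auto)
  also have "\<dots> \<le> measure \<mu> UNIV"
    by (rule finite_measure_mono) (auto simp: sets)
  finally show False using n C(1) c(1) by (simp add: field_simps)
qed

lemma countable_group: "countable \<Gamma>"
proof -
  have "\<Gamma> \<subseteq> (\<Union>n. sublevel (real n))"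
  proof
    fix \<gamma> assume \<gamma>: "\<gamma> \<in> \<Gamma>"
    obtain n where "N \<gamma> \<le> real n" using real_arch_simple by blast
    with \<gamma> have "\<gamma> \<in> sublevel (real n)" by (simp add: sublevel_def)
    then show "\<gamma> \<in> (\<Union>n. sublevel (real n))" by blast
  qed
  moreover have "countable (\<Union>n. sublevel (real n))" by (intro countable_UN) (auto intro: countable_finite)
  ultimately show ?thesis by (rule countable_subset)
qed

text \<open>Applying \<open>conical_pos\<close> to the restriction of \<mu> to \<open>A\<close>
  yields conical points of positive mass inside \<open>A\<close>, with a parameter depending on
  \<open>A\<close>. Zooming leaves \<open>A\<close> unchanged, so its complement is null away from
  \<open>b\<close>, and the restriction of \<mu> to the complement cannot live on one point.\<close>

lemma ergodic:
  assumes qc: "quasi_conformal \<mu> N"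
    and div: "\<And>B. \<exists>F\<subseteq>\<Gamma>. finite F \<and> B \<le> (\<Sum>\<gamma>\<in>F. exp (- N \<gamma>))"
    and A: "A \<in> sets borel" "\<forall>\<gamma>\<in>\<Gamma>. \<gamma> ` A = A" and pos: "measure \<mu> A > 0"
  shows "measure \<mu> (- A) = 0"
proof -
  interpret finite_measure \<mu> by (rule quasi_conformal_finite[OF qc])
  note sets = quasi_conformal_sets[OF qc]
  note rA = quasi_conformal_restrict[OF qc A]
  have "measure (density \<mu> (indicator A)) UNIV > 0" using rA(2)[of UNIV] pos by simp
  from conical_pos[OF rA(1) this div] obtain e where e: "e > 0" "0 < measure (density \<mu> (indicator A)) (conical e)"
    by blast
  then have "0 < measure \<mu> (A \<inter> conical e)" using rA(2)[OF conical_borel] by simp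
  from zoom[OF qc e(1) A(1) this] obtain g a b where g: "conv_seq g a b" and
    lim: "\<And>s. s > 0 \<Longrightarrow> (\<lambda>n. measure \<mu> ({x. s < d (Inr x) (Inr b)} - inv (g n) ` A)) \<longlonglongrightarrow> 0" by blast
  have invA: "inv (g n) ` A = A" for n using A(2) inv_in[OF conv_seq_in[OF g]] by blast
  have cA: "- A \<in> sets borel" using A(1) by auto
  have "measure \<mu> (- A \<inter> {x. s < d (Inr x) (Inr b)}) = 0" if "s > 0" for s
    using lim[OF that] unfolding invA by (simp add: LIMSEQ_const_iff Diff_eq Int_commute)
  from far_null[OF finite_measure_axioms sets cA _ this]
  have "measure \<mu> (- A \<inter> {x. Inr x \<noteq> (Inr b :: ('m \<Rightarrow> 'm) + 'm)}) = 0" by simp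
  then have 0: "measure \<mu> (- A \<inter> - {b}) = 0" by (simp add: Compl_eq)
  note rC = quasi_conformal_restrict[OF qc cA invariant_Compl[OF A(2)]]
  have "measure (density \<mu> (indicator (- A))) (- {b}) = 0" using rC(2)[of "- {b}"] 0 by simp
  from quasi_conformal_point[OF rC(1) this] show ?thesis using rC(2)[of UNIV] by simp
qed

text \<open>An invariant Lebesgue decomposition: \<open>B\<close> carries the part of
  \<open>\<mu>1\<close> singular to \<open>\<mu>2\<close>. A union of \<open>\<mu>2\<close>-null
  sets of nearly maximal \<open>\<mu>1\<close>-mass is saturated under \<Gamma>; it stays null
  because \<Gamma> is countable and each element preserves null sets.\<close>

lemma max_invariant_null_set:
  assumes qc1: "quasi_conformal \<mu>1 n1" and qc2: "quasi_conformal \<mu>2 n2"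
  obtains B where "B \<in> sets borel" "\<forall>\<gamma>\<in>\<Gamma>. \<gamma> ` B = B" "measure \<mu>2 B = 0"
    "\<And>F. F \<in> sets borel \<Longrightarrow> measure \<mu>2 F = 0 \<Longrightarrow> measure \<mu>1 (F - B) = 0"
proof -
  note goal = that
  interpret M1: finite_measure \<mu>1 by (rule quasi_conformal_finite[OF qc1])
  interpret M2: finite_measure \<mu>2 by (rule quasi_conformal_finite[OF qc2])
  note sets1 = quasi_conformal_sets[OF qc1] and sets2 = quasi_conformal_sets[OF qc2]
  define NN where "NN = {F \<in> sets (borel :: 'm measure). measure \<mu>2 F = 0}"
  have NN_null: "F \<in> NN \<longleftrightarrow> F \<in> null_sets \<mu>2" for F
    by (auto simp: NN_def null_sets_def sets2 M2.emeasure_eq_measure)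
  have NN_UN: "(\<Union>i\<in>I. F i) \<in> NN" if "countable I" "\<And>i. i \<in> I \<Longrightarrow> F i \<in> NN" for F and I :: "'i set"
    using that unfolding NN_null by (rule null_sets_UN')
  have NN_Un: "F \<union> G \<in> NN" if "F \<in> NN" "G \<in> NN" for F G
    using that unfolding NN_null by (rule null_sets.Un)
  have bdd: "bdd_above (measure \<mu>1 ` NN)"
    by (rule bdd_aboveI[of _ "measure \<mu>1 (space \<mu>1)"]) (auto simp: M1.bounded_measure)
  have ne: "NN \<noteq> {}" using NN_null by blast
  define s where "s = (SUP F\<in>NN. measure \<mu>1 F)"
  have le_s: "measure \<mu>1 F \<le> s" if "F \<in> NN" for F
    unfolding s_def by (rule cSUP_upper[OF that bdd])
  have "\<exists>F\<in>NN. s - inverse (real (Suc n)) < measure \<mu>1 F" for n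
    using less_cSUP_iff[OF ne bdd, of "s - inverse (real (Suc n))"] by (simp add: s_def[symmetric])
  then obtain F where F: "\<And>n. F n \<in> NN" "\<And>n. s - inverse (real (Suc n)) < measure \<mu>1 (F n)" by metis
  define B where "B = (\<Union>\<gamma>\<in>\<Gamma>. \<gamma> ` (\<Union>n. F n))"
  have B0: "(\<Union>n. F n) \<in> NN" by (rule NN_UN) (use F in auto)
  have "\<gamma> ` (\<Union>n. F n) \<in> NN" if \<gamma>: "\<gamma> \<in> \<Gamma>" for \<gamma>
  proof -
    obtain C where "measure \<mu>2 (\<gamma> ` (\<Union>n. F n)) \<le> C * measure \<mu>2 (\<Union>n. F n)"
      using quasi_conformal_element[OF qc2 \<gamma>] B0 unfolding NN_def by blast
    moreover have "measure \<mu>2 (\<Union>n. F n) = 0" using B0 by (simp add: NN_def)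
    ultimately have "measure \<mu>2 (\<gamma> ` (\<Union>n. F n)) \<le> 0" by simp
    then have "measure \<mu>2 (\<gamma> ` (\<Union>n. F n)) = 0" using measure_nonneg by (rule antisym)
    then show ?thesis using image_in_borel[OF \<gamma>] B0 by (simp add: NN_def)
  qed
  then have BN: "B \<in> NN" unfolding B_def by (rule NN_UN[OF countable_group])
  then have Bs: "B \<in> sets borel" by (simp add: NN_def)
  have sub: "\<gamma> ` B \<subseteq> B" if \<gamma>: "\<gamma> \<in> \<Gamma>" for \<gamma>
  proof
    fix x assume "x \<in> \<gamma> ` B"
    then obtain \<eta> y where "\<eta> \<in> \<Gamma>" "y \<in> (\<Union>n. F n)" "x = (\<gamma> \<circ> \<eta>) y" unfolding B_def by auto
    then show "x \<in> B" unfolding B_def using comp_in[OF \<gamma>] by blast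
  qed
  have inv: "\<gamma> ` B = B" if \<gamma>: "\<gamma> \<in> \<Gamma>" for \<gamma>
  proof (rule antisym[OF sub[OF \<gamma>]])
    show "B \<subseteq> \<gamma> ` B"
    proof
      fix x assume "x \<in> B"
      then have "inv \<gamma> x \<in> B" using sub[OF inv_in[OF \<gamma>]] by blast
      then have "\<gamma> (inv \<gamma> x) \<in> \<gamma> ` B" by (rule imageI)
      then show "x \<in> \<gamma> ` B" using inv_app(1)[OF \<gamma>] by simp
    qed
  qed
  have F0: "(\<Union>n. F n) \<subseteq> B" unfolding B_def using UN_upper[OF id_in, of "\<lambda>\<gamma>. \<gamma> ` (\<Union>n. F n)"] by simp
  have sB: "s \<le> measure \<mu>1 B"
  proof (rule field_le_epsilon)
    fix e :: real assume "e > 0"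
    then obtain n where "inverse (real (Suc n)) < e" using reals_Archimedean by blast
    moreover have "measure \<mu>1 (F n) \<le> measure \<mu>1 B"
      by (rule M1.finite_measure_mono) (use F0 Bs sets1 in auto)
    ultimately show "s \<le> measure \<mu>1 B + e" using F(2)[of n] by linarith
  qed
  show thesis
  proof (rule goal[OF Bs])
    show "\<forall>\<gamma>\<in>\<Gamma>. \<gamma> ` B = B" using inv by blast
    show "measure \<mu>2 B = 0" using BN by (simp add: NN_def)
    fix G assume G: "G \<in> sets borel" "measure \<mu>2 G = 0"
    then have "G \<union> B \<in> NN" by (intro NN_Un BN) (simp add: NN_def)
    then have "measure \<mu>1 (B \<union> (G - B)) \<le> s" using le_s[of "G \<union> B"] by (simp add: Un_commute)
    moreover have "measure \<mu>1 (B \<union> (G - B)) = measure \<mu>1 B + measure \<mu>1 (G - B)"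
      by (rule M1.finite_measure_Union) (use G Bs sets1 in auto)
    ultimately show "measure \<mu>1 (G - B) = 0" using sB measure_nonneg[of \<mu>1 "G - B"] by linarith
  qed
qed

end

section \<open>Comparison of equivalent measures\<close>

context compactified_group
begin

text \<open>Near \<open>b\<close> the bound is borrowed from elsewhere: an element
  \<open>\<eta>\<close> that moves \<open>b\<close> carries a neighbourhood of \<open>b\<close> into
  a far region and distorts both masses by bounded factors.\<close>

lemma comparable_glue:
  assumes qcm: "quasi_conformal \<mu> n1" and qcn: "quasi_conformal \<nu> n2"
    and far: "\<And>s. s > 0 \<Longrightarrow> \<exists>L>0. \<forall>F\<in>sets borel. F \<subseteq> {x. s < d (Inr x) (Inr b)} \<longrightarrow> measure \<nu> F \<le> L * measure \<mu> F"
  shows "\<exists>L>0. \<forall>F\<in>sets borel. measure \<nu> F \<le> L * measure \<mu> F"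
proof -
  interpret M: finite_measure \<mu> by (rule quasi_conformal_finite[OF qcm])
  interpret V: finite_measure \<nu> by (rule quasi_conformal_finite[OF qcn])
  note sm = quasi_conformal_sets[OF qcm] and sn = quasi_conformal_sets[OF qcn]
  let ?Q = "\<lambda>s. {x. s < d (Inr x) (Inr b)}"
  have Qs: "?Q s \<in> sets borel" for s by (intro borel_open open_far) simp
  obtain \<eta> where \<eta>: "\<eta> \<in> \<Gamma>" "\<eta> b \<noteq> b" using no_global_fixed_point by blast
  define s' where "s' = d (Inr (\<eta> b)) (Inr b) / 2"
  have s': "s' > 0"
    using zero[of "Inr (\<eta> b)" "Inr b"] nonneg[of "Inr (\<eta> b)" "Inr b"] \<eta>(2) by (simp add: s'_def less_le)
  have "\<exists>s>0. \<forall>x. \<not> s < d (Inr x) (Inr b) \<longrightarrow> \<eta> x \<in> ?Q s'"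
  proof (rule ccontr)
    assume contr: "\<not> ?thesis"
    have "\<forall>n. \<exists>x. \<not> inverse (real (Suc n)) < d (Inr x) (Inr b) \<and> \<eta> x \<notin> ?Q s'"
    proof
      fix n
      have "inverse (real (Suc n)) > 0" by simp
      with contr show "\<exists>x. \<not> inverse (real (Suc n)) < d (Inr x) (Inr b) \<and> \<eta> x \<notin> ?Q s'" by blast
    qed
    then obtain x where x: "\<And>n. \<not> inverse (real (Suc n)) < d (Inr (x n)) (Inr b)" "\<And>n. \<eta> (x n) \<notin> ?Q s'"
      by metis
    have c: "cvg (\<lambda>n. Inr (x n)) (Inr b)"
      unfolding cvg_def
      by (rule tendsto_sandwich[OF _ _ tendsto_const LIMSEQ_inverse_real_of_nat])
         (use x(1) in \<open>auto simp: not_less\<close>)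
    have "cvg (\<lambda>n. act \<eta> (Inr (x n))) (act \<eta> (Inr b))" by (rule cvg_act[OF \<eta>(1) c]) auto
    then have "cvg (\<lambda>n. Inr (\<eta> (x n))) (Inr (\<eta> b))" by simp
    then have "(\<lambda>n. d (Inr (\<eta> (x n))) (Inr b)) \<longlonglongrightarrow> d (Inr (\<eta> b)) (Inr b)"
      by (intro d_cvg cvg_const) auto
    then have "d (Inr (\<eta> b)) (Inr b) \<le> s'"
      by (rule LIMSEQ_le_const2) (use x(2) in \<open>auto simp: not_less\<close>)
    then show False using s' unfolding s'_def by linarith
  qed
  then obtain s where s: "s > 0" "\<And>x. \<not> s < d (Inr x) (Inr b) \<Longrightarrow> \<eta> x \<in> ?Q s'" by blast
  obtain L where L: "L > 0" "\<And>F. F \<in> sets borel \<Longrightarrow> F \<subseteq> ?Q s \<Longrightarrow> measure \<nu> F \<le> L * measure \<mu> F"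
    using far[OF s(1)] by blast
  obtain L' where L': "L' > 0" "\<And>F. F \<in> sets borel \<Longrightarrow> F \<subseteq> ?Q s' \<Longrightarrow> measure \<nu> F \<le> L' * measure \<mu> F"
    using far[OF s'] by blast
  obtain C1 where C1: "C1 > 0" "\<And>E. E \<in> sets borel \<Longrightarrow> measure \<mu> (\<eta> ` E) \<le> C1 * measure \<mu> E"
    using quasi_conformal_element[OF qcm \<eta>(1)] by blast
  obtain C2 where C2: "C2 > 0" "\<And>E. E \<in> sets borel \<Longrightarrow> measure \<nu> E \<le> C2 * measure \<nu> (\<eta> ` E)"
    using quasi_conformal_element[OF qcn \<eta>(1)] by blast
  have "measure \<nu> F \<le> (L + C2 * L' * C1) * measure \<mu> F" if F: "F \<in> sets borel" for F
  proof -
    have F1: "F \<inter> ?Q s \<in> sets borel" and F2: "F - ?Q s \<in> sets borel" using F Qs[of s] by auto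
    have sub: "\<eta> ` (F - ?Q s) \<subseteq> ?Q s'" using s(2) by blast
    have "measure \<nu> (F - ?Q s) \<le> C2 * measure \<nu> (\<eta> ` (F - ?Q s))" by (rule C2(2)[OF F2])
    also have "\<dots> \<le> C2 * (L' * measure \<mu> (\<eta> ` (F - ?Q s)))"
      using L'(2)[OF image_in_borel[OF \<eta>(1) F2] sub] C2(1) by (intro mult_left_mono) auto
    also have "\<dots> \<le> C2 * (L' * (C1 * measure \<mu> (F - ?Q s)))"
      using C1(2)[OF F2] C2(1) L'(1) by (intro mult_left_mono) auto
    also have "\<dots> \<le> C2 * (L' * (C1 * measure \<mu> F))"
      using C2(1) L'(1) C1(1) F sm by (intro mult_left_mono M.finite_measure_mono) auto
    finally have 1: "measure \<nu> (F - ?Q s) \<le> C2 * L' * C1 * measure \<mu> F" by (simp add: mult.assoc)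
    have "measure \<nu> (F \<inter> ?Q s) \<le> L * measure \<mu> (F \<inter> ?Q s)" by (rule L(2)[OF F1]) blast
    also have "\<dots> \<le> L * measure \<mu> F"
      using L(1) F sm by (intro mult_left_mono M.finite_measure_mono) auto
    finally have 2: "measure \<nu> (F \<inter> ?Q s) \<le> L * measure \<mu> F" .
    have "measure \<nu> ((F \<inter> ?Q s) \<union> (F - ?Q s)) \<le> measure \<nu> (F \<inter> ?Q s) + measure \<nu> (F - ?Q s)"
      by (rule measure_Un_le) (use F1 F2 sn in auto)
    also have "(F \<inter> ?Q s) \<union> (F - ?Q s) = F" by blast
    finally show ?thesis using 1 2 by (simp add: distrib_right)
  qed
  moreover have "L + C2 * L' * C1 > 0" using L(1) L'(1) C1(1) C2(1) by (intro add_pos_pos mult_pos_pos)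
  ultimately show ?thesis by blast
qed

text \<open>The two measures give the shadow of \<open>\<gamma>\<close> about
  \<open>exp (- n1 \<gamma>)\<close> and \<open>exp (- n2 \<gamma>)\<close> times their mass of
  \<open>big e \<gamma>\<close>, and they are comparable on either set. The lower bound on the mass
  of \<open>big e \<gamma>\<close> permits cancelling it; \<open>D\<close> collects two distortion
  constants and two uses of \<open>L\<close>.\<close>

lemma comparable_magnitude:
  assumes qcm: "quasi_conformal \<mu> n1" and qcn: "quasi_conformal \<nu> n2" and pos: "measure \<mu> UNIV > 0"
    and L: "L > 0" "\<And>F. F \<in> sets borel \<Longrightarrow> measure \<nu> F \<le> L * measure \<mu> F"
      "\<And>F. F \<in> sets borel \<Longrightarrow> measure \<mu> F \<le> L * measure \<nu> F"
  shows "\<exists>K. \<forall>\<gamma>\<in>\<Gamma>. \<bar>n1 \<gamma> - n2 \<gamma>\<bar> \<le> K"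
proof -
  obtain e c where e: "e > 0" and c: "c > 0" "\<And>\<gamma>. \<gamma> \<in> \<Gamma> \<Longrightarrow> c \<le> measure \<mu> (big e \<gamma>)"
    using big_measure_lower_bound[OF qcm pos] by blast
  obtain C1 where C1: "C1 > 0"
      "\<And>\<gamma> E. \<gamma> \<in> \<Gamma> \<Longrightarrow> E \<in> sets borel \<Longrightarrow> E \<subseteq> big e \<gamma> \<Longrightarrow>
        measure \<mu> (\<gamma> ` E) \<le> C1 * exp (- n1 \<gamma>) * measure \<mu> E"
      "\<And>\<gamma> E. \<gamma> \<in> \<Gamma> \<Longrightarrow> E \<in> sets borel \<Longrightarrow> E \<subseteq> big e \<gamma> \<Longrightarrow>
        exp (- n1 \<gamma>) * measure \<mu> E \<le> C1 * measure \<mu> (\<gamma> ` E)"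
    using quasi_conformal_bounds[OF qcm e] by metis
  obtain C2 where C2: "C2 > 0"
      "\<And>\<gamma> E. \<gamma> \<in> \<Gamma> \<Longrightarrow> E \<in> sets borel \<Longrightarrow> E \<subseteq> big e \<gamma> \<Longrightarrow>
        measure \<nu> (\<gamma> ` E) \<le> C2 * exp (- n2 \<gamma>) * measure \<nu> E"
      "\<And>\<gamma> E. \<gamma> \<in> \<Gamma> \<Longrightarrow> E \<in> sets borel \<Longrightarrow> E \<subseteq> big e \<gamma> \<Longrightarrow>
        exp (- n2 \<gamma>) * measure \<nu> E \<le> C2 * measure \<nu> (\<gamma> ` E)"
    using quasi_conformal_bounds[OF qcn e] by metis
  define D where "D = C1 * C2 * L * L"
  have D: "D > 0" using C1 C2 L by (simp add: D_def)
  have "\<bar>n1 \<gamma> - n2 \<gamma>\<bar> \<le> ln D" if \<gamma>: "\<gamma> \<in> \<Gamma>" for \<gamma>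
  proof -
    let ?F = "big e \<gamma>"
    have F: "?F \<in> sets borel" using open_big[OF \<gamma>] by simp
    have gF: "\<gamma> ` ?F \<in> sets borel" by (rule image_in_borel[OF \<gamma> F])
    have mF: "measure \<mu> ?F > 0" using c(1) c(2)[OF \<gamma>] by linarith
    then have "0 < L * measure \<nu> ?F" using L(3)[OF F] by linarith
    then have nF: "measure \<nu> ?F > 0" using L(1) zero_less_mult_pos by blast
    have "exp (- n2 \<gamma>) * measure \<nu> ?F \<le> C2 * measure \<nu> (\<gamma> ` ?F)" by (rule C2(3)[OF \<gamma> F order_refl])
    also have "\<dots> \<le> C2 * (L * measure \<mu> (\<gamma> ` ?F))"
      using L(2)[OF gF] C2(1) by (intro mult_left_mono) auto
    also have "\<dots> \<le> C2 * (L * (C1 * exp (- n1 \<gamma>) * measure \<mu> ?F))"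
      using C1(2)[OF \<gamma> F order_refl] C2(1) L(1) by (intro mult_left_mono) auto
    also have "\<dots> \<le> C2 * (L * (C1 * exp (- n1 \<gamma>) * (L * measure \<nu> ?F)))"
      using L(3)[OF F] C2(1) L(1) C1(1) by (intro mult_left_mono) auto
    also have "\<dots> = D * exp (- n1 \<gamma>) * measure \<nu> ?F" by (simp only: D_def mult_ac)
    finally have "exp (- n2 \<gamma>) \<le> D * exp (- n1 \<gamma>)" using nF by simp
    also have "\<dots> = exp (ln D + - n1 \<gamma>)" unfolding exp_add using D by simp
    finally have 1: "- n2 \<gamma> \<le> ln D - n1 \<gamma>" by simp
    have "exp (- n1 \<gamma>) * measure \<mu> ?F \<le> C1 * measure \<mu> (\<gamma> ` ?F)" by (rule C1(3)[OF \<gamma> F order_refl])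
    also have "\<dots> \<le> C1 * (L * measure \<nu> (\<gamma> ` ?F))"
      using L(3)[OF gF] C1(1) by (intro mult_left_mono) auto
    also have "\<dots> \<le> C1 * (L * (C2 * exp (- n2 \<gamma>) * measure \<nu> ?F))"
      using C2(2)[OF \<gamma> F order_refl] C1(1) L(1) by (intro mult_left_mono) auto
    also have "\<dots> \<le> C1 * (L * (C2 * exp (- n2 \<gamma>) * (L * measure \<mu> ?F)))"
      using L(2)[OF F] C2(1) L(1) C1(1) by (intro mult_left_mono) auto
    also have "\<dots> = D * exp (- n2 \<gamma>) * measure \<mu> ?F" by (simp only: D_def mult_ac)
    finally have "exp (- n1 \<gamma>) \<le> D * exp (- n2 \<gamma>)" using mF by simp
    also have "\<dots> = exp (ln D + - n2 \<gamma>)" unfolding exp_add using D by simp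
    finally have "- n1 \<gamma> \<le> ln D - n2 \<gamma>" by simp
    with 1 show ?thesis by linarith
  qed
  then show ?thesis by blast
qed

lemma exists_far_pos:
  assumes qc: "quasi_conformal \<mu> n" and pos: "measure \<mu> UNIV > 0"
  shows "\<exists>s>0. 0 < measure \<mu> {x. s < d (Inr x) (Inr b)}"
proof (rule ccontr)
  assume "\<not> ?thesis"
  then have "\<And>s. s > 0 \<Longrightarrow> measure \<mu> {x. s < d (Inr x) (Inr b)} = 0"
    by (metis measure_nonneg order_le_less)
  then have "measure \<mu> (UNIV \<inter> {x. Inr x \<noteq> (Inr b :: ('m \<Rightarrow> 'm) + 'm)}) = 0"
    by (intro far_null[OF quasi_conformal_finite[OF qc] quasi_conformal_sets[OF qc]]) auto
  then have "measure \<mu> (- {b}) = 0" by (simp add: Compl_eq)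
  from quasi_conformal_point[OF qc this] show False using pos by simp
qed

text \<open>A bound on \<open>E\<close> is transported to its preimages: pass to the image under
  \<open>g n\<close>, compare there and return. The two changes of measure leave an exponential
  factor that is not yet known to be bounded.\<close>

lemma zoom_comparison:
  assumes qcm: "quasi_conformal \<mu> n1" and qcn: "quasi_conformal \<nu> n2"
    and E: "E \<in> sets borel" "L > 0"
      "\<And>F. F \<in> sets borel \<Longrightarrow> F \<subseteq> E \<Longrightarrow> measure \<mu> F \<le> L * measure \<nu> F"
    and c: "conv_seq g a b" and s: "s > 0"
  shows "\<exists>M>0. \<forall>\<^sub>F n in sequentially. \<forall>F\<in>sets borel. F \<subseteq> {x. s < d (Inr x) (Inr b)} \<inter> inv (g n) ` E \<longrightarrow>
    measure \<mu> F \<le> M * exp (n1 (g n) - n2 (g n)) * measure \<nu> F"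
proof -
  have s2: "s / 2 > 0" using s by simp
  obtain C1 where C1: "C1 > 0"
      "\<And>\<gamma> E. \<gamma> \<in> \<Gamma> \<Longrightarrow> E \<in> sets borel \<Longrightarrow> E \<subseteq> big (s / 2) \<gamma> \<Longrightarrow>
        exp (- n1 \<gamma>) * measure \<mu> E \<le> C1 * measure \<mu> (\<gamma> ` E)"
    using quasi_conformal_bounds[OF qcm s2] by metis
  obtain C2 where C2: "C2 > 0"
      "\<And>\<gamma> E. \<gamma> \<in> \<Gamma> \<Longrightarrow> E \<in> sets borel \<Longrightarrow> E \<subseteq> big (s / 2) \<gamma> \<Longrightarrow>
        measure \<nu> (\<gamma> ` E) \<le> C2 * exp (- n2 \<gamma>) * measure \<nu> E"
    using quasi_conformal_bounds[OF qcn s2] by metis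
  have gG: "g n \<in> \<Gamma>" for n by (rule conv_seq_in[OF c])
  have "\<forall>\<^sub>F n in sequentially. {x. s < d (Inr x) (Inr b)} \<subseteq> big (s / 2) (g n)"
    by (rule far_subset_big[OF conv_seq_Inl_inv[OF c] gG]) (use s in auto)
  then have "\<forall>\<^sub>F n in sequentially. \<forall>F\<in>sets borel. F \<subseteq> {x. s < d (Inr x) (Inr b)} \<inter> inv (g n) ` E \<longrightarrow>
    measure \<mu> F \<le> (C1 * L * C2) * exp (n1 (g n) - n2 (g n)) * measure \<nu> F"
  proof eventually_elim
    case (elim n)
    show ?case
    proof (intro ballI impI)
      fix F :: "'m set" assume F: "F \<in> sets borel" and sub: "F \<subseteq> {x. s < d (Inr x) (Inr b)} \<inter> inv (g n) ` E"
      have Fb: "F \<subseteq> big (s / 2) (g n)" using sub elim by blast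
      have gF: "g n ` F \<in> sets borel" by (rule image_in_borel[OF gG F])
      have gE: "g n ` F \<subseteq> E"
      proof
        fix y assume "y \<in> g n ` F"
        then obtain z where "z \<in> E" "y = g n (inv (g n) z)" using sub by blast
        then show "y \<in> E" using gG by simp
      qed
      have "measure \<mu> F = exp (n1 (g n)) * (exp (- n1 (g n)) * measure \<mu> F)" by (simp add: exp_minus)
      also have "\<dots> \<le> exp (n1 (g n)) * (C1 * measure \<mu> (g n ` F))"
        using C1(2)[OF gG F Fb] by (rule mult_left_mono) simp
      also have "\<dots> \<le> exp (n1 (g n)) * (C1 * (L * measure \<nu> (g n ` F)))"
        using E(3)[OF gF gE] C1(1) by (intro mult_left_mono) auto
      also have "\<dots> \<le> exp (n1 (g n)) * (C1 * (L * (C2 * exp (- n2 (g n)) * measure \<nu> F)))"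
        using C2(2)[OF gG F Fb] C1(1) E(2) by (intro mult_left_mono) auto
      also have "\<dots> = (C1 * L * C2) * (exp (n1 (g n)) * exp (- n2 (g n))) * measure \<nu> F"
        by (simp only: mult_ac)
      also have "exp (n1 (g n)) * exp (- n2 (g n)) = exp (n1 (g n) - n2 (g n))"
        by (simp add: exp_diff exp_minus divide_inverse)
      finally show "measure \<mu> F \<le> (C1 * L * C2) * exp (n1 (g n) - n2 (g n)) * measure \<nu> F" .
    qed
  qed
  moreover have "C1 * L * C2 > 0" using C1(1) C2(1) E(2) by simp
  ultimately show ?thesis by blast
qed

text \<open>Otherwise \<open>\<mu>\<close> would vanish away from \<open>b\<close>.\<close>

lemma zoom_factor_bounded:
  assumes qcm: "quasi_conformal \<mu> n1" and qcn: "quasi_conformal \<nu> n2" and pos: "measure \<mu> UNIV > 0"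
    and E: "E \<in> sets borel" "L > 0"
      "\<And>F. F \<in> sets borel \<Longrightarrow> F \<subseteq> E \<Longrightarrow> measure \<mu> F \<le> L * measure \<nu> F"
    and c: "conv_seq g a b"
    and lim: "\<And>s. s > 0 \<Longrightarrow> (\<lambda>n. measure \<mu> ({x. s < d (Inr x) (Inr b)} - inv (g n) ` E)) \<longlonglongrightarrow> 0"
  shows "\<exists>h. \<forall>\<^sub>F n in sequentially. n2 (g n) - n1 (g n) \<le> h"
proof -
  interpret M: finite_measure \<mu> by (rule quasi_conformal_finite[OF qcm])
  interpret V: finite_measure \<nu> by (rule quasi_conformal_finite[OF qcn])
  note sm = quasi_conformal_sets[OF qcm] and sn = quasi_conformal_sets[OF qcn]
  obtain s where s: "s > 0" "0 < measure \<mu> {x. s < d (Inr x) (Inr b)}"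
    using exists_far_pos[OF qcm pos] by blast
  let ?Q = "{x. s < d (Inr x) (Inr b)}"
  have Qs: "?Q \<in> sets borel" by (intro borel_open open_far) simp
  obtain M where M: "M > 0" "\<forall>\<^sub>F n in sequentially. \<forall>F\<in>sets borel. F \<subseteq> ?Q \<inter> inv (g n) ` E \<longrightarrow>
    measure \<mu> F \<le> M * exp (n1 (g n) - n2 (g n)) * measure \<nu> F"
    using zoom_comparison[OF qcm qcn E c s(1)] by blast
  \<comment> \<open>The added \<open>1\<close> makes \<open>V\<close> positive without an appeal to
    \<nu> being nonzero, as the logarithm below requires.\<close>
  define V where "V = measure \<nu> UNIV + 1"
  have V: "V > 0" by (simp add: V_def add_nonneg_pos)
  have "\<forall>\<^sub>F n in sequentially. measure \<mu> (?Q - inv (g n) ` E) < measure \<mu> ?Q / 2"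
    by (rule order_tendstoD(2)[OF lim[OF s(1)]]) (use s(2) in simp)
  with M(2) have "\<forall>\<^sub>F n in sequentially. n2 (g n) - n1 (g n) \<le> ln (2 * M * V / measure \<mu> ?Q)"
  proof eventually_elim
    case (elim n)
    have P: "inv (g n) ` E \<in> sets borel" by (rule image_in_borel[OF inv_in[OF conv_seq_in[OF c]] E(1)])
    have "measure \<mu> ((?Q \<inter> inv (g n) ` E) \<union> (?Q - inv (g n) ` E)) \<le>
        measure \<mu> (?Q \<inter> inv (g n) ` E) + measure \<mu> (?Q - inv (g n) ` E)"
      by (rule measure_Un_le) (use P Qs sm in auto)
    also have "(?Q \<inter> inv (g n) ` E) \<union> (?Q - inv (g n) ` E) = ?Q" by blast
    finally have "measure \<mu> ?Q / 2 \<le> measure \<mu> (?Q \<inter> inv (g n) ` E)" using elim(2) by linarith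
    also have "\<dots> \<le> M * exp (n1 (g n) - n2 (g n)) * measure \<nu> (?Q \<inter> inv (g n) ` E)"
      using elim(1) P Qs by blast
    also have "\<dots> \<le> M * exp (n1 (g n) - n2 (g n)) * V"
    proof (rule mult_left_mono)
      have "measure \<nu> (?Q \<inter> inv (g n) ` E) \<le> measure \<nu> UNIV"
        by (rule V.finite_measure_mono) (auto simp: sn)
      then show "measure \<nu> (?Q \<inter> inv (g n) ` E) \<le> V" by (simp add: V_def)
    qed (use M(1) in simp)
    finally have le: "measure \<mu> ?Q / 2 \<le> M * exp (n1 (g n) - n2 (g n)) * V" .
    have "exp (n2 (g n) - n1 (g n)) * (measure \<mu> ?Q / 2) \<le>
        exp (n2 (g n) - n1 (g n)) * (M * exp (n1 (g n) - n2 (g n)) * V)"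
      using le by (rule mult_left_mono) simp
    also have "\<dots> = (exp (n2 (g n) - n1 (g n)) * exp (n1 (g n) - n2 (g n))) * (M * V)" by (simp only: mult_ac)
    also have "exp (n2 (g n) - n1 (g n)) * exp (n1 (g n) - n2 (g n)) = 1" by (simp flip: exp_add)
    finally have "exp (n2 (g n) - n1 (g n)) \<le> 2 * M * V / measure \<mu> ?Q"
      using s(2) by (simp add: field_simps)
    then show ?case using M(1) V s(2) by (subst ln_ge_iff) auto
  qed
  then show ?thesis by blast
qed

text \<open>Away from \<open>b\<close>, a Borel set differs from its intersections with the
  preimages of \<open>E\<close> by a mass tending to zero. With the exponential factor bounded, the
  transported comparison passes to the limit.\<close>

lemma zoom_far_comparable:
  assumes qcm: "quasi_conformal \<mu> n1" and qcn: "quasi_conformal \<nu> n2"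
    and E: "E \<in> sets borel" "L > 0"
      "\<And>F. F \<in> sets borel \<Longrightarrow> F \<subseteq> E \<Longrightarrow> measure \<mu> F \<le> L * measure \<nu> F"
    and c: "conv_seq g a b"
    and lim: "\<And>s. s > 0 \<Longrightarrow> (\<lambda>n. measure \<mu> ({x. s < d (Inr x) (Inr b)} - inv (g n) ` E)) \<longlonglongrightarrow> 0"
    and h: "\<forall>\<^sub>F n in sequentially. n1 (g n) - n2 (g n) \<le> h"
    and s: "s > 0"
  shows "\<exists>K>0. \<forall>F\<in>sets borel. F \<subseteq> {x. s < d (Inr x) (Inr b)} \<longrightarrow> measure \<mu> F \<le> K * measure \<nu> F"
proof -
  interpret M: finite_measure \<mu> by (rule quasi_conformal_finite[OF qcm])
  interpret V: finite_measure \<nu> by (rule quasi_conformal_finite[OF qcn])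
  note sm = quasi_conformal_sets[OF qcm] and sn = quasi_conformal_sets[OF qcn]
  let ?Q = "{x. s < d (Inr x) (Inr b)}"
  have Qs: "?Q \<in> sets borel" by (intro borel_open open_far) simp
  obtain M where M: "M > 0" "\<forall>\<^sub>F n in sequentially. \<forall>F\<in>sets borel. F \<subseteq> ?Q \<inter> inv (g n) ` E \<longrightarrow>
    measure \<mu> F \<le> M * exp (n1 (g n) - n2 (g n)) * measure \<nu> F"
    using zoom_comparison[OF qcm qcn E c s] by blast
  have "measure \<mu> F \<le> M * exp h * measure \<nu> F" if F: "F \<in> sets borel" "F \<subseteq> ?Q" for F
  proof (rule tendsto_lowerbound)
    show "(\<lambda>n. M * exp h * measure \<nu> F + measure \<mu> (?Q - inv (g n) ` E)) \<longlonglongrightarrow> M * exp h * measure \<nu> F"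
      using tendsto_add[OF tendsto_const lim[OF s]] by simp
    from M(2) h
    show "\<forall>\<^sub>F n in sequentially. measure \<mu> F \<le> M * exp h * measure \<nu> F + measure \<mu> (?Q - inv (g n) ` E)"
    proof eventually_elim
      case (elim n)
      have P: "inv (g n) ` E \<in> sets borel" by (rule image_in_borel[OF inv_in[OF conv_seq_in[OF c]] E(1)])
      have "measure \<mu> ((F \<inter> inv (g n) ` E) \<union> (F - inv (g n) ` E)) \<le>
          measure \<mu> (F \<inter> inv (g n) ` E) + measure \<mu> (F - inv (g n) ` E)"
        by (rule measure_Un_le) (use P F sm in auto)
      also have "(F \<inter> inv (g n) ` E) \<union> (F - inv (g n) ` E) = F" by blast
      also have "measure \<mu> (F - inv (g n) ` E) \<le> measure \<mu> (?Q - inv (g n) ` E)"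
        by (rule M.finite_measure_mono) (use F P Qs sm in auto)
      also have "measure \<mu> (F \<inter> inv (g n) ` E) \<le> M * exp (n1 (g n) - n2 (g n)) * measure \<nu> (F \<inter> inv (g n) ` E)"
      proof -
        have "F \<inter> inv (g n) ` E \<in> sets borel" "F \<inter> inv (g n) ` E \<subseteq> ?Q \<inter> inv (g n) ` E"
          using F P by auto
        then show ?thesis using elim(1) by blast
      qed
      also have "\<dots> \<le> M * exp h * measure \<nu> F"
        using M(1) elim(2) F P sn by (intro mult_mono V.finite_measure_mono) auto
      finally show ?case by simp
    qed
  qed simp
  moreover have "M * exp h > 0" using M(1) by simp
  ultimately show ?thesis by blast
qed

end

context additive_magnitude
begin

text \<open>Divergence is assumed for \<open>N\<close> only, so the zoom comes from \<mu> and must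
  be made to serve \<nu> as well. On \<open>E k\<close> each measure bounds the other, so
  \<open>N - n2\<close> is bounded from both sides along the zoom; this spreads the comparison from
  \<open>E k\<close> to all Borel sets.\<close>

lemma equivalent_magnitudes:
  assumes qcm: "quasi_conformal \<mu> N" and qcn: "quasi_conformal \<nu> n2"
    and div: "\<And>B. \<exists>F\<subseteq>\<Gamma>. finite F \<and> B \<le> (\<Sum>\<gamma>\<in>F. exp (- N \<gamma>))"
    and pos: "measure \<mu> UNIV > 0"
    and null: "\<And>F. F \<in> sets borel \<Longrightarrow> measure \<mu> F = 0 \<longleftrightarrow> measure \<nu> F = 0"
  shows "\<exists>K. \<forall>\<gamma>\<in>\<Gamma>. \<bar>N \<gamma> - n2 \<gamma>\<bar> \<le> K"
proof -
  interpret M: finite_measure \<mu> by (rule quasi_conformal_finite[OF qcm])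
  interpret V: finite_measure \<nu> by (rule quasi_conformal_finite[OF qcn])
  note sm = quasi_conformal_sets[OF qcm] and sn = quasi_conformal_sets[OF qcn]
  have spm: "space \<mu> = UNIV" and spn: "space \<nu> = UNIV"
    using sets_eq_imp_space_eq[OF sm] sets_eq_imp_space_eq[OF sn] by auto
  have posn: "measure \<nu> UNIV > 0"
    using null[of UNIV] pos measure_nonneg[of \<nu> UNIV] by (simp add: less_le)
  obtain E :: "nat \<Rightarrow> 'm set" where E: "\<And>k. E k \<in> sets borel"
    "\<And>k F. F \<in> sets borel \<Longrightarrow> F \<subseteq> E k \<Longrightarrow> measure \<mu> F \<le> real (Suc k) * measure \<nu> F"
    "\<And>k F. F \<in> sets borel \<Longrightarrow> F \<subseteq> E k \<Longrightarrow> measure \<nu> F \<le> real (Suc k) * measure \<mu> F"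
    "(\<lambda>k. measure \<mu> (- E k)) \<longlonglongrightarrow> 0" "(\<lambda>k. measure \<nu> (- E k)) \<longlonglongrightarrow> 0"
  proof (rule comparable_exhaustion[OF M.finite_measure_axioms V.finite_measure_axioms])
    show "sets \<nu> = sets \<mu>" using sm sn by simp
  qed (use null that in \<open>auto simp: sm sn spm spn Compl_eq_Diff_UNIV\<close>)
  obtain e where e: "e > 0" "0 < measure \<mu> (conical e)" using conical_pos[OF qcm pos div] by blast
  have "\<forall>\<^sub>F k in sequentially. measure \<mu> (- E k) < measure \<mu> (conical e)"
    by (rule order_tendstoD(2)[OF E(4) e(2)])
  then obtain k where k: "measure \<mu> (- E k) < measure \<mu> (conical e)" by (auto simp: eventually_sequentially)
  have "measure \<mu> (conical e) \<le> measure \<mu> ((E k \<inter> conical e) \<union> - E k)"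
    by (rule M.finite_measure_mono) (use E(1)[of k] conical_borel sm in auto)
  also have "\<dots> \<le> measure \<mu> (E k \<inter> conical e) + measure \<mu> (- E k)"
    by (rule measure_Un_le) (use E(1)[of k] conical_borel sm in auto)
  finally have "0 < measure \<mu> (E k \<inter> conical e)" using k by linarith
  from zoom[OF qcm e(1) E(1) this] obtain g a b where c: "conv_seq g a b" and
    lim: "\<And>s. s > 0 \<Longrightarrow> (\<lambda>n. measure \<mu> ({x. s < d (Inr x) (Inr b)} - inv (g n) ` E k)) \<longlonglongrightarrow> 0" by blast
  \<comment> \<open>The same sequence zooms for \<nu>: inside \<open>E j\<close> the \<nu>-mass of
    the defect is at most \<open>Suc j\<close> times its \<mu>-mass, and outside \<open>E j\<close>
    it is small for large \<open>j\<close>.\<close>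
  have limn: "(\<lambda>n. measure \<nu> ({x. s < d (Inr x) (Inr b)} - inv (g n) ` E k)) \<longlonglongrightarrow> 0" if s: "s > 0" for s
  proof (rule tendstoI)
    fix \<epsilon> :: real assume \<epsilon>: "\<epsilon> > 0"
    let ?D = "\<lambda>n. {x. s < d (Inr x) (Inr b)} - inv (g n) ` E k"
    have D: "?D n \<in> sets borel" for n
      by (rule sets.Diff[OF borel_open[OF open_far] image_in_borel[OF inv_in[OF conv_seq_in[OF c]] E(1)]]) simp
    have "\<epsilon> / 2 > 0" using \<epsilon> by simp
    from order_tendstoD(2)[OF E(5) this] obtain j where j: "measure \<nu> (- E j) < \<epsilon> / 2"
      by (auto simp: eventually_sequentially)
    have "\<epsilon> / 2 / real (Suc j) > 0" using \<epsilon> by simp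
    from order_tendstoD(2)[OF lim[OF s] this]
    show "\<forall>\<^sub>F n in sequentially. dist (measure \<nu> (?D n)) 0 < \<epsilon>"
    proof eventually_elim
      case (elim n)
      have "measure \<nu> (?D n) \<le> measure \<nu> ((?D n \<inter> E j) \<union> - E j)"
        by (rule V.finite_measure_mono) (use D[of n] E(1)[of j] sn in auto)
      also have "\<dots> \<le> measure \<nu> (?D n \<inter> E j) + measure \<nu> (- E j)"
        by (rule measure_Un_le) (use D[of n] E(1)[of j] sn in auto)
      also have "measure \<nu> (?D n \<inter> E j) \<le> real (Suc j) * measure \<mu> (?D n \<inter> E j)"
        by (rule E(3)) (use D[of n] E(1)[of j] in auto)
      also have "\<dots> \<le> real (Suc j) * measure \<mu> (?D n)"
        by (intro mult_left_mono M.finite_measure_mono) (use D[of n] sm in auto)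
      also have "real (Suc j) * measure \<mu> (?D n) < \<epsilon> / 2" using elim by (simp add: field_simps)
      finally show ?case using j by simp
    qed
  qed
  have Lk: "real (Suc k) > 0" by simp
  obtain h1 where h1: "\<forall>\<^sub>F n in sequentially. n2 (g n) - N (g n) \<le> h1"
    using zoom_factor_bounded[OF qcm qcn pos E(1) Lk E(2) c lim] by blast
  obtain h2 where h2: "\<forall>\<^sub>F n in sequentially. N (g n) - n2 (g n) \<le> h2"
    using zoom_factor_bounded[OF qcn qcm posn E(1) Lk E(3) c limn] by blast
  obtain L1 where L1: "L1 > 0" "\<And>F. F \<in> sets borel \<Longrightarrow> measure \<mu> F \<le> L1 * measure \<nu> F"
    using comparable_glue[OF qcn qcm zoom_far_comparable[OF qcm qcn E(1) Lk E(2) c lim h2]] by blast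
  obtain L2 where L2: "L2 > 0" "\<And>F. F \<in> sets borel \<Longrightarrow> measure \<nu> F \<le> L2 * measure \<mu> F"
    using comparable_glue[OF qcm qcn zoom_far_comparable[OF qcn qcm E(1) Lk E(3) c limn h1]] by blast
  have "measure \<nu> F \<le> (L1 + L2) * measure \<mu> F" "measure \<mu> F \<le> (L1 + L2) * measure \<nu> F"
    if F: "F \<in> sets borel" for F
    using L1(1) L1(2)[OF F] L2(1) L2(2)[OF F]
      mult_nonneg_nonneg[of L1 "measure \<mu> F"] mult_nonneg_nonneg[of L2 "measure \<nu> F"]
    by (auto simp: distrib_right intro: order_trans)
  then show ?thesis
    using L1(1) L2(1) by (intro comparable_magnitude[OF qcm qcn pos, of "L1 + L2"]) auto
qed

end

section \<open>Assembly of the dichotomy\<close>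

lemma (in compactified_group) additive_magnitude_scaled:
  assumes "coarse_cocycle \<Gamma> \<sigma>" "magnitude_function \<Gamma> d \<sigma> N"
    and "\<And>C. finite {\<gamma>\<in>\<Gamma>. \<delta> * N \<gamma> \<le> C}"
  shows "additive_magnitude \<Gamma> d (\<lambda>\<gamma>. \<delta> * N \<gamma>)"
proof
  fix e :: real assume "e > 0"
  then obtain C where C: "\<And>\<gamma> \<theta>. \<gamma> \<in> \<Gamma> \<Longrightarrow> \<theta> \<in> \<Gamma> \<Longrightarrow> e < d (Inl \<theta>) (Inl (inv \<gamma>)) \<Longrightarrow>
      \<bar>N (\<gamma> \<circ> \<theta>) - N \<gamma> - N \<theta>\<bar> \<le> C"
    using magnitude_add[OF assms(1,2)] by metis
  show "\<exists>C. \<forall>\<gamma>\<in>\<Gamma>. \<forall>\<theta>\<in>\<Gamma>. e < d (Inl \<theta>) (Inl (inv \<gamma>)) \<longrightarrow>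
      \<bar>\<delta> * N (\<gamma> \<circ> \<theta>) - \<delta> * N \<gamma> - \<delta> * N \<theta>\<bar> \<le> C"
  proof (intro exI[of _ "\<bar>\<delta>\<bar> * C"] ballI impI)
    fix \<gamma> \<theta> assume "\<gamma> \<in> \<Gamma>" "\<theta> \<in> \<Gamma>" "e < d (Inl \<theta>) (Inl (inv \<gamma>))"
    from C[OF this] have "\<bar>\<delta>\<bar> * \<bar>N (\<gamma> \<circ> \<theta>) - N \<gamma> - N \<theta>\<bar> \<le> \<bar>\<delta>\<bar> * C"
      by (rule mult_left_mono) simp
    then show "\<bar>\<delta> * N (\<gamma> \<circ> \<theta>) - \<delta> * N \<gamma> - \<delta> * N \<theta>\<bar> \<le> \<bar>\<delta>\<bar> * C"
      by (simp flip: abs_mult add: right_diff_distrib)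
  qed
qed (use assms(3) in simp)

lemma infsum_ennreal_infinite_sums:
  fixes f :: "'b \<Rightarrow> real"
  assumes "\<And>x. x \<in> A \<Longrightarrow> 0 \<le> f x" and inf: "(\<Sum>\<^sub>\<infinity>x\<in>A. ennreal (f x)) = \<infinity>"
  shows "\<exists>F\<subseteq>A. finite F \<and> B \<le> sum f F"
proof -
  have "(SUP F\<in>{F. finite F \<and> F \<subseteq> A}. \<Sum>x\<in>F. ennreal (f x)) = \<infinity>"
    using inf by (subst (asm) nonneg_infsum_complete) auto
  then have "ennreal B < (SUP F\<in>{F. finite F \<and> F \<subseteq> A}. \<Sum>x\<in>F. ennreal (f x))"
    by (simp only:) (simp add: less_top[symmetric])
  then obtain F where F: "finite F" "F \<subseteq> A" "ennreal B < (\<Sum>x\<in>F. ennreal (f x))"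
    by (auto simp: less_SUP_iff)
  then have "ennreal B < ennreal (sum f F)" using assms(1) by (subst (asm) sum_ennreal) auto
  then have "B \<le> sum f F" by (metis ennreal_leI linorder_not_le nle_le)
  then show ?thesis using F by blast
qed

theorem proposition1p4:
  fixes \<Gamma> :: "('m::metric_space \<Rightarrow> 'm) set"
    and d :: "('m \<Rightarrow> 'm) + 'm \<Rightarrow> ('m \<Rightarrow> 'm) + 'm \<Rightarrow> real"
    and \<sigma>1 \<sigma>2 :: "('m \<Rightarrow> 'm) \<Rightarrow> 'm \<Rightarrow> real"
    and N1 N2 :: "('m \<Rightarrow> 'm) \<Rightarrow> real"
    and \<mu>1 \<mu>2 :: "'m measure"
    and \<delta>1 \<delta>2 :: real
  assumes "compact (UNIV :: 'm set)"
    and "convergence_group \<Gamma>" and "non_elementary \<Gamma>"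
    and "compatible_metric \<Gamma> d"
    and "expanding_coarse_cocycle \<Gamma> d \<sigma>1" and "magnitude_function \<Gamma> d \<sigma>1 N1"
    and "expanding_coarse_cocycle \<Gamma> d \<sigma>2" and "magnitude_function \<Gamma> d \<sigma>2 N2"
    and "coarse_PS_measure \<Gamma> \<sigma>1 \<delta>1 \<mu>1"
    and "coarse_PS_measure \<Gamma> \<sigma>2 \<delta>2 \<mu>2"
    and "(\<Sum>\<^sub>\<infinity>\<gamma>\<in>\<Gamma>. ennreal (exp (- \<delta>1 * N1 \<gamma>))) = \<infinity>"
  shows "mutually_singular \<mu>1 \<mu>2 \<or>
    (absolutely_continuous \<mu>2 \<mu>1 \<and> absolutely_continuous \<mu>1 \<mu>2 \<and>
     (SUP \<gamma>\<in>\<Gamma>. ereal \<bar>\<delta>1 * N1 \<gamma> - \<delta>2 * N2 \<gamma>\<bar>) < \<infinity>)"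
proof (cases "mutually_singular \<mu>1 \<mu>2")
  case not_singular: False
  interpret compactified_group \<Gamma> d by standard (fact assms)+
  let ?n1 = "\<lambda>\<gamma>. \<delta>1 * N1 \<gamma>" and ?n2 = "\<lambda>\<gamma>. \<delta>2 * N2 \<gamma>"
  have qc1: "quasi_conformal \<mu>1 ?n1" by (rule PS_quasi_conformal[OF assms(9,6)])
  have qc2: "quasi_conformal \<mu>2 ?n2" by (rule PS_quasi_conformal[OF assms(10,8)])
  note fm1 = quasi_conformal_finite[OF qc1] and fm2 = quasi_conformal_finite[OF qc2]
  note sets1 = quasi_conformal_sets[OF qc1] and sets2 = quasi_conformal_sets[OF qc2]
  have em1: "emeasure \<mu>1 F = ennreal (measure \<mu>1 F)" and em2: "emeasure \<mu>2 F = ennreal (measure \<mu>2 F)" for F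
    using finite_measure.emeasure_eq_measure[OF fm1] finite_measure.emeasure_eq_measure[OF fm2] by auto
  have tot1: "measure \<mu>1 UNIV = 1"
    using assms(9) by (auto simp: coarse_PS_measure_def PS_measure_const_def measure_def)
  have co: "coarse_cocycle \<Gamma> \<sigma>1" "coarse_cocycle \<Gamma> \<sigma>2"
    using assms(5,7) by (auto simp: expanding_coarse_cocycle_def)
  have fin1: "finite {\<gamma>\<in>\<Gamma>. N1 \<gamma> \<le> C}" for C by (rule magnitude_proper[OF assms(5,6)])
  \<comment> \<open>The unscaled magnitude comes first: \<open>dimension_pos\<close> then gives the
    sign of \<open>\<delta>1\<close>, from which properness of \<open>?n1\<close> follows.\<close>
  interpret U: additive_magnitude \<Gamma> d N1
    using additive_magnitude_scaled[OF co(1) assms(6), of 1] fin1 by simp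
  have \<delta>1: "\<delta>1 > 0" by (rule U.dimension_pos[OF qc1]) (simp add: tot1)
  have fin1': "finite {\<gamma>\<in>\<Gamma>. ?n1 \<gamma> \<le> C}" for C
    using fin1[of "C / \<delta>1"] \<delta>1 by (simp add: field_simps)
  interpret A1: additive_magnitude \<Gamma> d ?n1
    by (rule additive_magnitude_scaled[OF co(1) assms(6) fin1'])
  have div1: "\<exists>F\<subseteq>\<Gamma>. finite F \<and> B \<le> (\<Sum>\<gamma>\<in>F. exp (- ?n1 \<gamma>))" for B
    using infsum_ennreal_infinite_sums[of \<Gamma> "\<lambda>\<gamma>. exp (- ?n1 \<gamma>)" B] assms(11) by simp
  \<comment> \<open>\<open>B\<close> carries the part of \<open>\<mu>1\<close> singular to
    \<open>\<mu>2\<close>. By ergodicity it has full or zero \<open>\<mu>1\<close>-mass, and full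
    mass would mean mutual singularity.\<close>
  obtain B where B: "B \<in> sets borel" "\<forall>\<gamma>\<in>\<Gamma>. \<gamma> ` B = B" "measure \<mu>2 B = 0"
    "\<And>F. F \<in> sets borel \<Longrightarrow> measure \<mu>2 F = 0 \<Longrightarrow> measure \<mu>1 (F - B) = 0"
    using A1.max_invariant_null_set[OF qc1 qc2] by metis
  have B0: "measure \<mu>1 B = 0"
  proof (rule ccontr)
    assume "measure \<mu>1 B \<noteq> 0"
    then have "measure \<mu>1 B > 0" by (simp add: less_le)
    then have "measure \<mu>1 (- B) = 0" by (rule A1.ergodic[OF qc1 div1 B(1,2)])
    then have "mutually_singular \<mu>1 \<mu>2"
      unfolding mutually_singular_def using B(1,3) by (intro bexI[of _ "- B"]) (auto simp: em1 em2)
    then show False using not_singular by simp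
  qed
  have null12: "measure \<mu>1 F = 0" if F: "F \<in> sets borel" "measure \<mu>2 F = 0" for F
  proof -
    have "measure \<mu>1 F \<le> measure \<mu>1 ((F - B) \<union> B)"
      by (rule finite_measure.finite_measure_mono[OF fm1]) (use F B(1) sets1 in auto)
    also have "\<dots> \<le> measure \<mu>1 (F - B) + measure \<mu>1 B"
      by (rule measure_Un_le) (use F B(1) sets1 in auto)
    finally show ?thesis using B(4)[OF F] B0 measure_nonneg[of \<mu>1 F] by linarith
  qed
  \<comment> \<open>The reverse singular part cannot be treated the same way yet, since ergodicity
    of \<open>\<mu>2\<close> has to wait for divergence of its series. It is cut off instead:
    \<open>\<mu>2\<close> restricted to the complement of \<open>A\<close> has the same null sets as
    \<open>\<mu>1\<close>, and comparison with it bounds the magnitudes.\<close>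
  obtain A where A: "A \<in> sets borel" "\<forall>\<gamma>\<in>\<Gamma>. \<gamma> ` A = A" "measure \<mu>1 A = 0"
    "\<And>F. F \<in> sets borel \<Longrightarrow> measure \<mu>1 F = 0 \<Longrightarrow> measure \<mu>2 (F - A) = 0"
    using A1.max_invariant_null_set[OF qc2 qc1] by metis
  have cA: "- A \<in> sets borel" using A(1) by auto
  note rA = quasi_conformal_restrict[OF qc2 cA invariant_Compl[OF A(2)]]
  have null: "measure \<mu>1 F = 0 \<longleftrightarrow> measure (density \<mu>2 (indicator (- A))) F = 0" if F: "F \<in> sets borel" for F
  proof -
    have eq: "measure (density \<mu>2 (indicator (- A))) F = measure \<mu>2 (F - A)"
      using rA(2)[OF F] by (simp add: Diff_eq Int_commute)
    have FA: "F - A \<in> sets borel" using F A(1) by auto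
    have "measure \<mu>1 F \<le> measure \<mu>1 ((F - A) \<union> A)"
      by (rule finite_measure.finite_measure_mono[OF fm1]) (use F A(1) sets1 in auto)
    also have "\<dots> \<le> measure \<mu>1 (F - A) + measure \<mu>1 A"
      by (rule measure_Un_le) (use F A(1) sets1 in auto)
    finally have "measure \<mu>1 F \<le> measure \<mu>1 (F - A)" using A(3) by simp
    then show ?thesis
      using A(4)[OF F] null12[OF FA] measure_nonneg[of \<mu>1 F] unfolding eq by linarith
  qed
  obtain K where K: "\<And>\<gamma>. \<gamma> \<in> \<Gamma> \<Longrightarrow> \<bar>?n1 \<gamma> - ?n2 \<gamma>\<bar> \<le> K"
    using A1.equivalent_magnitudes[OF qc1 rA(1) div1 _ null] tot1 by auto
  \<comment> \<open>Properness and divergence for the second measure are both inherited from the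
    first through \<open>K\<close>.\<close>
  have "{\<gamma>\<in>\<Gamma>. ?n2 \<gamma> \<le> C} \<subseteq> {\<gamma>\<in>\<Gamma>. ?n1 \<gamma> \<le> C + K}" for C
    using K by (force simp: abs_le_iff)
  then have fin2: "finite {\<gamma>\<in>\<Gamma>. ?n2 \<gamma> \<le> C}" for C
    using fin1' finite_subset by blast
  interpret A2: additive_magnitude \<Gamma> d ?n2
    by (rule additive_magnitude_scaled[OF co(2) assms(8) fin2])
  have div2: "\<exists>F\<subseteq>\<Gamma>. finite F \<and> B \<le> (\<Sum>\<gamma>\<in>F. exp (- ?n2 \<gamma>))" for B
  proof -
    obtain F where F: "F \<subseteq> \<Gamma>" "finite F" "B * exp K \<le> (\<Sum>\<gamma>\<in>F. exp (- ?n1 \<gamma>))" using div1 by blast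
    have "(\<Sum>\<gamma>\<in>F. exp (- ?n1 \<gamma>)) \<le> (\<Sum>\<gamma>\<in>F. exp K * exp (- ?n2 \<gamma>))"
    proof (rule sum_mono)
      fix \<gamma> assume "\<gamma> \<in> F"
      then have "- ?n1 \<gamma> \<le> K + - ?n2 \<gamma>" using K[of \<gamma>] F(1) by auto
      then have "exp (- ?n1 \<gamma>) \<le> exp (K + - ?n2 \<gamma>)" by simp
      then show "exp (- ?n1 \<gamma>) \<le> exp K * exp (- ?n2 \<gamma>)" by (simp only: exp_add)
    qed
    then have "exp K * B \<le> exp K * (\<Sum>\<gamma>\<in>F. exp (- ?n2 \<gamma>))"
      using F(3) unfolding sum_distrib_left[symmetric] by (simp only: mult.commute[of B])
    then have "B \<le> (\<Sum>\<gamma>\<in>F. exp (- ?n2 \<gamma>))" by simp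
    then show ?thesis using F by blast
  qed
  \<comment> \<open>Now \<open>\<mu>2\<close> is ergodic too. Were \<open>A\<close> charged, its
    complement would be null and the restriction zero, although it has the null sets of the nonzero
    measure \<open>\<mu>1\<close>.\<close>
  have A0: "measure \<mu>2 A = 0"
  proof (rule ccontr)
    assume "measure \<mu>2 A \<noteq> 0"
    then have "measure \<mu>2 A > 0" by (simp add: less_le)
    then have "measure \<mu>2 (- A) = 0" by (rule A2.ergodic[OF qc2 div2 A(1,2)])
    then show False using null[of UNIV] rA(2)[of UNIV] tot1 by simp
  qed
  have null21: "measure \<mu>2 F = 0" if F: "F \<in> sets borel" "measure \<mu>1 F = 0" for F
  proof -
    have "measure \<mu>2 F \<le> measure \<mu>2 ((F - A) \<union> A)"
      by (rule finite_measure.finite_measure_mono[OF fm2]) (use F A(1) sets2 in auto)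
    also have "\<dots> \<le> measure \<mu>2 (F - A) + measure \<mu>2 A"
      by (rule measure_Un_le) (use F A(1) sets2 in auto)
    finally show ?thesis using A(4)[OF F] A0 measure_nonneg[of \<mu>2 F] by linarith
  qed
  have "absolutely_continuous \<mu>2 \<mu>1" "absolutely_continuous \<mu>1 \<mu>2"
    unfolding absolutely_continuous_def using null12 null21 
    by (auto simp: null_sets_def sets1 sets2 em1 em2)
  moreover have "(SUP \<gamma>\<in>\<Gamma>. ereal \<bar>?n1 \<gamma> - ?n2 \<gamma>\<bar>) \<le> ereal K"
    by (rule SUP_least) (use K in simp)
  then have "(SUP \<gamma>\<in>\<Gamma>. ereal \<bar>?n1 \<gamma> - ?n2 \<gamma>\<bar>) < \<infinity>"
    by (rule le_less_trans) simp
  ultimately show ?thesis by blast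
qed simp

end
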